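(* The representation $\widetilde P_4$ of the universal covering $\widetilde Q_3$ of the $3$-Kronecker quiver (defined in the context) is accessible.
   Context: Let $k$ be an algebraically closed field; all representations are finite-dimensional over $k$. $Q_3$ is the quiver with two vertices and three arrows from the first to the second. Its universal covering $\widetilde Q_3$ is the (infinite) quiver whose underlying graph is the $3$-regular tree, oriented such that every vertex is a source or a sink. $\widetilde Q_3^{op}$ is the opposite quiver. Fix a sink $s$ of $\widetilde Q_3$. Reflection functor $\widetilde\sigma^-$ at all sources: let $Q$ be $\widetilde Q_3$ or $\widetilde Q_3^{op}$. For a representation $M$ of $Q$, $\widetilde\sigma^-(M)$ is the following representation of $Q^{op}$: for every sink $t$ of $Q$, $\widetilde\sigma^-(M)(t)=M(t)$; for every source $q$ of $Q$ with outgoing arrows $\alpha_i:q\to t_i$ ($i=1,2,3$), $\widetilde\sigma^-(M)(q)$ is the cokernel of the map $M(q)\to\bigoplus_{i=1}^3M(t_i)$ with components $M(\alpha_i)$, and the reversed arrow $t_i\to q$ is represented by the composition $M(t_i)\to\bigoplus_jM(t_j)\to\widetilde\sigma^-(M)(q)$. Put $\widetilde P_0=E_s$ (the simple representation of $\widetilde Q_3$ at $s$) and $\widetilde P_i=\widetilde\sigma^-(\widetilde P_{i-1})$ for $i\ge1$. So $\widetilde P_i$ is a representation of $\widetilde Q_3$ for even $i$ and of $\widetilde Q_3^{op}$ for odd $i$. Accessible representations are defined inductively: every simple representation is accessible; a representation $M$ of length $l>1$ is accessible if $M$ is indecomposable and has an accessible subrepresentation or factor representation of length $l-1$. *)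

theory Defs
  imports
    "HOL-Computational_Algebra.Polynomial"
    "HOL-Library.Function_Algebras"
    "Graph_Theory.Digraph_Component"
    "Graph_Theory.Vertex_Walk"
begin

section \<open>Quivers\<close>

text \<open>
  A quiver is a (possibly infinite) \<open>pre_digraph\<close> with explicit arcs.
\<close>

definition opposite :: "('v, 'e) pre_digraph \<Rightarrow> ('v, 'e) pre_digraph" where
  "opposite Q = \<lparr>verts = verts Q, arcs = arcs Q, tail = head Q, head = tail Q\<rparr>"

definition is_source :: "('v, 'e) pre_digraph \<Rightarrow> 'v \<Rightarrow> bool" where
  "is_source Q v \<longleftrightarrow> v \<in> verts Q \<and> in_arcs Q v = {}"

definition is_sink :: "('v, 'e) pre_digraph \<Rightarrow> 'v \<Rightarrow> bool" where
  "is_sink Q v \<longleftrightarrow> v \<in> verts Q \<and> out_arcs Q v = {}"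

text \<open>
  The underlying graph is a tree: no loops, no parallel arcs, and any two vertices are joined by
  exactly one path that may traverse arcs in either direction. (The library constant \<open>tree\<close> only
  excludes directed cycles, so it is not the right notion here.) A pair of opposite
  arcs would also give parallel edges in the underlying graph, but this cannot happen when every
  vertex is a source or a sink, the only case considered below.
\<close>

definition is_tree_quiver :: "('v, 'e) pre_digraph \<Rightarrow> bool" where
  "is_tree_quiver Q \<longleftrightarrow>
     loopfree_digraph Q \<and> nomulti_digraph Q \<and> verts Q \<noteq> {} \<and>
     (\<forall>u\<in>verts Q. \<forall>v\<in>verts Q.
        \<exists>!p. vpath p (with_proj (mk_symmetric Q)) \<and> hd p = u \<and> last p = v)"

text \<open>
  The universal covering of the 3-Kronecker quiver: its underlying graph is the 3-regular tree and
  every vertex is a source or a sink. This determines the quiver up to isomorphism.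
  The cardinality condition also forces the set of arcs at \<open>v\<close> to be finite.
\<close>

definition universal_cover_3_Kronecker :: "('v, 'e) pre_digraph \<Rightarrow> bool" where
  "universal_cover_3_Kronecker Q \<longleftrightarrow>
     is_tree_quiver Q \<and>
     (\<forall>v\<in>verts Q. card (in_arcs Q v \<union> out_arcs Q v) = 3) \<and>
     (\<forall>v\<in>verts Q. is_source Q v \<or> is_sink Q v)"


section \<open>Ambient vector spaces\<close>

text \<open>
  All vector spaces of a representation are finite-dimensional subspaces of the function space
  \<open>nat \<Rightarrow> 'k\<close>. Up to isomorphism this is no restriction.
  Direct sums of such spaces live in \<open>'e \<Rightarrow> nat \<Rightarrow> 'k\<close>.
\<close>

definition kscale :: "'k::field \<Rightarrow> (nat \<Rightarrow> 'k) \<Rightarrow> (nat \<Rightarrow> 'k)" where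
  "kscale c x = (\<lambda>i. c * x i)"

definition sscale :: "'k::field \<Rightarrow> ('e \<Rightarrow> nat \<Rightarrow> 'k) \<Rightarrow> ('e \<Rightarrow> nat \<Rightarrow> 'k)" where
  "sscale c g = (\<lambda>a. kscale c (g a))"

interpretation kvec: vector_space "kscale :: 'k::field \<Rightarrow> (nat \<Rightarrow> 'k) \<Rightarrow> (nat \<Rightarrow> 'k)"
  by unfold_locales (auto simp: kscale_def fun_eq_iff algebra_simps)

interpretation svec: vector_space "sscale :: 'k::field \<Rightarrow> ('e \<Rightarrow> nat \<Rightarrow> 'k) \<Rightarrow> ('e \<Rightarrow> nat \<Rightarrow> 'k)"
  by unfold_locales (auto simp: sscale_def kscale_def fun_eq_iff algebra_simps)

text \<open>The library's \<open>linear\<close> is about total maps; here only the values on \<open>S\<close> matter.\<close>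

definition linear_on ::
  "('k \<Rightarrow> 'a \<Rightarrow> 'a) \<Rightarrow> ('k \<Rightarrow> 'b \<Rightarrow> 'b) \<Rightarrow> 'a::ab_group_add set \<Rightarrow> ('a \<Rightarrow> 'b::ab_group_add) \<Rightarrow> bool"
  where
  "linear_on s1 s2 S f \<longleftrightarrow>
     (\<forall>x\<in>S. \<forall>y\<in>S. f (x + y) = f x + f y) \<and> (\<forall>c. \<forall>x\<in>S. f (s1 c x) = s2 c (f x))"


section \<open>Representations\<close>

record ('v, 'e, 'k) rep =
  rspace :: "'v \<Rightarrow> (nat \<Rightarrow> 'k) set"
  rmap :: "'e \<Rightarrow> (nat \<Rightarrow> 'k) \<Rightarrow> (nat \<Rightarrow> 'k)"

text \<open>
  Finite-dimensional representations. Values of \<open>rspace\<close> outside \<open>verts Q\<close>, of \<open>rmap\<close> outside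
  \<open>arcs Q\<close>, and of \<open>rmap M a\<close> outside the space at the tail of \<open>a\<close>, are irrelevant.
\<close>

definition is_rep :: "('v, 'e) pre_digraph \<Rightarrow> ('v, 'e, 'k::field) rep \<Rightarrow> bool" where
  "is_rep Q M \<longleftrightarrow>
     (\<forall>v\<in>verts Q. \<exists>B. finite B \<and> rspace M v = kvec.span B) \<and>
     finite {v \<in> verts Q. rspace M v \<noteq> {0}} \<and>
     (\<forall>a\<in>arcs Q. linear_on kscale kscale (rspace M (tail Q a)) (rmap M a) \<and>
        rmap M a ` rspace M (tail Q a) \<subseteq> rspace M (head Q a))"

definition rep_hom ::
  "('v, 'e) pre_digraph \<Rightarrow> ('v, 'e, 'k::field) rep \<Rightarrow> ('v, 'e, 'k) rep \<Rightarrow>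
   ('v \<Rightarrow> (nat \<Rightarrow> 'k) \<Rightarrow> (nat \<Rightarrow> 'k)) \<Rightarrow> bool" where
  "rep_hom Q M N \<phi> \<longleftrightarrow>
     (\<forall>v\<in>verts Q. linear_on kscale kscale (rspace M v) (\<phi> v) \<and> \<phi> v ` rspace M v \<subseteq> rspace N v) \<and>
     (\<forall>a\<in>arcs Q. \<forall>x\<in>rspace M (tail Q a).
        \<phi> (head Q a) (rmap M a x) = rmap N a (\<phi> (tail Q a) x))"

text \<open>
  A subrepresentation is given by its family \<open>U\<close> of subspaces; as a representation it is
  \<open>M\<lparr>rspace := U\<rparr>\<close>, which has the same maps as \<open>M\<close>.
\<close>

definition is_subrep ::
  "('v, 'e) pre_digraph \<Rightarrow> ('v, 'e, 'k::field) rep \<Rightarrow> ('v \<Rightarrow> (nat \<Rightarrow> 'k) set) \<Rightarrow> bool" where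
  "is_subrep Q M U \<longleftrightarrow>
     (\<forall>v\<in>verts Q. kvec.subspace (U v) \<and> U v \<subseteq> rspace M v) \<and>
     (\<forall>a\<in>arcs Q. rmap M a ` U (tail Q a) \<subseteq> U (head Q a))"

text \<open>Factor representations are taken up to isomorphism, as targets of epimorphisms.\<close>

definition is_factor_rep ::
  "('v, 'e) pre_digraph \<Rightarrow> ('v, 'e, 'k::field) rep \<Rightarrow> ('v, 'e, 'k) rep \<Rightarrow> bool" where
  "is_factor_rep Q M N \<longleftrightarrow>
     is_rep Q N \<and> (\<exists>\<phi>. rep_hom Q M N \<phi> \<and> (\<forall>v\<in>verts Q. \<phi> v ` rspace M v = rspace N v))"

definition family_le ::
  "('v, 'e) pre_digraph \<Rightarrow> ('v \<Rightarrow> (nat \<Rightarrow> 'k) set) \<Rightarrow> ('v \<Rightarrow> (nat \<Rightarrow> 'k) set) \<Rightarrow> bool" where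
  "family_le Q U W \<longleftrightarrow> (\<forall>v\<in>verts Q. U v \<subseteq> W v)"

definition family_eq ::
  "('v, 'e) pre_digraph \<Rightarrow> ('v \<Rightarrow> (nat \<Rightarrow> 'k) set) \<Rightarrow> ('v \<Rightarrow> (nat \<Rightarrow> 'k) set) \<Rightarrow> bool" where
  "family_eq Q U W \<longleftrightarrow> (\<forall>v\<in>verts Q. U v = W v)"

definition zero_family :: "'v \<Rightarrow> (nat \<Rightarrow> 'k::field) set" where
  "zero_family = (\<lambda>v. {0})"

definition simple_rep :: "('v, 'e) pre_digraph \<Rightarrow> ('v, 'e, 'k::field) rep \<Rightarrow> bool" where
  "simple_rep Q M \<longleftrightarrow>
     is_rep Q M \<and> \<not> family_eq Q (rspace M) zero_family \<and>
     (\<forall>U. is_subrep Q M U \<longrightarrow> family_eq Q U zero_family \<or> family_eq Q U (rspace M))"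

definition indecomposable :: "('v, 'e) pre_digraph \<Rightarrow> ('v, 'e, 'k::field) rep \<Rightarrow> bool" where
  "indecomposable Q M \<longleftrightarrow>
     is_rep Q M \<and> \<not> family_eq Q (rspace M) zero_family \<and>
     (\<forall>U W. is_subrep Q M U \<longrightarrow> is_subrep Q M W \<longrightarrow>
        (\<forall>v\<in>verts Q. U v \<inter> W v = {0} \<and> rspace M v = {x + y | x y. x \<in> U v \<and> y \<in> W v}) \<longrightarrow>
        family_eq Q U zero_family \<or> family_eq Q W zero_family)"

text \<open>
  \<open>M\<close> has length \<open>n\<close>: there is a composition series
  \<open>0 = U 0 \<subset> U 1 \<subset> \<dots> \<subset> U n = M\<close>, each \<open>U i\<close> being maximal in \<open>U (Suc i)\<close>.
  By the Jordan-Hoelder theorem, \<open>n\<close> is determined by \<open>M\<close>.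
\<close>

definition has_length :: "('v, 'e) pre_digraph \<Rightarrow> ('v, 'e, 'k::field) rep \<Rightarrow> nat \<Rightarrow> bool" where
  "has_length Q M n \<longleftrightarrow>
     (\<exists>U. (\<forall>i\<le>n. is_subrep Q M (U i)) \<and>
          family_eq Q (U 0) zero_family \<and> family_eq Q (U n) (rspace M) \<and>
          (\<forall>i<n. family_le Q (U i) (U (Suc i)) \<and> \<not> family_eq Q (U i) (U (Suc i)) \<and>
             (\<forall>W. is_subrep Q M W \<longrightarrow> family_le Q (U i) W \<longrightarrow> family_le Q W (U (Suc i)) \<longrightarrow>
                family_eq Q W (U i) \<or> family_eq Q W (U (Suc i)))))"

inductive accessible :: "('v, 'e) pre_digraph \<Rightarrow> ('v, 'e, 'k::field) rep \<Rightarrow> bool"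
  for Q :: "('v, 'e) pre_digraph" where
  simple: "simple_rep Q M \<Longrightarrow> accessible Q M"
| sub: "\<lbrakk>has_length Q M l; l > 1; indecomposable Q M; is_subrep Q M U;
         has_length Q (M\<lparr>rspace := U\<rparr>) (l - 1); accessible Q (M\<lparr>rspace := U\<rparr>)\<rbrakk>
        \<Longrightarrow> accessible Q M"
| factor: "\<lbrakk>has_length Q M l; l > 1; indecomposable Q M; is_factor_rep Q M N;
            has_length Q N (l - 1); accessible Q N\<rbrakk>
        \<Longrightarrow> accessible Q M"


section \<open>The reflection functor at all sources\<close>

text \<open>The direct sum of the spaces at the heads of the arcs starting in \<open>q\<close>.\<close>

definition out_sum ::
  "('v, 'e) pre_digraph \<Rightarrow> ('v, 'e, 'k::field) rep \<Rightarrow> 'v \<Rightarrow> ('e \<Rightarrow> nat \<Rightarrow> 'k) set" where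
  "out_sum Q M q = {g. (\<forall>a\<in>out_arcs Q q. g a \<in> rspace M (head Q a)) \<and> (\<forall>a. a \<notin> out_arcs Q q \<longrightarrow> g a = 0)}"

definition out_map ::
  "('v, 'e) pre_digraph \<Rightarrow> ('v, 'e, 'k::field) rep \<Rightarrow> 'v \<Rightarrow> (nat \<Rightarrow> 'k) \<Rightarrow> ('e \<Rightarrow> nat \<Rightarrow> 'k)" where
  "out_map Q M q x = (\<lambda>a. if a \<in> out_arcs Q q then rmap M a x else 0)"

text \<open>
  The cokernel of \<open>out_map\<close>, defined up to isomorphism only, is realised inside \<open>nat \<Rightarrow> 'k\<close>:
  we choose a linear map \<open>p\<close> on the direct sum with kernel the image of \<open>out_map\<close>. The image of \<open>p\<close>
  is then the cokernel and \<open>p\<close> is the projection onto it. Such a \<open>p\<close> exists by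
  \<open>coker_proj_exists\<close> below.
\<close>

definition is_coker_proj ::
  "('v, 'e) pre_digraph \<Rightarrow> ('v, 'e, 'k::field) rep \<Rightarrow> 'v \<Rightarrow> (('e \<Rightarrow> nat \<Rightarrow> 'k) \<Rightarrow> (nat \<Rightarrow> 'k)) \<Rightarrow> bool"
  where
  "is_coker_proj Q M q p \<longleftrightarrow>
     linear_on sscale kscale (out_sum Q M q) p \<and>
     {g \<in> out_sum Q M q. p g = 0} = out_map Q M q ` rspace M q"

definition coker_proj ::
  "('v, 'e) pre_digraph \<Rightarrow> ('v, 'e, 'k::field) rep \<Rightarrow> 'v \<Rightarrow> ('e \<Rightarrow> nat \<Rightarrow> 'k) \<Rightarrow> (nat \<Rightarrow> 'k)" where
  "coker_proj Q M q = (SOME p. is_coker_proj Q M q p)"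

lemma exists_map_with_kernel:
  fixes W I :: "('e \<Rightarrow> nat \<Rightarrow> 'k::field) set"
  assumes W: "finite T" "W \<subseteq> svec.span T" "svec.subspace W" and I: "svec.subspace I" "I \<subseteq> W"
  shows "\<exists>p. linear_on sscale kscale W p \<and> {g \<in> W. p g = 0} = I"
proof -
  obtain B0 where B0: "B0 \<subseteq> I" "svec.independent B0" "I \<subseteq> svec.span B0"
    using svec.maximal_independent_subset by blast
  obtain B where B: "B0 \<subseteq> B" "B \<subseteq> W" "svec.independent B" "W \<subseteq> svec.span B"
    using svec.maximal_independent_subset_extend[of B0 W] B0 I by blast
  have spI: "svec.span B0 = I"
    using B0 I by (meson subset_antisym svec.span_minimal)
  have "finite B"
    using svec.independent_span_bound[OF W(1) B(3)] B(2) W(2) by blast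
  then obtain h n where h: "B - B0 = h ` {i::nat. i < n}"
    using finite_imp_nat_seg_image_inj_on[of "B - B0"] by auto
  define R where "R = svec.representation B"
  define p :: "('e \<Rightarrow> nat \<Rightarrow> 'k) \<Rightarrow> nat \<Rightarrow> 'k" where "p x = (\<lambda>i. if i < n then R x (h i) else 0)" for x
  have lin: "linear_on sscale kscale W p"
    unfolding linear_on_def
  proof (intro conjI ballI allI)
    fix x y assume "x \<in> W" "y \<in> W"
    then show "p (x + y) = p x + p y"
      using B by (auto simp: p_def R_def svec.representation_add subset_iff fun_eq_iff)
  next
    fix c x assume "x \<in> W"
    then show "p (sscale c x) = kscale c (p x)"
      using B by (auto simp: p_def R_def svec.representation_scale subset_iff fun_eq_iff kscale_def)
  qed
  have "p x = 0 \<longleftrightarrow> x \<in> I" if x: "x \<in> W" for x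
  proof
    assume 0: "p x = 0"
    have "R x b = 0" if b: "b \<in> B - B0" for b
    proof -
      obtain i where "i < n" "b = h i" using b h by auto
      moreover have "p x i = 0" using 0 by simp
      ultimately show ?thesis by (simp add: p_def)
    qed
    then have "{b. R x b \<noteq> 0} \<subseteq> B0"
      using svec.representation_ne_zero[of B x] unfolding R_def by blast
    moreover have "(\<Sum>b | R x b \<noteq> 0. sscale (R x b) b) = x"
      unfolding R_def using B x by (intro svec.sum_nonzero_representation_eq) auto
    ultimately show "x \<in> I"
      using spI svec.span_sum[of "{b. R x b \<noteq> 0}" "\<lambda>b. sscale (R x b) b" B0]
        svec.span_scale svec.span_base by (metis (no_types, lifting) subsetD)
  next
    assume "x \<in> I"
    then have "R x = svec.representation B0 x"
      unfolding R_def using svec.representation_extend[OF B(3), of x B0] B spI by auto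
    then have "R x b = 0" if "b \<in> B - B0" for b
      using svec.representation_ne_zero[of B0 x b] that by auto
    then show "p x = 0"
      using h by (auto simp: p_def fun_eq_iff)
  qed
  then show ?thesis using lin I by blast
qed

lemma coker_proj_exists:
  assumes Q: "wf_digraph Q" "finite (out_arcs Q q)" "q \<in> verts Q" and M: "is_rep Q M"
  shows "is_coker_proj Q M q (coker_proj Q M q)"
proof -
  have "\<forall>a\<in>out_arcs Q q. \<exists>B. finite B \<and> rspace M (head Q a) = kvec.span B"
    using M wf_digraph.head_in_verts[OF Q(1)] unfolding is_rep_def by auto
  then obtain B where B: "\<forall>a\<in>out_arcs Q q. finite (B a) \<and> rspace M (head Q a) = kvec.span (B a)"
    by metis
  then have sub: "kvec.subspace (rspace M (head Q a))" if "a \<in> out_arcs Q q" for a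
    using that by simp
  define j :: "'b \<Rightarrow> (nat \<Rightarrow> 'c) \<Rightarrow> 'b \<Rightarrow> nat \<Rightarrow> 'c" where
    "j a x = (\<lambda>b. if b = a then x else 0)" for a x
  define T where "T = (\<Union>a\<in>out_arcs Q q. j a ` B a)"
  have sW: "svec.subspace (out_sum Q M q)"
    unfolding svec.subspace_def out_sum_def using sub
    by (auto simp: sscale_def kvec.subspace_0 kvec.subspace_add kvec.subspace_scale)
  have fT: "finite T" unfolding T_def using Q B by auto
  have jspan: "j a x \<in> svec.span T" if a: "a \<in> out_arcs Q q" and x: "x \<in> kvec.span (B a)" for a x
    using x
  proof (induction rule: kvec.span_induct_alt)
    case base
    have "j a 0 = 0" by (auto simp: j_def fun_eq_iff)
    then show ?case by (metis svec.span_zero)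
  next
    case (step c x y)
    have "j a (kscale c x + y) = sscale c (j a x) + j a y"
      by (auto simp: j_def sscale_def fun_eq_iff)
    moreover have "j a x \<in> svec.span T"
      using step a by (auto simp: T_def intro!: svec.span_base)
    ultimately show ?case using step(2) by (metis svec.span_add svec.span_scale)
  qed
  have WT: "out_sum Q M q \<subseteq> svec.span T"
  proof
    fix g assume g: "g \<in> out_sum Q M q"
    have "g = (\<Sum>a\<in>out_arcs Q q. j a (g a))"
    proof
      fix b
      have "(\<Sum>a\<in>out_arcs Q q. j a (g a)) b = (\<Sum>a\<in>out_arcs Q q. j a (g a) b)"
        using Q(2) by (induction rule: finite_induct) auto
      also have "\<dots> = g b"
        using Q(2) g by (auto simp: j_def out_sum_def)
      finally show "g b = (\<Sum>a\<in>out_arcs Q q. j a (g a)) b" by simp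
    qed
    moreover have "(\<Sum>a\<in>out_arcs Q q. j a (g a)) \<in> svec.span T"
      using g B by (intro svec.span_sum jspan) (auto simp: out_sum_def)
    ultimately show "g \<in> svec.span T" by simp
  qed
  have arc: "linear_on kscale kscale (rspace M q) (rmap M a)"
       "rmap M a ` rspace M q \<subseteq> rspace M (head Q a)" if "a \<in> out_arcs Q q" for a
  proof -
    have "a \<in> arcs Q" "tail Q a = q" using that by auto
    then show "linear_on kscale kscale (rspace M q) (rmap M a)"
       "rmap M a ` rspace M q \<subseteq> rspace M (head Q a)"
      using M unfolding is_rep_def by blast+
  qed
  have sq: "kvec.subspace (rspace M q)"
    using M Q unfolding is_rep_def by (metis kvec.subspace_span)
  have sI: "svec.subspace (out_map Q M q ` rspace M q)"
    unfolding svec.subspace_def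
  proof (intro conjI ballI allI)
    have "rmap M a 0 = 0" if "a \<in> out_arcs Q q" for a
      using arc(1)[OF that] kvec.subspace_0[OF sq] unfolding linear_on_def
      by (metis add_cancel_right_right)
    then have "out_map Q M q 0 = 0" by (auto simp: out_map_def fun_eq_iff)
    then show "0 \<in> out_map Q M q ` rspace M q"
      using kvec.subspace_0[OF sq] by (metis imageI)
  next
    fix g h assume "g \<in> out_map Q M q ` rspace M q" "h \<in> out_map Q M q ` rspace M q"
    then obtain x y where xy: "x \<in> rspace M q" "y \<in> rspace M q" "g = out_map Q M q x" "h = out_map Q M q y"
      by auto
    have "g + h = out_map Q M q (x + y)"
      unfolding xy(3,4) by (rule ext) (use arc(1) xy(1,2) in \<open>simp add: out_map_def linear_on_def\<close>)
    then show "g + h \<in> out_map Q M q ` rspace M q"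
      using xy kvec.subspace_add[OF sq] by auto
  next
    fix c g assume "g \<in> out_map Q M q ` rspace M q"
    then obtain x where x: "x \<in> rspace M q" "g = out_map Q M q x" by auto
    have "sscale c g = out_map Q M q (kscale c x)"
      unfolding x(2) by (rule ext) (use arc(1) x(1) in \<open>simp add: out_map_def linear_on_def sscale_def\<close>)
    then show "sscale c g \<in> out_map Q M q ` rspace M q"
      using x kvec.subspace_scale[OF sq] by auto
  qed
  have "out_map Q M q ` rspace M q \<subseteq> out_sum Q M q"
    using imageI arc(2) unfolding out_map_def out_sum_def by fastforce
  from exists_map_with_kernel[OF fT WT sW sI this]
  have "\<exists>p. is_coker_proj Q M q p" unfolding is_coker_proj_def .
  then show ?thesis unfolding coker_proj_def by (rule someI_ex)
qed

definition coker :: "('v, 'e) pre_digraph \<Rightarrow> ('v, 'e, 'k::field) rep \<Rightarrow> 'v \<Rightarrow> (nat \<Rightarrow> 'k) set" where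
  "coker Q M q = coker_proj Q M q ` out_sum Q M q"

text \<open>
  A representation of \<open>opposite Q\<close>, for \<open>Q\<close> in which every vertex is a source or a sink: the arc
  \<open>a\<close> of \<open>Q\<close> from \<open>q\<close> to \<open>t\<close> is reversed and carries the composition of the inclusion of the
  summand at \<open>t\<close> with the projection onto the cokernel.
\<close>

definition sigma_minus ::
  "('v, 'e) pre_digraph \<Rightarrow> ('v, 'e, 'k::field) rep \<Rightarrow> ('v, 'e, 'k) rep" where
  "sigma_minus Q M =
     \<lparr>rspace = (\<lambda>v. if is_source Q v then coker Q M v else rspace M v),
      rmap = (\<lambda>a x. coker_proj Q M (tail Q a) (\<lambda>b. if b = a then x else 0))\<rparr>"

definition simple_at :: "'v \<Rightarrow> ('v, 'e, 'k::field) rep" where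
  "simple_at s =
     \<lparr>rspace = (\<lambda>v. if v = s then {x. \<forall>i>0. x i = 0} else {0}), rmap = (\<lambda>a x. 0)\<rparr>"

primrec P_tilde :: "('v, 'e) pre_digraph \<Rightarrow> 'v \<Rightarrow> nat \<Rightarrow> ('v, 'e, 'k::field) rep" where
  "P_tilde Q s 0 = simple_at s"
| "P_tilde Q s (Suc i) = sigma_minus (if even i then Q else opposite Q) (P_tilde Q s i)"

end

theory Submission
  imports Defs
begin

text \<open>
  All simple representations of the covering are one-dimensional, so the length of a representation
  is its total dimension, which is 76 for \<open>P_tilde Q s 4\<close>. Choose coordinates and write the
  representation by explicit matrices. Lowering the dimension of one vertex by one, that is,
  dropping its last coordinate, gives a subrepresentation if the vertex is a source and a factor
  representation if it is a sink. The coordinates are chosen such that a chain of such steps leads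
  from \<open>P_tilde Q s 4\<close> to a simple representation through representations all of whose
  endomorphisms are scalars; these are indecomposable. An endomorphism is controlled at the three
  neighbours of the root first: it respects the linear relations between their images at the root,
  the kernels of the maps leading away from the root, and the preimages of the images of the leaves.
  These conditions force one common scalar, which the remaining maps spread over the tree.

  That the explicit matrices describe \<open>P_tilde Q s 4\<close> follows by reflecting four times: the
  reflection \<open>N'\<close> of \<open>N\<close> is characterised by exact sequences
  \<open>N(q) \<rightarrow> \<Oplus>N(t) \<rightarrow> N'(q) \<rightarrow> 0\<close> at the sources \<open>q\<close>, which can be checked
  vertex by vertex.
\<close>

section \<open>Lengths, bricks and accessibility\<close>

text \<open>Bricks are used because "all endomorphisms are scalars" is a linear condition on
  finitely many matrix entries. It is verified by plane geometry: an endomorphism of a plane with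
  three distinct invariant lines, or of a 3-space with four invariant lines in general position, is
  a scalar. The obstacle is that such lines get lost along the chain: enlarging a sink can destroy
  the kernel that gave a line, so a leaf giving a substitute has to be attached before. This
  dictates the order of the chain. The entries involve \<open>t\<close> with
  \<open>t * t = t + 1\<close> because \<open>t\<close>, \<open>t - 1\<close>, \<open>t + 1\<close>
  and \<open>t - 2\<close> are then units already over the integers, so one calculation serves all
  characteristics. \<open>P_tilde Q s 4\<close> is only isomorphic to its coordinate model. A
  subrepresentation is a literal family of subspaces, whereas factor representations are taken up to
  isomorphism; therefore the last step, from total dimension 75 to 76, is made at a sink and
  directly on \<open>P_tilde Q s 4\<close>.\<close>

lemma is_rep_subspace: "is_rep Q M \<Longrightarrow> v \<in> verts Q \<Longrightarrow> kvec.subspace (rspace M v)"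
  unfolding is_rep_def by (metis kvec.subspace_span)

lemma is_rep_map_in: "is_rep Q M \<Longrightarrow> a \<in> arcs Q \<Longrightarrow> x \<in> rspace M (tail Q a) \<Longrightarrow> rmap M a x \<in> rspace M (head Q a)"
  unfolding is_rep_def by blast

lemma is_subrep_map_in: "is_subrep Q M U \<Longrightarrow> a \<in> arcs Q \<Longrightarrow> x \<in> U (tail Q a) \<Longrightarrow> rmap M a x \<in> U (head Q a)"
  unfolding is_subrep_def by blast

lemma is_rep_map_linear: "is_rep Q M \<Longrightarrow> a \<in> arcs Q \<Longrightarrow> linear_on kscale kscale (rspace M (tail Q a)) (rmap M a)"
  unfolding is_rep_def by blast

lemma linear_on_add: "linear_on s1 s2 S f \<Longrightarrow> x \<in> S \<Longrightarrow> y \<in> S \<Longrightarrow> f (x + y) = f x + f y"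
  by (simp add: linear_on_def)

lemma linear_on_scale: "linear_on s1 s2 S f \<Longrightarrow> x \<in> S \<Longrightarrow> f (s1 c x) = s2 c (f x)"
  by (simp add: linear_on_def)

lemma linear_on_zero:
  assumes "linear_on s1 s2 S f" "0 \<in> S"
  shows "f 0 = 0"
  using linear_on_add[OF assms assms(2)] by simp

lemma is_subrep_zero:
  assumes "wf_digraph Q" "is_rep Q M"
  shows "is_subrep Q M zero_family"
proof -
  interpret wf_digraph Q by fact
  have "rmap M a 0 = 0" if "a \<in> arcs Q" for a
    using linear_on_zero[OF is_rep_map_linear[OF assms(2) that]]
      kvec.subspace_0[OF is_rep_subspace[OF assms(2)]] that by simp
  then show ?thesis
    using kvec.subspace_0[OF is_rep_subspace[OF assms(2)]]
    by (auto simp: is_subrep_def zero_family_def kvec.subspace_def)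
qed

lemma kvec_linear_on_diff:
  assumes "linear_on kscale kscale S f" "kvec.subspace S" "x \<in> S" "y \<in> S"
  shows "f (x - y) = f x - f y"
  using linear_on_add[OF assms(1) kvec.subspace_diff[OF assms(2-4)] assms(4)] by (simp add: algebra_simps)

lemma rep_hom_linear: "rep_hom Q M N \<phi> \<Longrightarrow> v \<in> verts Q \<Longrightarrow> linear_on kscale kscale (rspace M v) (\<phi> v)"
  by (simp add: rep_hom_def)

lemma rep_hom_in: "rep_hom Q M N \<phi> \<Longrightarrow> v \<in> verts Q \<Longrightarrow> x \<in> rspace M v \<Longrightarrow> \<phi> v x \<in> rspace N v"
  by (auto simp: rep_hom_def)

lemma rep_hom_commute:
  "rep_hom Q M N \<phi> \<Longrightarrow> a \<in> arcs Q \<Longrightarrow> x \<in> rspace M (tail Q a) \<Longrightarrow>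
     \<phi> (head Q a) (rmap M a x) = rmap N a (\<phi> (tail Q a) x)"
  by (simp add: rep_hom_def)

section \<open>Composition series and one-dimensional steps\<close>

lemma line_subspace_cases:
  assumes "kvec.subspace W" "\<And>x. x \<in> W \<Longrightarrow> \<exists>c. x = kscale c z"
  shows "W = {0} \<or> z \<in> W"
proof (cases "W \<subseteq> {0}")
  case True
  then show ?thesis using kvec.subspace_0[OF assms(1)] by auto
next
  case False
  then obtain x c where x: "x \<in> W" "x \<noteq> 0" "x = kscale c z" using assms(2) by blast
  then have "c \<noteq> 0" by auto
  then have "z = kscale (inverse c) x" using x by simp
  then show ?thesis using kvec.subspace_scale[OF assms(1)] x by metis
qed

text \<open>A composition series of \<open>N\<close> is pulled back along \<open>\<phi>\<close>, and
  zero is put below it. The lowest step is the kernel, which lives at \<open>t\<close> only and is a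
  line. The other steps stay simple because a subrepresentation lying above the kernel is the
  preimage of its image.\<close>

lemma has_length_factor:
  assumes wf: "wf_digraph Q" and M: "is_rep Q M" and N: "is_rep Q N"
    and hom: "rep_hom Q M N \<phi>" and surj: "\<And>v. v \<in> verts Q \<Longrightarrow> \<phi> v ` rspace M v = rspace N v"
    and t: "t \<in> verts Q" "z \<in> rspace M t" "z \<noteq> 0" "\<phi> t z = 0"
    and kert: "\<And>x. x \<in> rspace M t \<Longrightarrow> \<phi> t x = 0 \<Longrightarrow> \<exists>c. x = kscale c z"
    and kerv: "\<And>v x. v \<in> verts Q \<Longrightarrow> v \<noteq> t \<Longrightarrow> x \<in> rspace M v \<Longrightarrow> \<phi> v x = 0 \<Longrightarrow> x = 0"
    and len: "has_length Q N l"
  shows "has_length Q M (Suc l)"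
proof -
  interpret wf_digraph Q by fact
  note sub = is_rep_subspace[OF M]
  note lin = rep_hom_linear[OF hom]
  obtain U where U: "\<And>i. i \<le> l \<Longrightarrow> is_subrep Q N (U i)"
    "family_eq Q (U 0) zero_family" "family_eq Q (U l) (rspace N)"
    "\<And>i. i < l \<Longrightarrow> family_le Q (U i) (U (Suc i))" "\<And>i. i < l \<Longrightarrow> \<not> family_eq Q (U i) (U (Suc i))"
    "\<And>i W. i < l \<Longrightarrow> is_subrep Q N W \<Longrightarrow> family_le Q (U i) W \<Longrightarrow> family_le Q W (U (Suc i)) \<Longrightarrow>
       family_eq Q W (U i) \<or> family_eq Q W (U (Suc i))"
    using len unfolding has_length_def by blast
  have Usub: "kvec.subspace (U i v)" "U i v \<subseteq> rspace N v" if "i \<le> l" "v \<in> verts Q" for i v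
    using U(1)[OF that(1)] that(2) unfolding is_subrep_def by auto
  have Uarc: "rmap N a y \<in> U i (head Q a)" if "i \<le> l" "a \<in> arcs Q" "y \<in> U i (tail Q a)" for i a y
    using U(1)[OF that(1)] that(2,3) unfolding is_subrep_def by blast
  have phi0: "\<phi> v 0 = 0" if "v \<in> verts Q" for v
    using linear_on_zero[OF lin[OF that]] kvec.subspace_0[OF sub[OF that]] by simp
  define P where "P X v = {x \<in> rspace M v. \<phi> v x \<in> X v}" for X :: "'a \<Rightarrow> (nat \<Rightarrow> 'c) set" and v
  have Psub: "is_subrep Q M (P (U i))" if i: "i \<le> l" for i
    unfolding is_subrep_def
  proof (intro conjI ballI)
    fix v assume v: "v \<in> verts Q"
    show "kvec.subspace (P (U i) v)"
      unfolding kvec.subspace_def P_def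
      using sub[OF v] Usub(1)[OF i v] phi0[OF v]
      by (auto simp: linear_on_add[OF lin[OF v]] linear_on_scale[OF lin[OF v]]
          kvec.subspace_0 kvec.subspace_add kvec.subspace_scale)
    show "P (U i) v \<subseteq> rspace M v" by (auto simp: P_def)
  next
    fix a assume a: "a \<in> arcs Q"
    then show "rmap M a ` P (U i) (tail Q a) \<subseteq> P (U i) (head Q a)"
      using is_rep_map_in[OF M a] Uarc[OF i a] by (auto simp: P_def rep_hom_commute[OF hom a])
  qed
  have z: "z \<in> P (U 0) t"
    using t U(2) kvec.subspace_0 by (auto simp: P_def family_eq_def zero_family_def)
  have kerP: "x \<in> P (U i) v" if "x \<in> rspace M v" "\<phi> v x = 0" "i \<le> l" "v \<in> verts Q" for x v i
    using that kvec.subspace_0[OF Usub(1)[OF that(3,4)]] by (auto simp: P_def)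
  \<comment> \<open>The index is shifted by one: the preimage of \<open>U 0\<close> is the kernel,
    not zero, and sits at position 1.\<close>
  define U' where "U' i = (case i of 0 \<Rightarrow> zero_family | Suc j \<Rightarrow> P (U j))" for i
  show ?thesis
    unfolding has_length_def
  proof (intro exI[of _ U'] conjI allI impI)
    fix i assume "i \<le> Suc l"
    then show "is_subrep Q M (U' i)"
      using Psub is_subrep_zero[OF wf M] by (cases i) (auto simp: U'_def)
  next
    show "family_eq Q (U' 0) zero_family" by (simp add: U'_def family_eq_def)
    show "family_eq Q (U' (Suc l)) (rspace M)"
      using U(3) rep_hom_in[OF hom] by (auto simp: U'_def family_eq_def P_def)
  next
    fix i assume "i < Suc l"
    then have i: "i \<le> l" by simp
    show "family_le Q (U' i) (U' (Suc i))"
    proof (cases i)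
      case 0
      then show ?thesis
        using Psub[of 0] by (auto simp: U'_def family_le_def zero_family_def is_subrep_def kvec.subspace_0)
    next
      case (Suc j)
      then show ?thesis using U(4)[of j] i by (auto simp: U'_def family_le_def P_def)
    qed
    show "\<not> family_eq Q (U' i) (U' (Suc i))"
    proof (cases i)
      case 0
      then show ?thesis using z t by (auto simp: U'_def family_eq_def zero_family_def)
    next
      case (Suc j)
      then obtain v y where v: "v \<in> verts Q" "y \<in> U (Suc j) v" "y \<notin> U j v"
        using U(4,5)[of j] i unfolding family_le_def family_eq_def by fastforce
      moreover from v have "y \<in> rspace N v" using Usub(2)[of "Suc j" v] v Suc i by auto
      ultimately have "y \<in> \<phi> v ` rspace M v" using surj[of v] by simp
      then obtain x where "x \<in> rspace M v" "\<phi> v x = y" by auto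
      then have "x \<in> U' (Suc i) v" "x \<notin> U' i v" using v Suc by (simp_all add: U'_def P_def)
      then show ?thesis using v(1) unfolding family_eq_def by blast
    qed
    fix W assume W: "is_subrep Q M W" "family_le Q (U' i) W" "family_le Q W (U' (Suc i))"
    have Wsub: "kvec.subspace (W v)" "W v \<subseteq> rspace M v" if "v \<in> verts Q" for v
      using W(1) that unfolding is_subrep_def by auto
    show "family_eq Q W (U' i) \<or> family_eq Q W (U' (Suc i))"
    proof (cases i)
      case 0
      have ker: "x \<in> rspace M v \<and> \<phi> v x = 0" if "v \<in> verts Q" "x \<in> W v" for v x
        using W(3) that 0 U(2) unfolding family_le_def U'_def P_def family_eq_def zero_family_def by fastforce
      then have Wv: "W v = {0}" if "v \<in> verts Q" "v \<noteq> t" for v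
        using kerv[OF that] kvec.subspace_0[OF Wsub(1)[OF that(1)]] that by blast
      have Pv: "P (U 0) v = {0}" if "v \<in> verts Q" "v \<noteq> t" for v
        using kerv[OF that] U(2) that kvec.subspace_0[OF sub] phi0
        by (auto simp: P_def family_eq_def zero_family_def)
      have "W t = {0} \<or> z \<in> W t"
        by (rule line_subspace_cases[OF Wsub(1)[OF t(1)]]) (use t(1) ker kert in blast)
      moreover have "P (U 0) t \<subseteq> W t" if "z \<in> W t"
        using kert that kvec.subspace_scale[OF Wsub(1)[OF t(1)]] U(2) t(1)
        by (auto simp: P_def family_eq_def zero_family_def)
      ultimately show ?thesis
        using Wv Pv W(3) 0 unfolding U'_def family_eq_def zero_family_def family_le_def
        by (simp; metis subset_antisym)
    next
      case (Suc j)
      \<comment> \<open>\<open>W\<close> contains the kernel here, hence is the preimage of its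
        image \<open>V\<close>, and the simple step in \<open>N\<close> decides about
        \<open>V\<close>.\<close>
      define V where "V v = \<phi> v ` W v" for v
      have V: "is_subrep Q N V"
        unfolding is_subrep_def
      proof (intro conjI ballI)
        fix v assume v: "v \<in> verts Q"
        show "V v \<subseteq> rspace N v" using Wsub(2)[OF v] surj[OF v] by (auto simp: V_def)
        have "0 \<in> V v" using phi0[OF v] kvec.subspace_0[OF Wsub(1)[OF v]] unfolding V_def by (metis imageI)
        moreover have "\<phi> v x + \<phi> v y \<in> V v" if "x \<in> W v" "y \<in> W v" for x y
          using linear_on_add[OF lin[OF v], of x y] kvec.subspace_add[OF Wsub(1)[OF v] that] Wsub(2)[OF v] that
          unfolding V_def by (metis imageI subsetD)
        moreover have "kscale c (\<phi> v x) \<in> V v" if "x \<in> W v" for x c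
          using linear_on_scale[OF lin[OF v], of x c] kvec.subspace_scale[OF Wsub(1)[OF v] that] Wsub(2)[OF v] that
          unfolding V_def by (metis imageI subsetD)
        ultimately show "kvec.subspace (V v)" unfolding kvec.subspace_def by (auto simp: V_def)
      next
        fix a assume a: "a \<in> arcs Q"
        show "rmap N a ` V (tail Q a) \<subseteq> V (head Q a)"
        proof
          fix y assume "y \<in> rmap N a ` V (tail Q a)"
          then obtain x where x: "x \<in> W (tail Q a)" "y = rmap N a (\<phi> (tail Q a) x)" by (auto simp: V_def)
          then have "y = \<phi> (head Q a) (rmap M a x)"
            using rep_hom_commute[OF hom a, of x] Wsub(2)[of "tail Q a"] a by auto
          moreover have "rmap M a x \<in> W (head Q a)" using is_subrep_map_in[OF W(1) a x(1)] .
          ultimately show "y \<in> V (head Q a)" by (auto simp: V_def)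
        qed
      qed
      have le1: "family_le Q (U j) V"
        unfolding family_le_def
      proof (intro ballI subsetI)
        fix v y assume v: "v \<in> verts Q" and y: "y \<in> U j v"
        then have "y \<in> rspace N v" using Usub(2)[of j v] Suc i by auto
        then obtain x where x: "x \<in> rspace M v" "y = \<phi> v x" using surj[OF v] by auto
        then have "x \<in> W v" using W(2) v y Suc by (auto simp: U'_def P_def family_le_def)
        then show "y \<in> V v" using x by (simp add: V_def)
      qed
      have le2: "family_le Q V (U (Suc j))"
        using W(3) Suc unfolding family_le_def V_def U'_def P_def by fastforce
      have WV: "W v = P V v" if v: "v \<in> verts Q" for v
      proof
        show "W v \<subseteq> P V v" using Wsub(2)[OF v] by (auto simp: P_def V_def)
        show "P V v \<subseteq> W v"
        proof
          fix x assume "x \<in> P V v"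
          then obtain w where w: "x \<in> rspace M v" "w \<in> W v" "\<phi> v x = \<phi> v w" by (auto simp: P_def V_def)
          then have wM: "w \<in> rspace M v" using Wsub(2)[OF v] by auto
          then have "\<phi> v (x - w) = 0" using w kvec_linear_on_diff[OF lin[OF v] sub[OF v]] by simp
          then have "x - w \<in> P (U j) v"
            using kerP[of "x - w" v j] kvec.subspace_diff[OF sub[OF v] w(1) wM] v Suc i by auto
          then have "x - w \<in> W v" using W(2) v Suc unfolding U'_def family_le_def by auto
          then show "x \<in> W v" using kvec.subspace_add[OF Wsub(1)[OF v] _ w(2), of "x - w"] by simp
        qed
      qed
      have "family_eq Q V (U j) \<or> family_eq Q V (U (Suc j))"
        using U(6)[OF _ V le1 le2] Suc i by simp
      then show ?thesis
        using WV Suc unfolding family_eq_def U'_def P_def by auto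
    qed
  qed
qed

text \<open>\<open>M\<close> is put on top of a composition series of the subrepresentation; the new
  step is simple because the quotient is the line spanned by the class of \<open>z\<close>.\<close>

lemma has_length_sub:
  assumes M: "is_rep Q M" and U: "is_subrep Q M U"
    and q: "q \<in> verts Q" "z \<in> rspace M q" "z \<notin> U q"
    and span: "\<And>x. x \<in> rspace M q \<Longrightarrow> \<exists>c. x - kscale c z \<in> U q"
    and eq: "\<And>v. v \<in> verts Q \<Longrightarrow> v \<noteq> q \<Longrightarrow> U v = rspace M v"
    and len: "has_length Q (M\<lparr>rspace := U\<rparr>) l"
  shows "has_length Q M (Suc l)"
proof -
  obtain S where S: "\<And>i. i \<le> l \<Longrightarrow> is_subrep Q (M\<lparr>rspace := U\<rparr>) (S i)"
    "family_eq Q (S 0) zero_family" "family_eq Q (S l) U"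
    "\<And>i. i < l \<Longrightarrow> family_le Q (S i) (S (Suc i))" "\<And>i. i < l \<Longrightarrow> \<not> family_eq Q (S i) (S (Suc i))"
    "\<And>i W. i < l \<Longrightarrow> is_subrep Q (M\<lparr>rspace := U\<rparr>) W \<Longrightarrow> family_le Q (S i) W \<Longrightarrow> family_le Q W (S (Suc i)) \<Longrightarrow>
       family_eq Q W (S i) \<or> family_eq Q W (S (Suc i))"
    using len unfolding has_length_def by auto
  have le: "U v \<subseteq> rspace M v" if "v \<in> verts Q" for v
    using U that unfolding is_subrep_def by auto
  have iff: "is_subrep Q (M\<lparr>rspace := U\<rparr>) W \<longleftrightarrow> is_subrep Q M W \<and> family_le Q W U" for W
    using le unfolding is_subrep_def family_le_def by fastforce
  have leS: "family_le Q (S i) U" if "i \<le> l" for i using S(1)[OF that] iff by blast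
  define S' where "S' i = (if i \<le> l then S i else rspace M)" for i
  have full: "is_subrep Q M (rspace M)"
    using M is_rep_subspace[OF M] unfolding is_subrep_def is_rep_def by auto
  show ?thesis
    unfolding has_length_def
  proof (intro exI[of _ S'] conjI allI impI)
    fix i
    show "is_subrep Q M (S' i)" using full S(1) iff by (auto simp: S'_def)
  next
    show "family_eq Q (S' 0) zero_family" using S(2) by (simp add: S'_def)
    show "family_eq Q (S' (Suc l)) (rspace M)" by (simp add: S'_def family_eq_def)
  next
    fix i assume "i < Suc l"
    then consider "i < l" | "i = l" by linarith
    then show "family_le Q (S' i) (S' (Suc i))"
      by cases (use S(3,4) le in \<open>auto simp: S'_def family_le_def family_eq_def\<close>)
    show "\<not> family_eq Q (S' i) (S' (Suc i))"
      using \<open>i < Suc l\<close> S(3,5) q by (cases "i < l") (auto simp: S'_def family_eq_def less_Suc_eq)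
    fix W assume W: "is_subrep Q M W" "family_le Q (S' i) W" "family_le Q W (S' (Suc i))"
    show "family_eq Q W (S' i) \<or> family_eq Q W (S' (Suc i))"
    proof (cases "i < l")
      case True
      then have "family_le Q W U" using W(3) leS[of "Suc i"] by (auto simp: S'_def family_le_def)
      then show ?thesis using S(6)[OF True, of W] iff W True by (simp add: S'_def)
    next
      case False
      then have il: "i = l" using \<open>i < Suc l\<close> by simp
      then have UW: "U v \<subseteq> W v" "W v \<subseteq> rspace M v" if "v \<in> verts Q" for v
        using W(2,3) S(3) that by (auto simp: S'_def family_le_def family_eq_def)
      have Wq: "kvec.subspace (W q)" using W(1) q unfolding is_subrep_def by auto
      have "W q = U q \<or> W q = rspace M q"
      proof (cases "W q \<subseteq> U q")
        case True then show ?thesis using UW q by auto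
      next
        case False
        then obtain x where x: "x \<in> W q" "x \<notin> U q" by auto
        then obtain c where c: "x - kscale c z \<in> U q" using span UW q by blast
        then have "c \<noteq> 0" using x by auto
        have "kscale c z \<in> W q"
          using kvec.subspace_diff[OF Wq x(1), of "x - kscale c z"] c UW(1)[OF q(1)] by auto
        then have "z \<in> W q"
          using kvec.subspace_scale[OF Wq, of "kscale c z" "inverse c"] \<open>c \<noteq> 0\<close> by simp
        then have "y \<in> W q" if y: "y \<in> rspace M q" for y
        proof -
          obtain d where "y - kscale d z \<in> U q" using span[OF y] by auto
          then have "y - kscale d z + kscale d z \<in> W q"
            using \<open>z \<in> W q\<close> UW(1)[OF q(1)] by (intro kvec.subspace_add[OF Wq] kvec.subspace_scale[OF Wq]) auto
          then show ?thesis by simp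
        qed
        then show ?thesis using UW(2)[OF q(1)] by blast
      qed
      then have "family_eq Q W U \<or> family_eq Q W (rspace M)"
        using eq UW unfolding family_eq_def by (metis subset_antisym)
      then show ?thesis
        using il S(3) by (auto simp: S'_def family_eq_def)
    qed
  qed
qed

text \<open>The comparison with a scalar is made on \<open>rspace M v\<close> only, since
  \<open>rep_hom\<close> does not restrict the values elsewhere.\<close>

definition brick :: "('v, 'e) pre_digraph \<Rightarrow> ('v, 'e, 'k::field) rep \<Rightarrow> bool" where
  "brick Q M \<longleftrightarrow>
     (\<forall>f. rep_hom Q M M f \<longrightarrow> (\<exists>c. \<forall>v\<in>verts Q. \<forall>x\<in>rspace M v. f v x = kscale c x))"

text \<open>The projection onto \<open>U\<close> along \<open>W\<close> is an endomorphism, hence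
  multiplication by some \<open>c\<close>. It is the identity on \<open>U\<close> and zero on
  \<open>W\<close>; so \<open>U\<close> vanishes if \<open>c = 0\<close>, and \<open>W\<close>
  vanishes otherwise.\<close>

lemma brick_indecomposable:
  assumes wf: "wf_digraph Q" and M: "is_rep Q M" and ne: "\<not> family_eq Q (rspace M) zero_family"
    and br: "brick Q M"
  shows "indecomposable Q M"
  unfolding indecomposable_def
proof (intro conjI allI impI M ne)
  interpret wf_digraph Q by fact
  fix U W assume U: "is_subrep Q M U" and W: "is_subrep Q M W"
    and dec: "\<forall>v\<in>verts Q. U v \<inter> W v = {0} \<and> rspace M v = {x + y |x y. x \<in> U v \<and> y \<in> W v}"
  have subU: "kvec.subspace (U v)" and subW: "kvec.subspace (W v)" if "v \<in> verts Q" for v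
    using U W that unfolding is_subrep_def by auto
  define f where "f v x = (SOME u. u \<in> U v \<and> x - u \<in> W v)" for v x
  have f: "f v x \<in> U v \<and> x - f v x \<in> W v" if v: "v \<in> verts Q" and x: "x \<in> rspace M v" for v x
    unfolding f_def
  proof (rule someI_ex[of "\<lambda>u. u \<in> U v \<and> x - u \<in> W v"])
    show "\<exists>u. u \<in> U v \<and> x - u \<in> W v" using dec v x by force
  qed
  \<comment> \<open>By uniqueness of the decomposition, linearity of \<open>f\<close> and its
    commutation with the arrows follow once some decomposition of the vector in question is
    exhibited.\<close>
  have uniq: "f v x = u" if v: "v \<in> verts Q" and u: "u \<in> U v" "x - u \<in> W v" for v x u
  proof -
    have "x \<in> {x + y |x y. x \<in> U v \<and> y \<in> W v}"
      using u by (intro CollectI exI[of _ u] exI[of _ "x - u"]) simp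
    then have x: "x \<in> rspace M v" using dec v by simp
    have "f v x - u \<in> U v" using f[OF v x] u kvec.subspace_diff[OF subU[OF v]] by blast
    moreover have "(x - u) - (x - f v x) \<in> W v"
      using f[OF v x] u kvec.subspace_diff[OF subW[OF v]] by blast
    ultimately have "f v x - u \<in> U v \<inter> W v" by simp
    then show ?thesis using dec v by auto
  qed
  have "rep_hom Q M M f"
    unfolding rep_hom_def linear_on_def
  proof (intro conjI ballI allI)
    fix v x y assume v: "v \<in> verts Q" and xy: "x \<in> rspace M v" "y \<in> rspace M v"
    have "(x - f v x) + (y - f v y) \<in> W v"
      using f[OF v xy(1)] f[OF v xy(2)] kvec.subspace_add[OF subW[OF v]] by blast
    then have "x + y - (f v x + f v y) \<in> W v" by (simp add: algebra_simps)
    then show "f v (x + y) = f v x + f v y"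
      using f[OF v xy(1)] f[OF v xy(2)] kvec.subspace_add[OF subU[OF v]]
      by (intro uniq[OF v]) simp_all
  next
    fix v c x assume v: "v \<in> verts Q" and x: "x \<in> rspace M v"
    have "kscale c x - kscale c (f v x) = kscale c (x - f v x)"
      by (simp add: kvec.scale_right_diff_distrib)
    then show "f v (kscale c x) = kscale c (f v x)"
      using f[OF v x] kvec.subspace_scale[OF subU[OF v]] kvec.subspace_scale[OF subW[OF v]]
      by (intro uniq[OF v]) simp_all
  next
    fix v assume v: "v \<in> verts Q"
    show "f v ` rspace M v \<subseteq> rspace M v"
      using f[OF v] U v unfolding is_subrep_def by auto
  next
    fix a x assume a: "a \<in> arcs Q" and x: "x \<in> rspace M (tail Q a)"
    note lin = is_rep_map_linear[OF M a]
    have fx: "f (tail Q a) x \<in> U (tail Q a)" "x - f (tail Q a) x \<in> W (tail Q a)"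
      using f x a by auto
    have "f (tail Q a) x \<in> rspace M (tail Q a)"
      using fx(1) U a unfolding is_subrep_def by (meson subsetD tail_in_verts)
    then have "rmap M a x - rmap M a (f (tail Q a) x) = rmap M a (x - f (tail Q a) x)"
      using kvec_linear_on_diff[OF lin is_rep_subspace[OF M]] x a by simp
    then show "f (head Q a) (rmap M a x) = rmap M a (f (tail Q a) x)"
      using fx is_subrep_map_in[OF U a] is_subrep_map_in[OF W a] a by (intro uniq) auto
  qed
  then obtain c where c: "\<And>v x. v \<in> verts Q \<Longrightarrow> x \<in> rspace M v \<Longrightarrow> f v x = kscale c x"
    using br unfolding brick_def by blast
  have UM: "U v \<subseteq> rspace M v" and WM: "W v \<subseteq> rspace M v" if "v \<in> verts Q" for v
    using U W that unfolding is_subrep_def by auto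
  have fU: "kscale c x = x" if "v \<in> verts Q" "x \<in> U v" for v x
    using c[of v x] uniq[of v x x] that UM[of v] kvec.subspace_0[OF subW] by auto
  have fW: "kscale c x = 0" if "v \<in> verts Q" "x \<in> W v" for v x
    using c[of v x] uniq[of v 0 x] that WM[of v] kvec.subspace_0[OF subU] by auto
  show "family_eq Q U zero_family \<or> family_eq Q W zero_family"
  proof (cases "c = 0")
    case True
    then show ?thesis using fU kvec.subspace_0[OF subU] by (auto simp: family_eq_def zero_family_def)
  next
    case False
    then show ?thesis using fW kvec.subspace_0[OF subW] by (auto simp: family_eq_def zero_family_def)
  qed
qed

definition rep_iso ::
  "('v, 'e) pre_digraph \<Rightarrow> ('v, 'e, 'k::field) rep \<Rightarrow> ('v, 'e, 'k) rep \<Rightarrow>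
   ('v \<Rightarrow> (nat \<Rightarrow> 'k) \<Rightarrow> (nat \<Rightarrow> 'k)) \<Rightarrow> bool" where
  "rep_iso Q M N \<phi> \<longleftrightarrow> rep_hom Q M N \<phi> \<and> (\<forall>v\<in>verts Q. bij_betw (\<phi> v) (rspace M v) (rspace N v))"

lemma linear_on_inv_into:
  assumes lin: "linear_on s1 kscale S f" and bij: "bij_betw f S T"
    and add: "\<And>x y. x \<in> S \<Longrightarrow> y \<in> S \<Longrightarrow> x + y \<in> S" and sc: "\<And>c x. x \<in> S \<Longrightarrow> s1 c x \<in> S"
  shows "linear_on kscale s1 T (inv_into S f)"
proof -
  have inj: "inj_on f S" and im: "f ` S = T" using bij by (auto simp: bij_betw_def)
  show ?thesis
    unfolding linear_on_def
  proof (intro conjI ballI allI)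
    fix x y assume xy: "x \<in> T" "y \<in> T"
    let ?g = "inv_into S f"
    have g: "?g x \<in> S" "?g y \<in> S" "f (?g x) = x" "f (?g y) = y"
      using xy im by (auto simp: inv_into_into f_inv_into_f)
    then show "?g (x + y) = ?g x + ?g y"
      using linear_on_add[OF lin, of "?g x" "?g y"] add[of "?g x" "?g y"]
      by (metis inv_into_f_f[OF inj])
  next
    fix c x assume x: "x \<in> T"
    let ?g = "inv_into S f"
    have g: "?g x \<in> S" "f (?g x) = x"
      using x im by (auto simp: inv_into_into f_inv_into_f)
    then show "?g (kscale c x) = s1 c (?g x)"
      using linear_on_scale[OF lin, of "?g x" c] sc[of "?g x" c]
      by (metis inv_into_f_f[OF inj])
  qed
qed

lemma rep_hom_comp:
  assumes "wf_digraph Q" "rep_hom Q L M \<phi>" "rep_hom Q M N \<psi>"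
  shows "rep_hom Q L N (\<lambda>v. \<psi> v \<circ> \<phi> v)"
proof -
  interpret wf_digraph Q by fact
  show ?thesis
    using assms(2,3) unfolding rep_hom_def linear_on_def by (auto simp: image_subset_iff)
qed

text \<open>Conjugation by \<open>\<phi>\<close> turns endomorphisms of \<open>M\<close> into
  endomorphisms of \<open>N\<close> and leaves scalars unchanged.\<close>

lemma brick_iso:
  assumes wf: "wf_digraph Q" and M: "is_rep Q M" and iso: "rep_iso Q M N \<phi>" and br: "brick Q N"
  shows "brick Q M"
  unfolding brick_def
proof (intro allI impI)
  interpret wf_digraph Q by fact
  fix f assume f: "rep_hom Q M M f"
  define \<psi> where "\<psi> v = inv_into (rspace M v) (\<phi> v)" for v
  have hom: "rep_hom Q M N \<phi>" and bij: "\<And>v. v \<in> verts Q \<Longrightarrow> bij_betw (\<phi> v) (rspace M v) (rspace N v)"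
    using iso by (auto simp: rep_iso_def)
  have psi1: "\<psi> v (\<phi> v x) = x" if "v \<in> verts Q" "x \<in> rspace M v" for v x
    using bij[OF that(1)] that(2) by (simp add: \<psi>_def bij_betw_def)
  have psi2: "\<phi> v (\<psi> v y) = y" "\<psi> v y \<in> rspace M v" if "v \<in> verts Q" "y \<in> rspace N v" for v y
    using bij[OF that(1)] that(2)
    by (auto simp: \<psi>_def bij_betw_def f_inv_into_f inv_into_into)
  have psi: "rep_hom Q N M \<psi>"
    unfolding rep_hom_def
  proof (intro conjI ballI)
    fix v assume v: "v \<in> verts Q"
    show "linear_on kscale kscale (rspace N v) (\<psi> v)"
      unfolding \<psi>_def
      by (rule linear_on_inv_into[OF rep_hom_linear[OF hom v] bij[OF v]])
        (use is_rep_subspace[OF M v] in \<open>auto intro: kvec.subspace_add kvec.subspace_scale\<close>)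
    show "\<psi> v ` rspace N v \<subseteq> rspace M v" using psi2[OF v] by auto
  next
    fix a y assume a: "a \<in> arcs Q" and y: "y \<in> rspace N (tail Q a)"
    let ?x = "\<psi> (tail Q a) y"
    have x: "?x \<in> rspace M (tail Q a)" "\<phi> (tail Q a) ?x = y" using psi2 a y by auto
    then have "rmap N a y = \<phi> (head Q a) (rmap M a ?x)" using rep_hom_commute[OF hom a] by simp
    moreover have "rmap M a ?x \<in> rspace M (head Q a)" using M a x unfolding is_rep_def by blast
    ultimately show "\<psi> (head Q a) (rmap N a y) = rmap M a ?x" using psi1 a by simp
  qed
  have "rep_hom Q N N (\<lambda>v. (\<phi> v \<circ> f v) \<circ> \<psi> v)"
    using rep_hom_comp[OF wf psi rep_hom_comp[OF wf f hom]] .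
  then obtain c where c: "\<And>v y. v \<in> verts Q \<Longrightarrow> y \<in> rspace N v \<Longrightarrow> \<phi> v (f v (\<psi> v y)) = kscale c y"
    using br unfolding brick_def by fastforce
  have "f v x = kscale c x" if v: "v \<in> verts Q" and x: "x \<in> rspace M v" for v x
  proof -
    have "\<phi> v (f v x) = kscale c (\<phi> v x)" using c[OF v rep_hom_in[OF hom v x]] psi1[OF v x] by simp
    also have "\<dots> = \<phi> v (kscale c x)" using linear_on_scale[OF rep_hom_linear[OF hom v] x] by simp
    finally show ?thesis
      using bij[OF v] rep_hom_in[OF f v x] kvec.subspace_scale[OF is_rep_subspace[OF M v] x]
      by (auto simp: bij_betw_def inj_on_def)
  qed
  then show "\<exists>c. \<forall>v\<in>verts Q. \<forall>x\<in>rspace M v. f v x = kscale c x" by blast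
qed

section \<open>Coordinate models\<close>

text \<open>
  The vertices of the covering are addressed by lists of natural numbers, with the empty list for
  the root \<open>s\<close>; the nonempty address \<open>p\<close> also addresses the arc between \<open>p\<close> and \<open>butlast p\<close>.
\<close>

definition Adr :: "nat list set" where
  "Adr = {p. \<forall>k<length p. p ! k < (if k = 0 then 3 else 2)}"

lemma Adr_Nil [simp]: "[] \<in> Adr"
  by (simp add: Adr_def)

lemma Adr_snoc [simp]: "p @ [i] \<in> Adr \<longleftrightarrow> p \<in> Adr \<and> i < (if p = [] then 3 else 2)"
  by (auto simp: Adr_def nth_append less_Suc_eq)

lemma Adr_butlast [simp]: "p \<in> Adr \<Longrightarrow> butlast p \<in> Adr"
  by (cases p rule: rev_cases) auto

lemma Adr_single [simp]: "[i] \<in> Adr \<longleftrightarrow> i < 3"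
  using Adr_snoc[of "[]" i] by simp

lemma Adr_Cons [simp]: "x # y # p \<in> Adr \<longleftrightarrow> x # butlast (y # p) \<in> Adr \<and> last (y # p) < 2"
  using Adr_snoc[of "x # butlast (y # p)" "last (y # p)"] by auto

text \<open>The parity \<open>b\<close> tells whether the sources are the addresses of even or of odd length.\<close>

definition src :: "bool \<Rightarrow> nat list \<Rightarrow> nat list" where
  "src b p = (if even (length p) = b then p else butlast p)"

definition snk :: "bool \<Rightarrow> nat list \<Rightarrow> nat list" where
  "snk b p = (if even (length p) = b then butlast p else p)"

lemma even_length_src: "p \<noteq> [] \<Longrightarrow> even (length (src b p)) = b"
  by (cases p rule: rev_cases) (auto simp: src_def)

lemma even_length_snk: "p \<noteq> [] \<Longrightarrow> even (length (snk b p)) = (\<not> b)"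
  by (cases p rule: rev_cases) (auto simp: snk_def)

lemma src_Adr [simp]: "p \<in> Adr \<Longrightarrow> src b p \<in> Adr" and snk_Adr [simp]: "p \<in> Adr \<Longrightarrow> snk b p \<in> Adr"
  by (auto simp: src_def snk_def)

section \<open>Coordinate spaces and truncation\<close>

definition kn :: "nat \<Rightarrow> (nat \<Rightarrow> 'k::zero) set" where
  "kn n = {x. \<forall>i\<ge>n. x i = 0}"

definition trunc :: "nat \<Rightarrow> (nat \<Rightarrow> 'k::zero) \<Rightarrow> nat \<Rightarrow> 'k" where
  "trunc n x = (\<lambda>i. if i < n then x i else 0)"

definition unit :: "nat \<Rightarrow> nat \<Rightarrow> 'k::field" where
  "unit n = (\<lambda>i. if i = n then 1 else 0)"

lemma kn_0 [simp]: "kn 0 = {0}"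
  by (auto simp: kn_def fun_eq_iff)

lemma zero_kn [simp]: "0 \<in> kn n"
  by (simp add: kn_def)

lemma kn_mono: "m \<le> n \<Longrightarrow> kn m \<subseteq> kn n"
  by (auto simp: kn_def)

lemma subspace_kn [simp]: "kvec.subspace (kn n)"
  by (auto simp: kn_def kvec.subspace_def kscale_def)

lemma trunc_in_kn [simp]: "trunc n x \<in> kn n"
  by (simp add: trunc_def kn_def)

lemma trunc_id [simp]: "x \<in> kn n \<Longrightarrow> trunc n x = x"
  by (auto simp: trunc_def kn_def fun_eq_iff)

lemma trunc_trunc [simp]: "m \<le> n \<Longrightarrow> trunc m (trunc n x) = trunc m x"
  by (auto simp: trunc_def)

lemma trunc_add: "trunc n (x + y) = trunc n x + (trunc n y :: nat \<Rightarrow> 'k::field)"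
  by (auto simp: trunc_def)

lemma trunc_scale: "trunc n (kscale c x) = kscale c (trunc n x)"
  by (auto simp: trunc_def kscale_def)

lemma trunc_0 [simp]: "trunc 0 x = 0"
  by (auto simp: trunc_def)

lemma trunc_zero [simp]: "trunc n 0 = (0 :: nat \<Rightarrow> 'k::field)"
  by (auto simp: trunc_def)

lemma kn_Suc_decomp: "x \<in> kn (Suc n) \<Longrightarrow> x = trunc n x + kscale (x n) (unit n)"
  by (auto simp: kn_def trunc_def kscale_def unit_def fun_eq_iff le_Suc_eq not_less)

lemma unit_in_kn [simp]: "unit i \<in> kn n \<longleftrightarrow> i < n"
  by (auto simp: unit_def kn_def)

lemma kn_span: "kn n = kvec.span (unit ` {..<n})"
proof
  show "kvec.span (unit ` {..<n}) \<subseteq> (kn n :: (nat \<Rightarrow> 'a) set)"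
    by (rule kvec.span_minimal) auto
  show "kn n \<subseteq> kvec.span (unit ` {..<n} :: (nat \<Rightarrow> 'a) set)"
  proof (induction n)
    case (Suc n)
    show ?case
    proof
      fix x :: "nat \<Rightarrow> 'a" assume x: "x \<in> kn (Suc n)"
      have "trunc n x \<in> kvec.span (unit ` {..<Suc n})"
        using Suc kvec.span_mono[OF image_mono, of "{..<n}" "{..<Suc n}" "unit :: nat \<Rightarrow> nat \<Rightarrow> 'a"]
          trunc_in_kn[of n x] by (meson lessThan_subset_iff lessI less_imp_le subsetD)
      moreover have "kscale (x n) (unit n) \<in> kvec.span (unit ` {..<Suc n})"
        by (intro kvec.span_scale kvec.span_base) auto
      ultimately show "x \<in> kvec.span (unit ` {..<Suc n})"
        by (subst kn_Suc_decomp[OF x]) (rule kvec.span_add)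
    qed
  qed auto
qed

text \<open>The locale is meant for \<open>Q\<close> and \<open>opposite Q\<close> alike: both get
  the same addresses, and only the parity \<open>b\<close> of the sources differs.\<close>

locale coded_quiver =
  fixes Q :: "('v, 'e) pre_digraph" and w :: "nat list \<Rightarrow> 'v" and e :: "nat list \<Rightarrow> 'e" and b :: bool
  assumes bij_w: "bij_betw w Adr (verts Q)"
    and bij_e: "bij_betw e (Adr - {[]}) (arcs Q)"
    and tail_e: "\<And>p. p \<in> Adr \<Longrightarrow> p \<noteq> [] \<Longrightarrow> tail Q (e p) = w (src b p)"
    and head_e: "\<And>p. p \<in> Adr \<Longrightarrow> p \<noteq> [] \<Longrightarrow> head Q (e p) = w (snk b p)"
begin

definition vadr :: "'v \<Rightarrow> nat list" where "vadr = inv_into Adr w"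
definition eadr :: "'e \<Rightarrow> nat list" where "eadr = inv_into (Adr - {[]}) e"

lemma vadr_w [simp]: "p \<in> Adr \<Longrightarrow> vadr (w p) = p"
  using bij_w by (simp add: vadr_def bij_betw_def)

lemma eadr_e [simp]: "p \<in> Adr \<Longrightarrow> p \<noteq> [] \<Longrightarrow> eadr (e p) = p"
  using bij_e by (simp add: eadr_def bij_betw_def)

lemma verts_eq: "verts Q = w ` Adr"
  using bij_w by (simp add: bij_betw_def)

lemma arcs_eq: "arcs Q = e ` (Adr - {[]})"
  using bij_e by (simp add: bij_betw_def)

lemma w_in [simp]: "p \<in> Adr \<Longrightarrow> w p \<in> verts Q"
  by (simp add: verts_eq)

lemma e_in [simp]: "p \<in> Adr \<Longrightarrow> p \<noteq> [] \<Longrightarrow> e p \<in> arcs Q"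
  by (simp add: arcs_eq)

lemma w_eq_iff [simp]: "p \<in> Adr \<Longrightarrow> r \<in> Adr \<Longrightarrow> w p = w r \<longleftrightarrow> p = r"
  by (metis vadr_w)

lemma ball_verts: "(\<forall>v\<in>verts Q. P v) \<longleftrightarrow> (\<forall>p\<in>Adr. P (w p))"
  by (auto simp: verts_eq)

lemma ball_arcs: "(\<forall>a\<in>arcs Q. P a) \<longleftrightarrow> (\<forall>p\<in>Adr. p \<noteq> [] \<longrightarrow> P (e p))"
  by (auto simp: arcs_eq)

lemma wf: "wf_digraph Q"
  by unfold_locales (simp add: arcs_eq, metis DiffE imageE insertI1 src_Adr snk_Adr tail_e head_e w_in)+

text \<open>The matrices act on infinite sequences; they are cut off at the head by
  \<open>trunc\<close> and at the tail by the domain. So a single family \<open>A\<close> serves all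
  dimension vectors of the chain. The fixed values outside the quiver make models equal as records
  whenever their dimensions agree on \<open>Adr\<close>.\<close>

definition model :: "(nat list \<Rightarrow> (nat \<Rightarrow> 'k) \<Rightarrow> (nat \<Rightarrow> 'k)) \<Rightarrow> (nat list \<Rightarrow> nat) \<Rightarrow> ('v, 'e, 'k::field) rep" where
  "model A D = \<lparr>rspace = (\<lambda>v. if v \<in> verts Q then kn (D (vadr v)) else {0}),
     rmap = (\<lambda>a. if a \<in> arcs Q then trunc (D (snk b (eadr a))) \<circ> A (eadr a) else id)\<rparr>"

lemma rspace_model [simp]: "p \<in> Adr \<Longrightarrow> rspace (model A D) (w p) = kn (D p)"
  by (simp add: model_def)

lemma rmap_model [simp]:
  "p \<in> Adr \<Longrightarrow> p \<noteq> [] \<Longrightarrow> rmap (model A D) (e p) x = trunc (D (snk b p)) (A p x)"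
  by (simp add: model_def)

end

definition all_linear :: "(nat list \<Rightarrow> (nat \<Rightarrow> 'k) \<Rightarrow> (nat \<Rightarrow> 'k::field)) \<Rightarrow> bool" where
  "all_linear A \<longleftrightarrow> (\<forall>p. linear_on kscale kscale UNIV (A p))"

definition finite_dims :: "(nat list \<Rightarrow> nat) \<Rightarrow> bool" where
  "finite_dims D \<longleftrightarrow> finite {p \<in> Adr. D p \<noteq> 0}"

text \<open>Endomorphisms of \<open>model A D\<close>, transported to addresses, so that the
  calculations with matrices do not mention a quiver.\<close>

definition endo ::
  "bool \<Rightarrow> (nat list \<Rightarrow> (nat \<Rightarrow> 'k) \<Rightarrow> (nat \<Rightarrow> 'k::field)) \<Rightarrow> (nat list \<Rightarrow> nat) \<Rightarrow>
   (nat list \<Rightarrow> (nat \<Rightarrow> 'k) \<Rightarrow> (nat \<Rightarrow> 'k)) \<Rightarrow> bool" where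
  "endo b A D f \<longleftrightarrow>
     (\<forall>p\<in>Adr. linear_on kscale kscale (kn (D p)) (f p) \<and> f p ` kn (D p) \<subseteq> kn (D p)) \<and>
     (\<forall>p\<in>Adr. p \<noteq> [] \<longrightarrow> (\<forall>x\<in>kn (D (src b p)).
        f (snk b p) (trunc (D (snk b p)) (A p x)) = trunc (D (snk b p)) (A p (f (src b p) x))))"

definition scalar_at :: "(nat list \<Rightarrow> nat) \<Rightarrow> (nat list \<Rightarrow> (nat \<Rightarrow> 'k) \<Rightarrow> (nat \<Rightarrow> 'k::field)) \<Rightarrow> 'k \<Rightarrow> nat list \<Rightarrow> bool" where
  "scalar_at D f c p \<longleftrightarrow> (\<forall>x\<in>kn (D p). f p x = kscale c x)"

definition brick_dims ::
  "bool \<Rightarrow> (nat list \<Rightarrow> (nat \<Rightarrow> 'k) \<Rightarrow> (nat \<Rightarrow> 'k::field)) \<Rightarrow> (nat list \<Rightarrow> nat) \<Rightarrow> bool" where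
  "brick_dims b A D \<longleftrightarrow> (\<forall>f. endo b A D f \<longrightarrow> (\<exists>c. \<forall>p\<in>Adr. scalar_at D f c p))"

lemma linear_on_trunc_comp:
  assumes "all_linear A"
  shows "linear_on kscale kscale S (trunc n \<circ> A p)"
  using assms unfolding all_linear_def linear_on_def by (auto simp: trunc_add trunc_scale)

context coded_quiver
begin

lemma is_rep_model:
  assumes A: "all_linear A" and D: "finite_dims D"
  shows "is_rep Q (model A D)"
  unfolding is_rep_def ball_verts ball_arcs
proof (intro conjI ballI impI)
  fix p assume p: "p \<in> Adr"
  show "\<exists>B. finite B \<and> rspace (model A D) (w p) = kvec.span B"
    using kn_span[of "D p"] p by (intro exI[of _ "unit ` {..<D p}"]) auto
next
  have "{v \<in> verts Q. rspace (model A D) v \<noteq> {0}} \<subseteq> w ` {p \<in> Adr. D p \<noteq> 0}"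
    by (auto simp: verts_eq image_iff)
  then show "finite {v \<in> verts Q. rspace (model A D) v \<noteq> {0}}"
    using D finite_subset unfolding finite_dims_def by blast
next
  fix p assume p: "p \<in> Adr" "p \<noteq> []"
  then have "rmap (model A D) (e p) = trunc (D (snk b p)) \<circ> A p" by auto
  then show "linear_on kscale kscale (rspace (model A D) (tail Q (e p))) (rmap (model A D) (e p))"
    by (simp add: linear_on_trunc_comp[OF A])
  show "rmap (model A D) (e p) ` rspace (model A D) (tail Q (e p)) \<subseteq> rspace (model A D) (head Q (e p))"
    using p by (auto simp: head_e)
qed

lemma brick_model:
  assumes "brick_dims b A D"
  shows "brick Q (model A D)"
  unfolding brick_def
proof (intro allI impI)
  fix f assume f: "rep_hom Q (model A D) (model A D) f"
  have "endo b A D (f \<circ> w)"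
    using f unfolding endo_def rep_hom_def ball_verts ball_arcs by (auto simp: tail_e head_e)
  then show "\<exists>c. \<forall>v\<in>verts Q. \<forall>x\<in>rspace (model A D) v. f v x = kscale c x"
    using assms unfolding brick_dims_def ball_verts scalar_at_def by auto
qed

text \<open>The invariant of the chain. The length is required to be positive because the rules of
  \<open>accessible\<close> ask for length greater than 1 after the next step.\<close>

definition good :: "(nat list \<Rightarrow> (nat \<Rightarrow> 'k) \<Rightarrow> (nat \<Rightarrow> 'k::field)) \<Rightarrow> (nat list \<Rightarrow> nat) \<Rightarrow> bool" where
  "good A D \<longleftrightarrow> finite_dims D \<and> brick_dims b A D \<and> accessible Q (model A D) \<and>
     (\<exists>l>0. has_length Q (model A D) l)"

lemma model_nonzero:
  fixes A :: "nat list \<Rightarrow> (nat \<Rightarrow> 'k::field) \<Rightarrow> (nat \<Rightarrow> 'k)"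
  assumes "p \<in> Adr" "D p > 0"
  shows "\<not> family_eq Q (rspace (model A D)) zero_family"
proof -
  have "unit 0 \<in> rspace (model A D) (w p)" "unit 0 \<noteq> (0 :: nat \<Rightarrow> 'k)"
    using assms by (simp, metis unit_def zero_fun_apply zero_neq_one)
  then show ?thesis using assms(1) unfolding family_eq_def ball_verts zero_family_def by blast
qed

end

lemma finite_dims_upd: "finite_dims D \<Longrightarrow> finite_dims (D(p := n))"
  unfolding finite_dims_def by (rule finite_subset[of _ "insert p {p \<in> Adr. D p \<noteq> 0}"]) auto

context coded_quiver
begin

text \<open>No arc starts at a sink, and the maps into it are truncated anyway, so cutting off one
  more coordinate is compatible with all maps.\<close>

lemma model_factor_hom:
  assumes p: "p \<in> Adr" "even (length p) \<noteq> b"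
  shows "rep_hom Q (model A (D(p := Suc (D p)))) (model A D) (\<lambda>v. if v = w p then trunc (D p) else id)"
  unfolding rep_hom_def ball_verts ball_arcs
proof (intro conjI ballI impI)
  fix r assume r: "r \<in> Adr"
  show "linear_on kscale kscale (rspace (model A (D(p := Suc (D p)))) (w r)) (if w r = w p then trunc (D p) else id)"
    by (auto simp: linear_on_def trunc_add trunc_scale)
  show "(if w r = w p then trunc (D p) else id) ` rspace (model A (D(p := Suc (D p)))) (w r)
          \<subseteq> rspace (model A D) (w r)"
    using r p by auto
next
  fix r x assume r: "r \<in> Adr" "r \<noteq> []" and x: "x \<in> rspace (model A (D(p := Suc (D p)))) (tail Q (e r))"
  have "src b r \<noteq> p" using even_length_src[OF r(2), of b] p by auto
  then show "(if head Q (e r) = w p then trunc (D p) else id) (rmap (model A (D(p := Suc (D p)))) (e r) x) =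
       rmap (model A D) (e r) ((if tail Q (e r) = w p then trunc (D p) else id) x)"
    using r p by (auto simp: head_e tail_e)
qed

text \<open>\<open>is_factor_rep\<close> admits any epimorphism. Composing \<open>\<phi>\<close>
  with the truncation at \<open>p\<close> gives one with a one-dimensional kernel, so the step can
  start from any representation isomorphic to the larger model. With the identity it is an ordinary
  step of the chain; with a proper isomorphism it is the last step, which reaches
  \<open>P_tilde Q s 4\<close>.\<close>

lemma accessible_iso_sink:
  fixes A :: "nat list \<Rightarrow> (nat \<Rightarrow> 'k::field) \<Rightarrow> (nat \<Rightarrow> 'k)"
  assumes A: "all_linear A" and D: "good A D" and p: "p \<in> Adr" "even (length p) \<noteq> b"
    and br: "brick_dims b A (D(p := Suc (D p)))"
    and M: "is_rep Q M" and iso: "rep_iso Q M (model A (D(p := Suc (D p)))) \<phi>"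
  shows "accessible Q M \<and> (\<exists>l>0. has_length Q M l)"
proof -
  let ?N = "model A (D(p := Suc (D p)))"
  have N: "is_rep Q (model A D)" using D by (auto simp: good_def intro: is_rep_model[OF A])
  have hom: "rep_hom Q M ?N \<phi>" and bij: "\<And>v. v \<in> verts Q \<Longrightarrow> bij_betw (\<phi> v) (rspace M v) (rspace ?N v)"
    using iso by (auto simp: rep_iso_def)
  have zero: "0 \<in> rspace M v" "\<phi> v 0 = 0" if "v \<in> verts Q" for v
    using kvec.subspace_0[OF is_rep_subspace[OF M that]] linear_on_zero[OF rep_hom_linear[OF hom that]] by auto
  have inj: "x = 0" if "v \<in> verts Q" "x \<in> rspace M v" "\<phi> v x = 0" for v x
    using bij[OF that(1)] that(2,3) zero[OF that(1)] unfolding bij_betw_def inj_on_def by metis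
  have wp: "w p \<in> verts Q" using p by simp
  have "unit (D p) \<in> rspace ?N (w p)" using p(1) by simp
  moreover have unit_nonzero: "unit (D p) \<noteq> (0 :: nat \<Rightarrow> 'k)" by (auto simp: unit_def fun_eq_iff)
  \<comment> \<open>\<open>z\<close> corresponds to the coordinate that the truncation removes, and
    so it will span the kernel.\<close>
  ultimately obtain z where z: "z \<in> rspace M (w p)" "\<phi> (w p) z = unit (D p)"
    using bij[OF wp] by (metis bij_betw_imp_surj_on imageE)
  have z0: "z \<noteq> 0" using z(2) zero(2)[OF wp] unit_nonzero by metis
  have "\<not> family_eq Q (rspace M) zero_family"
    using wp z(1) z0 unfolding family_eq_def zero_family_def by blast
  then have ind: "indecomposable Q M"
    by (rule brick_indecomposable[OF wf M _ brick_iso[OF wf M iso brick_model[OF br]]])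
  let ?\<pi> = "\<lambda>v. if v = w p then trunc (D p) else id"
  note hom' = rep_hom_comp[OF wf hom model_factor_hom[OF p]]
  have surj: "(?\<pi> v \<circ> \<phi> v) ` rspace M v = rspace (model A D) v" if v: "v \<in> verts Q" for v
  proof -
    obtain r where r: "r \<in> Adr" "v = w r" using v by (auto simp: verts_eq)
    have "(?\<pi> v \<circ> \<phi> v) ` rspace M v = ?\<pi> v ` rspace ?N v"
      unfolding image_comp[symmetric] bij_betw_imp_surj_on[OF bij[OF v]] ..
    moreover have "trunc (D p) ` kn (Suc (D p)) = kn (D p)"
      using kn_mono[of "D p" "Suc (D p)"] by (force simp: image_iff)
    ultimately show ?thesis using r p by auto
  qed
  obtain l where l: "l > 0" "has_length Q (model A D) l" and acc: "accessible Q (model A D)"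
    using D by (auto simp: good_def)
  have len: "has_length Q M (Suc l)"
  proof (rule has_length_factor[OF wf M N hom' surj wp z(1) z0 _ _ _ l(2)])
    show "(?\<pi> (w p) \<circ> \<phi> (w p)) z = 0"
      using z(2) by (auto simp: unit_def trunc_def fun_eq_iff)
    show "\<exists>c. x = kscale c z" if x: "x \<in> rspace M (w p)" "(?\<pi> (w p) \<circ> \<phi> (w p)) x = 0" for x
    proof -
      have "\<phi> (w p) x \<in> kn (Suc (D p))" using rep_hom_in[OF hom wp x(1)] p by simp
      then obtain c where "\<phi> (w p) x = kscale c (unit (D p))"
        using kn_Suc_decomp[of "\<phi> (w p) x" "D p"] x(2) by auto
      then have "\<phi> (w p) x = \<phi> (w p) (kscale c z)"
        using linear_on_scale[OF rep_hom_linear[OF hom wp] z(1)] z(2) by simp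
      then show ?thesis
        using bij[OF wp] x(1) kvec.subspace_scale[OF is_rep_subspace[OF M wp] z(1)]
        unfolding bij_betw_def inj_on_def by blast
    qed
    show "x = 0" if "v \<in> verts Q" "v \<noteq> w p" "x \<in> rspace M v" "(?\<pi> v \<circ> \<phi> v) x = 0" for v x
      using that inj by simp
  qed
  moreover have "is_factor_rep Q M (model A D)"
    using hom' surj N unfolding is_factor_rep_def by blast
  then have "accessible Q M"
    using accessible.factor[OF len _ ind, of "model A D"] l acc by simp
  ultimately show ?thesis by blast
qed

lemma good_step:
  assumes A: "all_linear A" and D: "good A D" and p: "p \<in> Adr" and br: "brick_dims b A (D(p := Suc (D p)))"
  shows "good A (D(p := Suc (D p)))"
proof -
  let ?D = "D(p := Suc (D p))"
  let ?M = "model A ?D"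
  have fin: "finite_dims ?D" using D by (simp add: good_def finite_dims_upd)
  have M: "is_rep Q ?M" and N: "is_rep Q (model A D)"
    using D by (auto simp: good_def intro: is_rep_model[OF A] fin)
  have ind: "indecomposable Q ?M"
    by (rule brick_indecomposable[OF wf M model_nonzero[OF p] brick_model[OF br]]) simp
  obtain l where l: "l > 0" "has_length Q (model A D) l" and acc: "accessible Q (model A D)"
    using D by (auto simp: good_def)
  have wp: "w p \<in> verts Q" using p by simp
  have un: "unit (D p) \<in> rspace ?M (w p)" using p by simp
  have "accessible Q ?M \<and> (\<exists>l>0. has_length Q ?M l)"
  proof (cases "even (length p) = b")
    case True
    let ?U = "rspace (model A D)"
    \<comment> \<open>A source is never the head of an arc, so lowering its dimension affects no
      truncation and the two models have the same maps.\<close>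
    have eq: "?M\<lparr>rspace := ?U\<rparr> = model A D"
    proof -
      have "snk b (eadr a) \<noteq> p" if "a \<in> arcs Q" for a
        using that True even_length_snk[of "eadr a" b] by (auto simp: arcs_eq)
      then show ?thesis by (auto simp: model_def fun_eq_iff)
    qed
    have sub: "is_subrep Q ?M ?U"
      unfolding is_subrep_def
    proof (intro conjI ballI)
      fix v assume "v \<in> verts Q"
      then show "kvec.subspace (?U v)" "?U v \<subseteq> rspace ?M v"
        using kn_mono[of "D p" "Suc (D p)"] by (auto simp: model_def)
    next
      fix a assume a: "a \<in> arcs Q"
      have "rmap ?M a = rmap (model A D) a" by (metis eq rep.select_convs(2) rep.surjective rep.update_convs(1))
      then show "rmap ?M a ` ?U (tail Q a) \<subseteq> ?U (head Q a)"
        using is_rep_map_in[OF N a] by auto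
    qed
    have "has_length Q ?M (Suc l)"
    proof (rule has_length_sub[OF M sub wp un])
      show "unit (D p) \<notin> ?U (w p)" using p by simp
      show "\<exists>c. x - kscale c (unit (D p)) \<in> ?U (w p)" if "x \<in> rspace ?M (w p)" for x
        using that p by (intro exI[of _ "x (D p)"]) (auto simp: kn_def kscale_def unit_def le_Suc_eq)
      show "?U v = rspace ?M v" if "v \<in> verts Q" "v \<noteq> w p" for v
        using that by (auto simp: verts_eq split: if_splits)
      show "has_length Q (?M\<lparr>rspace := ?U\<rparr>) l" using l eq by simp
    qed
    moreover have "accessible Q ?M"
      by (rule accessible.sub[OF calculation _ ind sub]) (use l acc eq in simp_all)
    ultimately show ?thesis by blast
  next
    case False
    have "rep_iso Q ?M ?M (\<lambda>_. id)" by (simp add: rep_iso_def rep_hom_def linear_on_def)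
    then show ?thesis by (rule accessible_iso_sink[OF A D p False br M])
  qed
  then show ?thesis using fin br by (auto simp: good_def)
qed

lemma good_simple:
  fixes A :: "nat list \<Rightarrow> (nat \<Rightarrow> 'k::field) \<Rightarrow> (nat \<Rightarrow> 'k)"
  assumes A: "all_linear A" and p: "p \<in> Adr"
  shows "good A ((\<lambda>_. 0)(p := 1))"
proof -
  let ?D = "(\<lambda>_. 0)(p := 1) :: nat list \<Rightarrow> nat"
  let ?M = "model A ?D"
  have fin: "finite_dims ?D" using finite_dims_upd[of "\<lambda>_. 0" p 1] by (simp add: finite_dims_def)
  have line: "\<exists>c. x = kscale c (unit 0)" if "x \<in> kn 1" for x :: "nat \<Rightarrow> 'k"
    using kn_Suc_decomp[of x 0] that by auto
  have sub: "family_eq Q U zero_family \<or> family_eq Q U (rspace ?M)" if U: "is_subrep Q ?M U" for U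
  proof -
    have U': "kvec.subspace (U (w r))" "U (w r) \<subseteq> kn (?D r)" if "r \<in> Adr" for r
      using U that unfolding is_subrep_def ball_verts by auto
    have "U (w r) = {0}" if "r \<in> Adr" "r \<noteq> p" for r
      using U'[OF that(1)] that kvec.subspace_0 by fastforce
    moreover have "U (w p) = {0} \<or> U (w p) = kn 1"
    proof -
      have "U (w p) = {0} \<or> unit 0 \<in> U (w p)"
        using line_subspace_cases[OF U'(1)[OF p]] U'(2)[OF p] line by (metis fun_upd_same subsetD)
      moreover have "kn 1 \<subseteq> U (w p)" if "unit 0 \<in> U (w p)"
        using line kvec.subspace_scale[OF U'(1)[OF p] that] by blast
      ultimately show ?thesis using U'(2)[OF p] by auto
    qed
    ultimately show ?thesis
      using p unfolding family_eq_def ball_verts zero_family_def by (metis fun_upd_apply kn_0 rspace_model)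
  qed
  have M: "is_rep Q ?M" by (rule is_rep_model[OF A fin])
  have ne: "\<not> family_eq Q (rspace ?M) zero_family" by (rule model_nonzero[OF p]) simp
  have simple: "simple_rep Q ?M" using M ne sub unfolding simple_rep_def by blast
  have full: "is_subrep Q ?M (rspace ?M)"
    using is_rep_subspace[OF M] is_rep_map_in[OF M] unfolding is_subrep_def by blast
  have "has_length Q ?M 1"
    unfolding has_length_def
  proof (intro exI[of _ "\<lambda>i::nat. if i = 0 then zero_family else rspace ?M"] conjI allI impI)
    fix i :: nat assume "i < 1"
    then show "\<not> family_eq Q (if i = 0 then zero_family else rspace ?M)
          (if Suc i = 0 then zero_family else rspace ?M)"
      using ne by (auto simp: family_eq_def)
    show "family_le Q (if i = 0 then zero_family else rspace ?M)
          (if Suc i = 0 then zero_family else rspace ?M)"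
      using \<open>i < 1\<close> by (auto simp: family_le_def zero_family_def model_def)
    fix W assume "is_subrep Q ?M W"
    then show "family_eq Q W (if i = 0 then zero_family else rspace ?M) \<or>
         family_eq Q W (if Suc i = 0 then zero_family else rspace ?M)"
      using sub \<open>i < 1\<close> by auto
  qed (use full is_subrep_zero[OF wf M] in \<open>auto simp: family_eq_def\<close>)
  moreover have "brick_dims b A ?D"
    unfolding brick_dims_def
  proof (intro allI impI)
    fix f assume f: "endo b A ?D f"
    have lin: "linear_on kscale kscale (kn (?D r)) (f r)" "f r ` kn (?D r) \<subseteq> kn (?D r)" if "r \<in> Adr" for r
      using f that unfolding endo_def by blast+
    obtain c where c: "f p (unit 0) = kscale c (unit 0)"
      using lin(2)[OF p] line by force
    have "scalar_at ?D f c r" if r: "r \<in> Adr" for r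
      unfolding scalar_at_def
    proof
      fix x :: "nat \<Rightarrow> 'k" assume x: "x \<in> kn (?D r)"
      show "f r x = kscale c x"
      proof (cases "r = p")
        case True
        then obtain d where "x = kscale d (unit 0)" using line x by auto
        then show ?thesis
          using linear_on_scale[OF lin(1)[OF p], of "unit 0" d] c True by (simp add: mult.commute)
      next
        case False
        then show ?thesis using x linear_on_zero[OF lin(1)[OF r]] by simp
      qed
    qed
    then show "\<exists>c. \<forall>p\<in>Adr. scalar_at ?D f c p" by blast
  qed
  ultimately show ?thesis
    using fin accessible.simple[OF simple] unfolding good_def by (metis zero_less_one)
qed

end

lemma endoD:
  assumes "endo b A D f" "p \<in> Adr"
  shows "linear_on kscale kscale (kn (D p)) (f p)" "x \<in> kn (D p) \<Longrightarrow> f p x \<in> kn (D p)"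
  using assms unfolding endo_def by auto

lemma endo_commute:
  assumes "endo b A D f" "p \<in> Adr" "p \<noteq> []" "x \<in> kn (D (src b p))"
  shows "f (snk b p) (trunc (D (snk b p)) (A p x)) = trunc (D (snk b p)) (A p (f (src b p) x))"
  using assms unfolding endo_def by blast

section \<open>Addresses in the covering\<close>

definition adj :: "('v, 'e) pre_digraph \<Rightarrow> 'v \<Rightarrow> 'v \<Rightarrow> bool" where
  "adj Q u v \<longleftrightarrow> (\<exists>a\<in>arcs Q. tail Q a = u \<and> head Q a = v \<or> tail Q a = v \<and> head Q a = u)"

lemma adj_sym: "adj Q u v \<longleftrightarrow> adj Q v u"
  by (auto simp: adj_def)

lemma arcs_ends_mk_symmetric: "(u, v) \<in> parcs (mk_symmetric Q) \<longleftrightarrow> adj Q u v"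
  by (auto simp: parcs_mk_symmetric adj_def)

lemma vpath_Nil: "\<not> vpath [] G"
  by (auto simp: vpath_def vwalk_def)

lemma vpath_snoc:
  "vpath (xs @ [u, v]) G \<longleftrightarrow> vpath (xs @ [u]) G \<and> v \<in> verts G \<and> (u, v) \<in> arcs_ends G \<and> v \<notin> set (xs @ [u])"
  using vwalk_arcs_append[of "xs @ [u]" "[v]"] by (auto simp: vpath_def vwalk_def)

lemma vpath_prefix: "vpath (xs @ [v] @ ys) G \<Longrightarrow> vpath (xs @ [v]) G"
  using set_vwalk_arcs_append1[of "xs @ [v]" ys] by (auto simp: vpath_def vwalk_def)

locale tree_root =
  fixes Q :: "('v, 'e) pre_digraph" and s :: 'v
  assumes cover: "universal_cover_3_Kronecker Q" and sink: "is_sink Q s"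
begin

abbreviation "G \<equiv> with_proj (mk_symmetric Q)"

sublocale wf_digraph Q
  using cover by (simp add: universal_cover_3_Kronecker_def is_tree_quiver_def loopfree_digraph_def)

lemma nomulti: "a \<in> arcs Q \<Longrightarrow> a' \<in> arcs Q \<Longrightarrow> tail Q a = tail Q a' \<Longrightarrow> head Q a = head Q a' \<Longrightarrow> a = a'"
  using cover nomulti_digraph.no_multi_arcs[of Q a a']
  by (auto simp: universal_cover_3_Kronecker_def is_tree_quiver_def arc_to_ends_def)

lemma no_loop: "a \<in> arcs Q \<Longrightarrow> tail Q a \<noteq> head Q a"
  using cover loopfree_digraph.no_loops[of Q a]
  by (auto simp: universal_cover_3_Kronecker_def is_tree_quiver_def)

lemma s_vert: "s \<in> verts Q"
  using sink by (simp add: is_sink_def)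

lemma adj_verts: "adj Q u v \<Longrightarrow> u \<in> verts Q \<and> v \<in> verts Q"
  by (auto simp: adj_def)

lemma adj_neq: "adj Q u v \<Longrightarrow> u \<noteq> v"
  using no_loop by (fastforce simp: adj_def)

lemma unique_path: "v \<in> verts Q \<Longrightarrow> \<exists>!p. vpath p G \<and> hd p = s \<and> last p = v"
  using cover s_vert by (auto simp: universal_cover_3_Kronecker_def is_tree_quiver_def)

section \<open>Paths from the root, parents and children\<close>

definition pth :: "'v \<Rightarrow> 'v list" where
  "pth v = (THE p. vpath p G \<and> hd p = s \<and> last p = v)"

lemma pth: "v \<in> verts Q \<Longrightarrow> vpath (pth v) G \<and> hd (pth v) = s \<and> last (pth v) = v"
  unfolding pth_def by (rule theI'[OF unique_path])

lemma pth_eqI: "v \<in> verts Q \<Longrightarrow> vpath p G \<Longrightarrow> hd p = s \<Longrightarrow> last p = v \<Longrightarrow> pth v = p"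
  using unique_path[of v] pth[of v] by blast

lemma pth_s: "pth s = [s]"
  by (rule pth_eqI[OF s_vert]) (auto simp: vpath_def vwalk_def s_vert)

lemma pth_snocE:
  assumes "v \<in> verts Q"
  obtains xs where "pth v = xs @ [v]"
  using pth[OF assms] vpath_Nil by (metis append_butlast_last_id)

lemma pth_snocI:
  assumes uv: "adj Q u v" and n: "v \<notin> set (pth u)"
  shows "pth v = pth u @ [v]"
proof -
  have V: "u \<in> verts Q" "v \<in> verts Q" using adj_verts[OF uv] by auto
  obtain xs where xs: "pth u = xs @ [u]" by (rule pth_snocE[OF V(1)])
  have "vpath (xs @ [u, v]) G"
    using pth[OF V(1)] xs n uv V by (simp add: vpath_snoc arcs_ends_mk_symmetric)
  then show ?thesis
    using pth[OF V(1)] xs by (intro pth_eqI[OF V(2)]) (auto simp: hd_append split: if_splits)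
qed

lemma pth_prefix:
  assumes "u \<in> verts Q" "pth u = xs @ v # ys"
  shows "pth v = xs @ [v]"
proof (rule pth_eqI)
  show "vpath (xs @ [v]) G" using vpath_prefix[of xs v ys G] pth[OF assms(1)] assms(2) by simp
  then show "v \<in> verts Q" by (auto simp: vpath_def vwalk_def)
  show "hd (xs @ [v]) = s" using pth[OF assms(1)] assms(2) by (auto simp: hd_append)
qed simp

text \<open>If \<open>v\<close> is not on the path to \<open>u\<close>, appending it gives the path
  to \<open>v\<close>. Otherwise the path to \<open>v\<close> is an initial segment that avoids
  \<open>u\<close>, and the first case applies with the roles exchanged.\<close>

lemma pth_adj:
  assumes uv: "adj Q u v"
  shows "pth v = pth u @ [v] \<or> pth u = pth v @ [u]"
proof (cases "v \<in> set (pth u)")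
  case False
  then show ?thesis using pth_snocI[OF uv] by simp
next
  case True
  have V: "u \<in> verts Q" "v \<in> verts Q" using adj_verts[OF uv] by auto
  obtain xs ys where xy: "pth u = xs @ v # ys" using split_list[OF True] by blast
  have v: "pth v = xs @ [v]" by (rule pth_prefix[OF V(1) xy])
  have "distinct (pth u)" "last (pth u) = u" using pth[OF V(1)] by (auto simp: vpath_def)
  then have "u \<notin> set (pth v)"
    using xy v adj_neq[OF uv] by (cases ys rule: rev_cases) auto
  then show ?thesis using pth_snocI[of v u] uv adj_sym by metis
qed

definition children :: "'v \<Rightarrow> 'v set" where
  "children v = {u. adj Q v u \<and> pth u = pth v @ [u]}"

lemma source_or_sink: "v \<in> verts Q \<Longrightarrow> is_source Q v \<or> is_sink Q v"
  using cover by (auto simp: universal_cover_3_Kronecker_def)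

text \<open>The degree condition counts arcs, not neighbours. Sending an arc at \<open>v\<close> to
  its other end is injective: as \<open>v\<close> is a source or a sink, it is on the same side of
  all its arcs, and two of them with the same other end would be parallel.\<close>

lemma card_nbrs:
  assumes v: "v \<in> verts Q"
  shows "card {u. adj Q v u} = 3"
proof -
  let ?other = "\<lambda>a. if tail Q a = v then head Q a else tail Q a"
  have "bij_betw ?other (in_arcs Q v \<union> out_arcs Q v) {u. adj Q v u}"
    unfolding bij_betw_def
  proof
    show "inj_on ?other (in_arcs Q v \<union> out_arcs Q v)"
      using source_or_sink[OF v]
    proof
      assume "is_source Q v"
      then show ?thesis using nomulti by (auto simp: is_source_def inj_on_def)
    next
      assume "is_sink Q v"
      then have "out_arcs Q v = {}" by (simp add: is_sink_def)
      then show ?thesis using nomulti no_loop by (fastforce simp: inj_on_def)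
    qed
    show "?other ` (in_arcs Q v \<union> out_arcs Q v) = {u. adj Q v u}"
    proof (intro equalityI subsetI)
      fix u assume "u \<in> ?other ` (in_arcs Q v \<union> out_arcs Q v)"
      then show "u \<in> {u. adj Q v u}" by (auto simp: adj_def)
    next
      fix u assume "u \<in> {u. adj Q v u}"
      then obtain a where "a \<in> arcs Q" "tail Q a = v \<and> head Q a = u \<or> tail Q a = u \<and> head Q a = v"
        by (auto simp: adj_def)
      then show "u \<in> ?other ` (in_arcs Q v \<union> out_arcs Q v)"
        using no_loop by (intro image_eqI[of _ _ a]) auto
    qed
  qed
  then show ?thesis
    using cover v by (auto simp: universal_cover_3_Kronecker_def dest: bij_betw_same_card)
qed

lemma children_s: "children s = {u. adj Q s u}"
proof -
  have "pth u \<noteq> []" if "adj Q s u" for u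
    using adj_verts[OF that] pth[of u] vpath_Nil by metis
  then show ?thesis using pth_adj[of s] by (fastforce simp: children_def pth_s)
qed

text \<open>The parent is the last but one vertex of the path to \<open>v\<close>. A neighbour of
  \<open>v\<close> that is not a child has a path which \<open>v\<close> extends; this is the path
  of the parent, and a path determines its end.\<close>

lemma parent:
  assumes v: "v \<in> verts Q" "v \<noteq> s"
  obtains u where "u \<in> verts Q" "v \<in> children u" "children v = {x. adj Q v x} - {u}" "adj Q v u"
proof -
  obtain xs where xs: "pth v = xs @ [v]" by (rule pth_snocE[OF v(1)])
  have "xs \<noteq> []" using pth[OF v(1)] xs v(2) by auto
  then obtain ys u where ys: "xs = ys @ [u]" by (metis rev_exhaust)
  have u: "pth u = xs" using pth_prefix[OF v(1), of ys u "[v]"] xs ys by simp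
  have "vpath (ys @ [u, v]) G" using pth[OF v(1)] xs ys by simp
  then have uv: "adj Q u v" by (simp add: vpath_snoc arcs_ends_mk_symmetric)
  have "children v = {x. adj Q v x} - {u}"
  proof (intro equalityI subsetI)
    fix x assume "x \<in> children v"
    then show "x \<in> {x. adj Q v x} - {u}" using u xs by (auto simp: children_def)
  next
    fix x assume x: "x \<in> {x. adj Q v x} - {u}"
    have "pth v \<noteq> pth x @ [v]"
    proof
      assume "pth v = pth x @ [v]"
      then have "pth x = pth u" using u xs by simp
      then have "x = u" using pth[of x] pth[of u] adj_verts[of v x] adj_verts[OF uv] x by auto
      then show False using x by simp
    qed
    then have "pth x = pth v @ [x]" using pth_adj[of v x] x by blast
    then show "x \<in> children v" using x by (simp add: children_def)
  qed
  moreover have "v \<in> children u" using u xs uv by (simp add: children_def)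
  moreover have "u \<in> verts Q" "adj Q v u" using adj_verts[OF uv] uv adj_sym[of Q] by auto
  ultimately show ?thesis using that[of u] by blast
qed

lemma card_children:
  assumes "v \<in> verts Q"
  shows "card (children v) = (if v = s then 3 else 2)"
proof (cases "v = s")
  case True
  then show ?thesis using card_nbrs[OF assms] children_s by simp
next
  case False
  obtain u where "children v = {x. adj Q v x} - {u}" "adj Q v u" by (rule parent[OF assms False])
  then show ?thesis using card_nbrs[OF assms] False by (simp add: card_Diff_singleton)
qed

section \<open>Enumeration of the tree by addresses\<close>

definition child :: "'v \<Rightarrow> nat \<Rightarrow> 'v" where
  "child v = (SOME h. bij_betw h {..<if v = s then 3 else 2} (children v))"

lemma child:
  assumes "v \<in> verts Q"
  shows "bij_betw (child v) {..<if v = s then 3 else 2} (children v)"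
proof -
  have "card (children v) > 0" using card_children[OF assms] by simp
  then have "finite (children v)" by (rule card_ge_0_finite)
  then obtain h where "bij_betw h {0..<card (children v)} (children v)"
    using ex_bij_betw_nat_finite by blast
  then have "\<exists>h. bij_betw h {..<if v = s then 3 else 2 :: nat} (children v)"
    using card_children[OF assms] by (auto simp: atLeast0LessThan)
  then show ?thesis unfolding child_def by (rule someI_ex)
qed

definition vert :: "nat list \<Rightarrow> 'v" where
  "vert = foldl child s"

lemma vert_simps [simp]: "vert [] = s" "vert (p @ [i]) = child (vert p) i"
  by (simp_all add: vert_def)

lemma vert_Adr:
  assumes "p \<in> Adr"
  shows "vert p \<in> verts Q \<and> length (pth (vert p)) = Suc (length p) \<and>
    (p \<noteq> [] \<longrightarrow> vert p \<noteq> s \<and> vert p \<in> children (vert (butlast p)))"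
  using assms
proof (induction p rule: rev_induct)
  case Nil
  then show ?case by (simp add: s_vert pth_s)
next
  case (snoc i p)
  then have p: "p \<in> Adr" "i < (if p = [] then 3 else 2)" by auto
  with snoc.IH have V: "vert p \<in> verts Q" "length (pth (vert p)) = Suc (length p)" "vert p = s \<longleftrightarrow> p = []"
    by auto
  have c: "child (vert p) i \<in> children (vert p)"
    using child[OF V(1)] p(2) V(3) by (auto simp: bij_betw_def)
  then have "length (pth (child (vert p) i)) = Suc (Suc (length p))"
    using V(2) by (simp add: children_def)
  then show ?case using c adj_verts by (auto simp: children_def pth_s)
qed

lemma vert_eq_s: "p \<in> Adr \<Longrightarrow> vert p = s \<longleftrightarrow> p = []"
  using vert_Adr[of p] by auto

text \<open>Removing the last vertex from the path of a child gives the path of its parent, so equal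
  vertices have equal parents; then the enumeration of the children separates the last
  entries.\<close>

lemma inj_vert: "p \<in> Adr \<Longrightarrow> q \<in> Adr \<Longrightarrow> vert p = vert q \<Longrightarrow> p = q"
proof (induction p arbitrary: q rule: rev_induct)
  case Nil
  then show ?case using vert_eq_s[of q] by simp
next
  case (snoc i p)
  then have "q \<noteq> []" using vert_eq_s[of "p @ [i]"] by auto
  then obtain r j where q: "q = r @ [j]" by (metis rev_exhaust)
  have p: "p \<in> Adr" "i < (if p = [] then 3 else 2)" and r: "r \<in> Adr" "j < (if r = [] then 3 else 2)"
    using snoc.prems q by auto
  have "vert (p @ [i]) \<in> children (vert p)" "vert q \<in> children (vert r)"
    using vert_Adr[OF snoc.prems(1)] vert_Adr[OF snoc.prems(2)] q by auto
  then have "pth (vert p) = pth (vert r)" using snoc.prems(3) by (simp add: children_def)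
  then have "vert p = vert r"
    using pth[of "vert p"] pth[of "vert r"] vert_Adr[OF p(1)] vert_Adr[OF r(1)] by metis
  then have pr: "p = r" using snoc.IH p r by blast
  have "inj_on (child (vert p)) {..<if vert p = s then 3 else 2}"
    using child[of "vert p"] vert_Adr[OF p(1)] by (simp add: bij_betw_def)
  then have "i = j"
    using snoc.prems(3) q pr p r vert_eq_s[OF p(1)] by (auto simp: inj_on_def)
  then show ?case using pr q by simp
qed

lemma surj_vert: "v \<in> verts Q \<Longrightarrow> \<exists>p\<in>Adr. v = vert p"
proof (induction "length (pth v)" arbitrary: v rule: less_induct)
  case less
  show ?case
  proof (cases "v = s")
    case True
    then show ?thesis by (intro bexI[of _ "[]"]) simp_all
  next
    case False
    obtain u where u: "u \<in> verts Q" "v \<in> children u" by (rule parent[OF less.prems False])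
    then have "length (pth u) < length (pth v)" by (simp add: children_def)
    then obtain p where p: "p \<in> Adr" "u = vert p" using less.hyps[OF _ u(1)] by blast
    obtain i where "i < (if u = s then 3 else 2)" "v = child u i"
      using child[OF u(1)] u(2) unfolding bij_betw_def by auto
    then show ?thesis using p vert_eq_s[OF p(1)] by (intro bexI[of _ "p @ [i]"]) simp_all
  qed
qed

lemma bij_vert: "bij_betw vert Adr (verts Q)"
  unfolding bij_betw_def inj_on_def using inj_vert surj_vert vert_Adr by blast

lemma adj_source:
  assumes "adj Q u v" "is_source Q u"
  obtains a where "a \<in> arcs Q" "tail Q a = u" "head Q a = v"
  using assms by (auto simp: adj_def is_source_def in_arcs_def)

lemma adj_sink_source: "adj Q u v \<Longrightarrow> is_sink Q u \<Longrightarrow> is_source Q v"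
  using source_or_sink[of v] adj_verts[of u v] by (fastforce simp: adj_def is_sink_def out_arcs_def)

lemma adj_source_sink: "adj Q u v \<Longrightarrow> is_source Q u \<Longrightarrow> is_sink Q v"
  using source_or_sink[of v] adj_verts[of u v] by (fastforce simp: adj_def is_source_def in_arcs_def)

lemma vert_adj: "p \<in> Adr \<Longrightarrow> p \<noteq> [] \<Longrightarrow> adj Q (vert (butlast p)) (vert p)"
  using vert_Adr[of p] by (simp add: children_def)

lemma vert_parity: "p \<in> Adr \<Longrightarrow> if even (length p) then is_sink Q (vert p) else is_source Q (vert p)"
proof (induction p rule: rev_induct)
  case Nil
  then show ?case using sink by simp
next
  case (snoc i p)
  then have "adj Q (vert p) (vert (p @ [i]))" using vert_adj[of "p @ [i]"] by simp
  then show ?case using snoc adj_sink_source adj_source_sink by (auto split: if_splits)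
qed

text \<open>The sink \<open>s\<close> has the address \<open>[]\<close> of even length, so the
  sources of \<open>Q\<close> have odd length; this is parity \<open>False\<close>.\<close>

definition edge :: "nat list \<Rightarrow> 'e" where
  "edge p = (SOME a. a \<in> arcs Q \<and> tail Q a = vert (src False p) \<and> head Q a = vert (snk False p))"

lemma edge:
  assumes p: "p \<in> Adr" "p \<noteq> []"
  shows "edge p \<in> arcs Q \<and> tail Q (edge p) = vert (src False p) \<and> head Q (edge p) = vert (snk False p)"
proof -
  have "adj Q (vert (src False p)) (vert (snk False p))"
    using vert_adj[OF p] adj_sym[of Q "vert p"] by (auto simp: src_def snk_def)
  moreover have "is_source Q (vert (src False p))"
    using vert_parity[of "src False p"] even_length_src[OF p(2), of False] p(1) by simp
  ultimately obtain a where "a \<in> arcs Q" "tail Q a = vert (src False p)" "head Q a = vert (snk False p)"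
    by (rule adj_source)
  then have "\<exists>a. a \<in> arcs Q \<and> tail Q a = vert (src False p) \<and> head Q a = vert (snk False p)" by blast
  then show ?thesis unfolding edge_def by (rule someI_ex)
qed

text \<open>The address of an arc is the longer one of the addresses of its two ends.\<close>

lemma src_snk_inj:
  assumes "src b p = src b q" "snk b p = snk b q" "p \<noteq> []" "q \<noteq> []"
  shows "p = q"
proof -
  have "r = (if length (src b r) < length (snk b r) then snk b r else src b r)" if "r \<noteq> []" for r
    using that by (cases r rule: rev_cases) (auto simp: src_def snk_def)
  then show ?thesis using assms by metis
qed

lemma bij_edge: "bij_betw edge (Adr - {[]}) (arcs Q)"
  unfolding bij_betw_def
proof
  show "inj_on edge (Adr - {[]})"
    using edge inj_vert src_snk_inj by (intro inj_onI) (metis Diff_iff insertI1 snk_Adr src_Adr)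
  show "edge ` (Adr - {[]}) = arcs Q"
  proof (intro equalityI subsetI)
    fix a assume "a \<in> edge ` (Adr - {[]})"
    then show "a \<in> arcs Q" using edge by auto
  next
    fix a assume a: "a \<in> arcs Q"
    have *: "\<exists>p\<in>Adr. p \<noteq> [] \<and> x = vert p \<and> y = vert (butlast p)" if xy: "x \<in> children y" "y \<in> verts Q" for x y
    proof -
      obtain p where p: "p \<in> Adr" "y = vert p" using surj_vert[OF xy(2)] by blast
      obtain i where "i < (if y = s then 3 else 2)" "x = child y i"
        using child[OF xy(2)] xy(1) unfolding bij_betw_def by auto
      then show ?thesis using p vert_eq_s[OF p(1)] by (intro bexI[of _ "p @ [i]"]) simp_all
    qed
    have adj: "adj Q (tail Q a) (head Q a)" using a by (auto simp: adj_def)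
    then have "tail Q a \<in> children (head Q a) \<or> head Q a \<in> children (tail Q a)"
      using pth_adj[OF adj] adj_sym[of Q] by (auto simp: children_def)
    then obtain p where p: "p \<in> Adr" "p \<noteq> []"
      "tail Q a = vert p \<and> head Q a = vert (butlast p) \<or> head Q a = vert p \<and> tail Q a = vert (butlast p)"
      using *[of "tail Q a" "head Q a"] *[of "head Q a" "tail Q a"] a by auto
    have "\<not> is_sink Q (tail Q a)" using a by (auto simp: is_sink_def)
    then have "tail Q a = vert (src False p)" "head Q a = vert (snk False p)"
      using p vert_parity[OF p(1)] vert_parity[of "butlast p"] by (auto simp: src_def snk_def split: if_splits)
    then have "a = edge p" using nomulti[OF a] edge[OF p(1,2)] by simp
    then show "a \<in> edge ` (Adr - {[]})" using p by auto
  qed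
qed

lemma coded: "coded_quiver Q vert edge False"
  by unfold_locales (use bij_vert bij_edge edge in auto)

lemma coded_opposite: "coded_quiver (opposite Q) vert edge True"
  by unfold_locales (use bij_vert bij_edge edge in \<open>auto simp: opposite_def src_def snk_def\<close>)

end

section \<open>Reflections of coordinate models\<close>

lemma opposite_simps [simp]:
  "verts (opposite Q) = verts Q" "arcs (opposite Q) = arcs Q" "tail (opposite Q) = head Q" "head (opposite Q) = tail Q"
  by (simp_all add: opposite_def)

lemma opposite_opposite [simp]: "opposite (opposite Q) = Q"
  by (simp add: opposite_def)

lemma linear_on_image_span:
  assumes lin: "linear_on kscale kscale (kvec.span B) f"
  shows "f ` kvec.span B = kvec.span (f ` B)"
proof
  have f0: "f 0 = 0" using linear_on_zero[OF lin] kvec.span_zero by blast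
  show "f ` kvec.span B \<subseteq> kvec.span (f ` B)"
  proof clarify
    fix x assume "x \<in> kvec.span B"
    then have "x \<in> kvec.span B \<and> f x \<in> kvec.span (f ` B)"
    proof (induction rule: kvec.span_induct_alt)
      case base
      show ?case by (simp only: f0 kvec.span_zero)
    next
      case (step c x y)
      then have x: "x \<in> kvec.span B" by (simp add: kvec.span_base)
      have "f (kscale c x + y) = kscale c (f x) + f y"
        using linear_on_add[OF lin, of "kscale c x" y] linear_on_scale[OF lin x] x step
        by (simp add: kvec.span_scale)
      then have "kscale c x + y \<in> kvec.span B \<and> f (kscale c x + y) \<in> kvec.span (f ` B)"
        using step x by (simp add: kvec.span_add kvec.span_scale kvec.span_base)
      then show ?case .
    qed
    then show "f x \<in> kvec.span (f ` B)" ..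
  qed
  show "kvec.span (f ` B) \<subseteq> f ` kvec.span B"
  proof (rule kvec.span_minimal)
    show "f ` B \<subseteq> f ` kvec.span B" using kvec.span_superset by blast
    show "kvec.subspace (f ` kvec.span B)"
      unfolding kvec.subspace_def
    proof (intro conjI ballI allI)
      show "0 \<in> f ` kvec.span B" using f0 kvec.span_zero by (metis imageI)
    next
      fix x y assume "x \<in> f ` kvec.span B" "y \<in> f ` kvec.span B"
      then obtain u v where uv: "u \<in> kvec.span B" "v \<in> kvec.span B" "x = f u" "y = f v" by auto
      then have "x + y = f (u + v)" using linear_on_add[OF lin uv(1,2)] by simp
      then show "x + y \<in> f ` kvec.span B" using kvec.span_add[OF uv(1,2)] by (simp only: imageI)
    next
      fix c x assume "x \<in> f ` kvec.span B"
      then obtain u where u: "u \<in> kvec.span B" "x = f u" by auto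
      then have "kscale c x = f (kscale c u)" using linear_on_scale[OF lin u(1)] by simp
      then show "kscale c x \<in> f ` kvec.span B" using kvec.span_scale[OF u(1)] by (simp only: imageI)
    qed
  qed
qed

text \<open>Finite dimension and finite support are transported from \<open>N\<close>. This is
  applied to \<open>sigma_minus Q M\<close>, whose cokernels come from a choice and have no visible
  generators.\<close>

lemma is_rep_iso:
  fixes M N :: "('v, 'e, 'k::field) rep"
  assumes N: "is_rep Q N"
    and sub: "\<And>v. v \<in> verts Q \<Longrightarrow> kvec.subspace (rspace M v)"
    and lin: "\<And>v. v \<in> verts Q \<Longrightarrow> linear_on kscale kscale (rspace M v) (\<phi> v)"
    and bij: "\<And>v. v \<in> verts Q \<Longrightarrow> bij_betw (\<phi> v) (rspace M v) (rspace N v)"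
    and maps: "\<And>a. a \<in> arcs Q \<Longrightarrow> linear_on kscale kscale (rspace M (tail Q a)) (rmap M a)"
      "\<And>a. a \<in> arcs Q \<Longrightarrow> rmap M a ` rspace M (tail Q a) \<subseteq> rspace M (head Q a)"
  shows "is_rep Q M"
  unfolding is_rep_def
proof (intro conjI ballI)
  fix v assume v: "v \<in> verts Q"
  obtain B where B: "finite B" "rspace N v = kvec.span B" using N v unfolding is_rep_def by blast
  let ?g = "inv_into (rspace M v) (\<phi> v)"
  have "linear_on kscale kscale (rspace N v) ?g"
    by (rule linear_on_inv_into[OF lin[OF v] bij[OF v]])
      (use sub[OF v] in \<open>auto intro: kvec.subspace_add kvec.subspace_scale\<close>)
  then have "?g ` rspace N v = kvec.span (?g ` B)" unfolding B(2) by (rule linear_on_image_span)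
  moreover have "?g ` rspace N v = rspace M v"
    using bij_betw_inv_into[OF bij[OF v]] by (simp add: bij_betw_def)
  ultimately have "rspace M v = kvec.span (?g ` B)" by simp
  then show "\<exists>B. finite B \<and> rspace M v = kvec.span B" using B(1) by (intro exI[of _ "?g ` B"]) simp
next
  have "rspace N v \<noteq> {0}" if v: "v \<in> verts Q" "rspace M v \<noteq> {0}" for v
  proof
    assume 0: "rspace N v = {0}"
    have "\<phi> v 0 = 0" using linear_on_zero[OF lin[OF v(1)]] kvec.subspace_0[OF sub[OF v(1)]] by simp
    have "x = 0" if x: "x \<in> rspace M v" for x
    proof (rule inj_onD[of "\<phi> v" "rspace M v"])
      show "inj_on (\<phi> v) (rspace M v)" using bij[OF v(1)] by (simp add: bij_betw_def)
      have "\<phi> v x \<in> {0}" using bij[OF v(1)] x 0 by (auto simp: bij_betw_def)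
      then show "\<phi> v x = \<phi> v 0" using \<open>\<phi> v 0 = 0\<close> by simp
    qed (use x kvec.subspace_0[OF sub[OF v(1)]] in simp_all)
    then have "rspace M v \<subseteq> {0}" by auto
    then show False using v(2) kvec.subspace_0[OF sub[OF v(1)]] by auto
  qed
  then have "{v \<in> verts Q. rspace M v \<noteq> {0}} \<subseteq> {v \<in> verts Q. rspace N v \<noteq> {0}}" by auto
  moreover have "finite {v \<in> verts Q. rspace N v \<noteq> {0}}" using N by (simp add: is_rep_def)
  ultimately show "finite {v \<in> verts Q. rspace M v \<noteq> {0}}" by (rule finite_subset)
qed (use maps in blast)+

text \<open>
  The maps of \<open>N'\<close> realise the cokernel at the source \<open>q\<close>: the sequence
  \<open>N(q) \<rightarrow> \<Oplus>N(t) \<rightarrow> N'(q) \<rightarrow> 0\<close> is exact.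
\<close>

definition exact_at ::
  "('v, 'e) pre_digraph \<Rightarrow> ('v, 'e, 'k::field) rep \<Rightarrow> ('v, 'e, 'k) rep \<Rightarrow> 'v \<Rightarrow> bool" where
  "exact_at Q N N' q \<longleftrightarrow>
     (\<forall>g\<in>out_sum Q N q. (\<Sum>a\<in>out_arcs Q q. rmap N' a (g a)) = 0 \<longleftrightarrow> g \<in> out_map Q N q ` rspace N q) \<and>
     (\<forall>y\<in>rspace N' q. \<exists>g\<in>out_sum Q N q. (\<Sum>a\<in>out_arcs Q q. rmap N' a (g a)) = y)"

lemma out_sum_subspace:
  assumes "wf_digraph Q" "is_rep Q M" "q \<in> verts Q"
  shows "svec.subspace (out_sum Q M q)"
proof -
  interpret wf_digraph Q by fact
  have "kvec.subspace (rspace M (head Q a))" if "a \<in> out_arcs Q q" for a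
    using is_rep_subspace[OF assms(2)] that by auto
  then show ?thesis
    unfolding svec.subspace_def out_sum_def
    by (auto simp: sscale_def kvec.subspace_0 kvec.subspace_add kvec.subspace_scale)
qed

text \<open>Of the chosen \<open>coker_proj\<close> only linearity and kernel are known. The map
  \<open>\<theta>\<close>, which applies \<open>\<phi>\<close> and then the maps of
  \<open>N'\<close>, has the same kernel by exactness. So it factors through the cokernel by an
  injective map, which is onto because the exact sequence ends in zero.\<close>

lemma sigma_minus_iso_source:
  fixes M N N' :: "('v, 'e, 'k::field) rep"
  assumes wf: "wf_digraph Q" and fin: "finite (out_arcs Q q)" and q: "q \<in> verts Q"
    and M: "is_rep Q M" and N: "is_rep Q N" and iso: "rep_iso Q M N \<phi>"
    and N': "is_rep (opposite Q) N'"
    and heads: "\<And>a. a \<in> out_arcs Q q \<Longrightarrow> rspace N' (head Q a) = rspace N (head Q a)"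
    and ex: "exact_at Q N N' q"
  obtains \<chi> where "linear_on kscale kscale (coker Q M q) \<chi>" "bij_betw \<chi> (coker Q M q) (rspace N' q)"
    "\<And>g. g \<in> out_sum Q M q \<Longrightarrow> \<chi> (coker_proj Q M q g) = (\<Sum>a\<in>out_arcs Q q. rmap N' a (\<phi> (head Q a) (g a)))"
    "kvec.subspace (coker Q M q)"
proof -
  interpret wf_digraph Q by fact
  let ?S = "out_sum Q M q" and ?p = "coker_proj Q M q"
  have p: "linear_on sscale kscale ?S ?p" "{g \<in> ?S. ?p g = 0} = out_map Q M q ` rspace M q"
    using coker_proj_exists[OF wf fin q M] by (auto simp: is_coker_proj_def)
  note S = out_sum_subspace[OF wf M q]
  have hom: "rep_hom Q M N \<phi>" and bij: "\<And>v. v \<in> verts Q \<Longrightarrow> bij_betw (\<phi> v) (rspace M v) (rspace N v)"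
    using iso by (auto simp: rep_iso_def)
  define \<theta> where "\<theta> g = (\<Sum>a\<in>out_arcs Q q. rmap N' a (\<phi> (head Q a) (g a)))" for g
  define \<Phi> where "\<Phi> g = (\<lambda>a. if a \<in> out_arcs Q q then \<phi> (head Q a) (g a) else 0)" for g :: "'e \<Rightarrow> nat \<Rightarrow> 'k"
  have \<theta>\<Phi>: "\<theta> g = (\<Sum>a\<in>out_arcs Q q. rmap N' a (\<Phi> g a))" for g
    unfolding \<theta>_def \<Phi>_def by (rule sum.cong) auto
  have ga: "g a \<in> rspace M (head Q a)" if "g \<in> ?S" "a \<in> out_arcs Q q" for g a
    using that by (simp add: out_sum_def)
  have \<Phi>_in: "\<Phi> g \<in> out_sum Q N q" if "g \<in> ?S" for g
    using ga[OF that] rep_hom_in[OF hom] by (auto simp: \<Phi>_def out_sum_def)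
  have lin\<phi>: "linear_on kscale kscale (rspace M (head Q a)) (\<phi> (head Q a))" if "a \<in> out_arcs Q q" for a
    using rep_hom_linear[OF hom] that by auto
  have lin': "linear_on kscale kscale (rspace N (head Q a)) (rmap N' a)" if "a \<in> out_arcs Q q" for a
    using is_rep_map_linear[OF N', of a] heads[OF that] that by simp
  have \<phi>N: "\<phi> (head Q a) (g a) \<in> rspace N (head Q a)" if "g \<in> ?S" "a \<in> out_arcs Q q" for g a
    using rep_hom_in[OF hom _ ga[OF that]] that by auto
  have lin\<theta>: "linear_on sscale kscale ?S \<theta>"
    unfolding linear_on_def
  proof (intro conjI ballI allI)
    fix g h assume gh: "g \<in> ?S" "h \<in> ?S"
    show "\<theta> (g + h) = \<theta> g + \<theta> h"
      unfolding \<theta>_def sum.distrib[symmetric]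
      by (rule sum.cong)
        (use gh in \<open>simp_all add: linear_on_add[OF lin\<phi>] linear_on_add[OF lin'] ga \<phi>N\<close>)
  next
    fix c g assume g: "g \<in> ?S"
    show "\<theta> (sscale c g) = kscale c (\<theta> g)"
      unfolding \<theta>_def kvec.scale_sum_right
      by (rule sum.cong)
        (use g in \<open>simp_all add: sscale_def linear_on_scale[OF lin\<phi>] linear_on_scale[OF lin'] ga \<phi>N\<close>)
  qed
  \<comment> \<open>The bijections \<open>\<phi>\<close> match the image of \<open>out_map\<close>
    for \<open>M\<close> with the one for \<open>N\<close>, where exactness applies.\<close>
  have ker: "\<theta> g = 0 \<longleftrightarrow> ?p g = 0" if g: "g \<in> ?S" for g
  proof -
    have "\<theta> g = 0 \<longleftrightarrow> \<Phi> g \<in> out_map Q N q ` rspace N q"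
      using ex \<Phi>_in[OF g] unfolding exact_at_def \<theta>\<Phi> by blast
    also have "\<dots> \<longleftrightarrow> g \<in> out_map Q M q ` rspace M q"
    proof
      assume "\<Phi> g \<in> out_map Q N q ` rspace N q"
      then obtain y where y: "y \<in> rspace N q" "\<Phi> g = out_map Q N q y" by auto
      obtain x where x: "x \<in> rspace M q" "y = \<phi> q x" using bij[OF q] y(1) by (auto simp: bij_betw_def)
      have "g a = out_map Q M q x a" for a
      proof (cases "a \<in> out_arcs Q q")
        case True
        then have a: "a \<in> arcs Q" "tail Q a = q" by auto
        have "\<phi> (head Q a) (g a) = rmap N a (\<phi> q x)"
          using fun_cong[OF y(2), of a] True x(2) by (simp add: \<Phi>_def out_map_def)
        also have "\<dots> = \<phi> (head Q a) (rmap M a x)"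
          using rep_hom_commute[OF hom a(1), of x] a(2) x(1) by simp
        finally have "g a = rmap M a x"
          using bij[OF head_in_verts[OF a(1)]] ga[OF g True] is_rep_map_in[OF M a(1), of x] a(2) x(1)
          unfolding bij_betw_def inj_on_def by blast
        then show ?thesis using True by (simp add: out_map_def)
      next
        case False
        then have "g a = 0" using g unfolding out_sum_def by blast
        then show ?thesis using False by (simp only: out_map_def if_False)
      qed
      then show "g \<in> out_map Q M q ` rspace M q" using x(1) by (intro image_eqI[of _ _ x]) auto
    next
      assume "g \<in> out_map Q M q ` rspace M q"
      then obtain x where x: "x \<in> rspace M q" "g = out_map Q M q x" by auto
      have "\<Phi> g a = out_map Q N q (\<phi> q x) a" for a
      proof (cases "a \<in> out_arcs Q q")
        case True
        then have "a \<in> arcs Q" "tail Q a = q" by auto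
        then have "\<phi> (head Q a) (rmap M a x) = rmap N a (\<phi> q x)"
          using rep_hom_commute[OF hom, of a x] x(1) by simp
        then show ?thesis using True x(2) by (simp add: \<Phi>_def out_map_def)
      next
        case False
        then show ?thesis by (simp only: \<Phi>_def out_map_def if_False)
      qed
      then have "\<Phi> g = out_map Q N q (\<phi> q x)" by blast
      then show "\<Phi> g \<in> out_map Q N q ` rspace N q" using rep_hom_in[OF hom q x(1)] by blast
    qed
    also have "\<dots> \<longleftrightarrow> ?p g = 0" using p(2) g by blast
    finally show ?thesis .
  qed
  have diff: "h (g - g') = h g - h g'" if "linear_on sscale kscale ?S h" "g \<in> ?S" "g' \<in> ?S"
    for h :: "('e \<Rightarrow> nat \<Rightarrow> 'k) \<Rightarrow> nat \<Rightarrow> 'k" and g g'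
    using linear_on_add[OF that(1) svec.subspace_diff[OF S that(2,3)] that(3)] by (simp add: algebra_simps)
  have eq_iff: "\<theta> g = \<theta> g' \<longleftrightarrow> ?p g = ?p g'" if g: "g \<in> ?S" "g' \<in> ?S" for g g'
    using ker[OF svec.subspace_diff[OF S g]] diff[OF lin\<theta> g] diff[OF p(1) g] by simp
  \<comment> \<open>By \<open>eq_iff\<close> the value does not depend on the preimage that
    \<open>inv_into\<close> picks.\<close>
  define \<chi> where "\<chi> y = \<theta> (inv_into ?S ?p y)" for y
  have \<chi>: "\<chi> (?p g) = \<theta> g" if "g \<in> ?S" for g
  proof -
    have "inv_into ?S ?p (?p g) \<in> ?S" "?p (inv_into ?S ?p (?p g)) = ?p g"
      using that inv_into_into[of "?p g" ?p ?S] f_inv_into_f[of "?p g" ?p ?S] by blast+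
    then show ?thesis unfolding \<chi>_def using eq_iff that by blast
  qed
  have lin\<chi>: "linear_on kscale kscale (coker Q M q) \<chi>"
    unfolding linear_on_def coker_def
  proof (intro conjI ballI allI)
    fix x y assume "x \<in> ?p ` ?S" "y \<in> ?p ` ?S"
    then obtain g h where gh: "g \<in> ?S" "h \<in> ?S" "x = ?p g" "y = ?p h" by auto
    have "x + y = ?p (g + h)" using linear_on_add[OF p(1)] gh by simp
    then show "\<chi> (x + y) = \<chi> x + \<chi> y"
      using gh \<chi> svec.subspace_add[OF S gh(1,2)] linear_on_add[OF lin\<theta> gh(1,2)] by simp
  next
    fix c x assume "x \<in> ?p ` ?S"
    then obtain g where g: "g \<in> ?S" "x = ?p g" by auto
    have "kscale c x = ?p (sscale c g)" using linear_on_scale[OF p(1)] g by simp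
    then show "\<chi> (kscale c x) = kscale c (\<chi> x)"
      using g \<chi> svec.subspace_scale[OF S g(1)] linear_on_scale[OF lin\<theta> g(1)] by simp
  qed
  have "bij_betw \<chi> (coker Q M q) (rspace N' q)"
    unfolding bij_betw_def
  proof
    show "inj_on \<chi> (coker Q M q)"
      unfolding coker_def by (rule inj_onI) (use \<chi> eq_iff in auto)
    have "\<theta> g \<in> rspace N' q" if g: "g \<in> ?S" for g
      unfolding \<theta>_def
    proof (rule kvec.subspace_sum)
      show "kvec.subspace (rspace N' q)" using is_rep_subspace[OF N'] q by simp
      fix a assume a: "a \<in> out_arcs Q q"
      then show "rmap N' a (\<phi> (head Q a) (g a)) \<in> rspace N' q"
        using is_rep_map_in[OF N', of a "\<phi> (head Q a) (g a)"] \<phi>N[OF g a] heads[OF a] by simp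
    qed
    moreover have "\<exists>g\<in>?S. y = \<theta> g" if y: "y \<in> rspace N' q" for y
    proof -
      obtain h where h: "h \<in> out_sum Q N q" "(\<Sum>a\<in>out_arcs Q q. rmap N' a (h a)) = y"
        using ex y unfolding exact_at_def by blast
      have "\<exists>x\<in>rspace M (head Q a). h a = \<phi> (head Q a) x" if "a \<in> out_arcs Q q" for a
        using h(1) bij[of "head Q a"] that by (auto simp: out_sum_def bij_betw_def image_iff)
      then obtain k where k: "\<And>a. a \<in> out_arcs Q q \<Longrightarrow> k a \<in> rspace M (head Q a) \<and> h a = \<phi> (head Q a) (k a)"
        by metis
      define g where "g a = (if a \<in> out_arcs Q q then k a else 0)" for a
      have "g \<in> ?S" using k by (simp add: g_def out_sum_def)
      moreover have "\<theta> g = y"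
        unfolding \<theta>_def h(2)[symmetric] by (rule sum.cong) (use k in \<open>auto simp: g_def\<close>)
      ultimately show ?thesis by blast
    qed
    ultimately show "\<chi> ` coker Q M q = rspace N' q"
      unfolding coker_def image_image using \<chi> by (auto simp: image_iff)
  qed
  moreover have "kvec.subspace (coker Q M q)"
    unfolding coker_def kvec.subspace_def
  proof (intro conjI ballI allI)
    show "0 \<in> ?p ` ?S" using linear_on_zero[OF p(1)] svec.subspace_0[OF S] by (metis imageI)
  next
    fix x y assume "x \<in> ?p ` ?S" "y \<in> ?p ` ?S"
    then obtain g h where gh: "g \<in> ?S" "h \<in> ?S" "x = ?p g" "y = ?p h" by auto
    then have "x + y = ?p (g + h)" using linear_on_add[OF p(1) gh(1,2)] by simp
    then show "x + y \<in> ?p ` ?S" using svec.subspace_add[OF S gh(1,2)] by (simp only: imageI)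
  next
    fix c x assume "x \<in> ?p ` ?S"
    then obtain g where g: "g \<in> ?S" "x = ?p g" by auto
    then have "kscale c x = ?p (sscale c g)" using linear_on_scale[OF p(1) g(1)] by simp
    then show "kscale c x \<in> ?p ` ?S" using svec.subspace_scale[OF S g(1)] by (simp only: imageI)
  qed
  ultimately show ?thesis using that[of \<chi>] lin\<chi> \<chi> by (simp add: \<theta>_def)
qed

text \<open>The isomorphism is \<open>\<phi>\<close> at the sinks, which the functor leaves alone,
  and the induced map of cokernels at the sources.\<close>

lemma sigma_minus_iso:
  fixes M N N' :: "('v, 'e, 'k::field) rep"
  assumes wf: "wf_digraph Q" and fin: "\<And>q. finite (out_arcs Q q)"
    and ends: "\<And>a. a \<in> arcs Q \<Longrightarrow> is_source Q (tail Q a) \<and> \<not> is_source Q (head Q a)"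
    and M: "is_rep Q M" and N: "is_rep Q N" and iso: "rep_iso Q M N \<phi>"
    and N': "is_rep (opposite Q) N'"
    and sinks: "\<And>v. v \<in> verts Q \<Longrightarrow> \<not> is_source Q v \<Longrightarrow> rspace N' v = rspace N v"
    and ex: "\<And>q. is_source Q q \<Longrightarrow> exact_at Q N N' q"
  shows "is_rep (opposite Q) (sigma_minus Q M) \<and> (\<exists>\<psi>. rep_iso (opposite Q) (sigma_minus Q M) N' \<psi>)"
proof -
  interpret wf_digraph Q by fact
  let ?M = "sigma_minus Q M"
  have hom: "rep_hom Q M N \<phi>" and bij: "\<And>v. v \<in> verts Q \<Longrightarrow> bij_betw (\<phi> v) (rspace M v) (rspace N v)"
    using iso by (auto simp: rep_iso_def)
  define P where "P q \<chi> \<longleftrightarrow> linear_on kscale kscale (coker Q M q) \<chi> \<and> bij_betw \<chi> (coker Q M q) (rspace N' q) \<and>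
    (\<forall>g\<in>out_sum Q M q. \<chi> (coker_proj Q M q g) = (\<Sum>a\<in>out_arcs Q q. rmap N' a (\<phi> (head Q a) (g a)))) \<and>
    kvec.subspace (coker Q M q)" for q \<chi>
  have "\<exists>\<chi>. P q \<chi>" if q: "is_source Q q" for q
  proof -
    have qv: "q \<in> verts Q" using q by (simp add: is_source_def)
    have heads: "rspace N' (head Q a) = rspace N (head Q a)" if "a \<in> out_arcs Q q" for a
      using sinks ends that by auto
    obtain \<chi> where "linear_on kscale kscale (coker Q M q) \<chi>" "bij_betw \<chi> (coker Q M q) (rspace N' q)"
      "\<And>g. g \<in> out_sum Q M q \<Longrightarrow> \<chi> (coker_proj Q M q g) = (\<Sum>a\<in>out_arcs Q q. rmap N' a (\<phi> (head Q a) (g a)))"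
      "kvec.subspace (coker Q M q)"
      by (rule sigma_minus_iso_source[OF wf fin qv M N iso N' heads ex[OF q]]) (assumption, rule that)
    then have "P q \<chi>" by (simp add: P_def)
    then show ?thesis by blast
  qed
  then have "\<forall>q. \<exists>\<chi>. is_source Q q \<longrightarrow> P q \<chi>" by blast
  then obtain \<chi> where "\<forall>q. is_source Q q \<longrightarrow> P q (\<chi> q)" using choice[of "\<lambda>q \<chi>. is_source Q q \<longrightarrow> P q \<chi>"] by blast
  then have \<chi>: "\<And>q. is_source Q q \<Longrightarrow> linear_on kscale kscale (coker Q M q) (\<chi> q)"
    "\<And>q. is_source Q q \<Longrightarrow> bij_betw (\<chi> q) (coker Q M q) (rspace N' q)"
    "\<And>q g. is_source Q q \<Longrightarrow> g \<in> out_sum Q M q \<Longrightarrow>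
      \<chi> q (coker_proj Q M q g) = (\<Sum>a\<in>out_arcs Q q. rmap N' a (\<phi> (head Q a) (g a)))"
    "\<And>q. is_source Q q \<Longrightarrow> kvec.subspace (coker Q M q)"
    by (simp_all add: P_def)
  define \<psi> where "\<psi> v = (if is_source Q v then \<chi> v else \<phi> v)" for v
  define \<delta> :: "'e \<Rightarrow> (nat \<Rightarrow> 'k) \<Rightarrow> 'e \<Rightarrow> nat \<Rightarrow> 'k" where "\<delta> a x = (\<lambda>b. if b = a then x else 0)" for a x
  have rm: "rmap ?M a x = coker_proj Q M (tail Q a) (\<delta> a x)" for a x
    by (simp add: sigma_minus_def \<delta>_def)
  have rs: "rspace ?M v = (if is_source Q v then coker Q M v else rspace M v)" for v
    by (simp add: sigma_minus_def)
  have \<delta>: "\<delta> a x \<in> out_sum Q M (tail Q a)" if "a \<in> arcs Q" "x \<in> rspace M (head Q a)" for a x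
    using that kvec.subspace_0[OF is_rep_subspace[OF M]] by (auto simp: \<delta>_def out_sum_def)
  have sub: "kvec.subspace (rspace ?M v)" if "v \<in> verts Q" for v
    using \<chi>(4) is_rep_subspace[OF M that] by (simp add: rs)
  have lin: "linear_on kscale kscale (rspace ?M v) (\<psi> v)" if "v \<in> verts Q" for v
    using \<chi>(1) rep_hom_linear[OF hom that] by (simp add: rs \<psi>_def)
  have bij': "bij_betw (\<psi> v) (rspace ?M v) (rspace N' v)" if "v \<in> verts Q" for v
    using \<chi>(2) bij[OF that] sinks[OF that] by (simp add: rs \<psi>_def)
  have map_lin: "linear_on kscale kscale (rspace ?M (head Q a)) (rmap ?M a)" if a: "a \<in> arcs Q" for a
  proof -
    have "is_coker_proj Q M (tail Q a) (coker_proj Q M (tail Q a))"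
      by (rule coker_proj_exists[OF wf fin _ M]) (use a in simp)
    then have p: "linear_on sscale kscale (out_sum Q M (tail Q a)) (coker_proj Q M (tail Q a))"
      by (simp add: is_coker_proj_def)
    have add: "\<delta> a (x + y) = \<delta> a x + \<delta> a y" for x y
      by (auto simp: \<delta>_def fun_eq_iff)
    have scale: "\<delta> a (kscale c x) = sscale c (\<delta> a x)" for c x
      by (rule ext) (simp add: \<delta>_def sscale_def)
    have head: "rspace ?M (head Q a) = rspace M (head Q a)" using ends[OF a] by (simp add: rs)
    show ?thesis
      unfolding linear_on_def rm head add scale
      using linear_on_add[OF p \<delta>[OF a] \<delta>[OF a]] linear_on_scale[OF p \<delta>[OF a]] by blast
  qed
  have map_in: "rmap ?M a ` rspace ?M (head Q a) \<subseteq> rspace ?M (tail Q a)" if a: "a \<in> arcs Q" for a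
    using \<delta>[OF a] ends[OF a] by (auto simp: rm rs coker_def)
  have rep: "is_rep (opposite Q) ?M"
    by (rule is_rep_iso[OF N', of ?M \<psi>]) (use sub lin bij' map_lin map_in in simp_all)
  have "rep_hom (opposite Q) ?M N' \<psi>"
    unfolding rep_hom_def
  proof (intro conjI ballI)
    fix v assume "v \<in> verts (opposite Q)"
    then have v: "v \<in> verts Q" by simp
    show "linear_on kscale kscale (rspace ?M v) (\<psi> v)" by (rule lin[OF v])
    show "\<psi> v ` rspace ?M v \<subseteq> rspace N' v" using bij'[OF v] by (simp add: bij_betw_def)
  next
    fix a x assume "a \<in> arcs (opposite Q)" "x \<in> rspace ?M (tail (opposite Q) a)"
    then have a: "a \<in> arcs Q" and x: "x \<in> rspace M (head Q a)"
      using ends[of a] by (auto simp: rs)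
    have "\<psi> (tail Q a) (rmap ?M a x) = (\<Sum>b\<in>out_arcs Q (tail Q a). rmap N' b (\<phi> (head Q b) (\<delta> a x b)))"
      using \<chi>(3)[OF _ \<delta>[OF a x]] ends[OF a] by (simp add: \<psi>_def rm)
    \<comment> \<open>\<open>\<delta> a x\<close> is concentrated in the summand belonging to
      \<open>a\<close>, so one term survives.\<close>
    also have "\<dots> = (\<Sum>b\<in>out_arcs Q (tail Q a). if b = a then rmap N' a (\<phi> (head Q a) x) else 0)"
    proof (rule sum.cong)
      fix b assume "b \<in> out_arcs Q (tail Q a)"
      then have b: "b \<in> arcs Q" by simp
      have "\<phi> (head Q b) 0 = 0"
        using linear_on_zero[OF rep_hom_linear[OF hom]] kvec.subspace_0[OF is_rep_subspace[OF M]] b by simp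
      moreover have "rmap N' b 0 = 0"
        using linear_on_zero[OF is_rep_map_linear[OF N', of b]] kvec.subspace_0[OF is_rep_subspace[OF N']] b
        by simp
      ultimately show "rmap N' b (\<phi> (head Q b) (\<delta> a x b)) = (if b = a then rmap N' a (\<phi> (head Q a) x) else 0)"
        by (simp add: \<delta>_def)
    qed simp
    also have "\<dots> = rmap N' a (\<phi> (head Q a) x)"
      using fin a by simp
    finally show "\<psi> (head (opposite Q) a) (rmap ?M a x) = rmap N' a (\<psi> (tail (opposite Q) a) x)"
      using ends[OF a] by (simp add: \<psi>_def)
  qed
  then show ?thesis using rep bij' unfolding rep_iso_def by auto
qed

text \<open>These are the arcs at the vertex \<open>p\<close>. Away from the root, \<open>p\<close>
  itself addresses the arc to the parent.\<close>

definition star :: "nat list \<Rightarrow> nat list set" where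
  "star p = (if p = [] then {[0], [1], [2]} else {p, p @ [0], p @ [1]})"

lemma star_iff:
  assumes "p \<in> Adr" "even (length p) = b"
  shows "r \<in> star p \<longleftrightarrow> r \<in> Adr \<and> r \<noteq> [] \<and> src b r = p"
proof (cases r rule: rev_cases)
  case Nil
  then show ?thesis by (auto simp: star_def)
next
  case (snoc q i)
  have "i < 3 \<longleftrightarrow> i = 0 \<or> i = 1 \<or> i = 2" "i < 2 \<longleftrightarrow> i = 0 \<or> i = 1" by auto
  then show ?thesis using assms snoc by (auto simp: star_def src_def)
qed

lemma finite_star [simp]: "finite (star p)"
  by (simp add: star_def)

lemma snk_Not: "snk (\<not> b) p = src b p"
  by (simp add: snk_def src_def)

text \<open>\<open>exact_at\<close> in coordinates, split into vanishing composition, exactness in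
  the middle and surjectivity. The dimensions of the summands are taken from \<open>D\<close>, since
  the reflection does not change the sinks.\<close>

definition exact_dims ::
  "bool \<Rightarrow> (nat list \<Rightarrow> (nat \<Rightarrow> 'k) \<Rightarrow> nat \<Rightarrow> 'k::field) \<Rightarrow> (nat list \<Rightarrow> nat) \<Rightarrow>
   (nat list \<Rightarrow> (nat \<Rightarrow> 'k) \<Rightarrow> nat \<Rightarrow> 'k) \<Rightarrow> (nat list \<Rightarrow> nat) \<Rightarrow> nat list \<Rightarrow> bool" where
  "exact_dims b A D A' D' p \<longleftrightarrow>
     (\<forall>x\<in>kn (D p). (\<Sum>r\<in>star p. trunc (D' p) (A' r (trunc (D (snk b r)) (A r x)))) = 0) \<and>
     (\<forall>h. (\<forall>r\<in>star p. h r \<in> kn (D (snk b r))) \<longrightarrow> (\<Sum>r\<in>star p. trunc (D' p) (A' r (h r))) = 0 \<longrightarrow>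
        (\<exists>x\<in>kn (D p). \<forall>r\<in>star p. h r = trunc (D (snk b r)) (A r x))) \<and>
     (\<forall>y\<in>kn (D' p). \<exists>h. (\<forall>r\<in>star p. h r \<in> kn (D (snk b r))) \<and> (\<Sum>r\<in>star p. trunc (D' p) (A' r (h r))) = y)"

context coded_quiver
begin

lemma is_source_w:
  assumes p: "p \<in> Adr"
  shows "is_source Q (w p) \<longleftrightarrow> even (length p) = b"
proof
  assume src: "is_source Q (w p)"
  show "even (length p) = b"
  proof (rule ccontr)
    assume ne: "even (length p) \<noteq> b"
    have r: "p @ [0] \<in> Adr" using p by simp
    have "head Q (e (p @ [0])) = w p" using head_e[OF r] ne by (simp add: snk_def)
    then have "e (p @ [0]) \<in> in_arcs Q (w p)" using e_in[OF r] by (simp add: in_arcs_def)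
    then show False using src unfolding is_source_def by blast
  qed
next
  assume b: "even (length p) = b"
  have "w (snk b r) \<noteq> w p" if "r \<in> Adr" "r \<noteq> []" for r
    using even_length_snk[OF that(2), of b] b p that(1) by auto
  then have "in_arcs Q (w p) = {}" by (auto simp: in_arcs_def arcs_eq head_e)
  then show "is_source Q (w p)" using p by (simp add: is_source_def)
qed

lemma out_arcs_w:
  assumes p: "p \<in> Adr" "even (length p) = b"
  shows "out_arcs Q (w p) = e ` star p"
proof -
  have "tail Q (e r) = w p \<longleftrightarrow> src b r = p" if "r \<in> Adr" "r \<noteq> []" for r
    using that p(1) by (simp add: tail_e)
  then have "out_arcs Q (w p) = e ` {r \<in> Adr. r \<noteq> [] \<and> src b r = p}"
    by (auto simp: out_arcs_def arcs_eq)
  also have "{r \<in> Adr. r \<noteq> [] \<and> src b r = p} = star p" using star_iff[OF p] by blast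
  finally show ?thesis .
qed

lemma finite_out_arcs: "finite (out_arcs Q q)"
proof (cases "is_source Q q")
  case True
  then obtain p where "p \<in> Adr" "q = w p" by (auto simp: is_source_def verts_eq)
  then show ?thesis using True is_source_w out_arcs_w by simp
next
  case False
  have "tail Q a \<noteq> q" if a: "a \<in> arcs Q" for a
  proof -
    obtain r where r: "r \<in> Adr" "r \<noteq> []" "a = e r" using a by (auto simp: arcs_eq)
    have "is_source Q (tail Q a)"
      using is_source_w[of "src b r"] even_length_src[OF r(2), of b] r by (simp add: tail_e)
    then show ?thesis using False by auto
  qed
  then have "out_arcs Q q = {}" by (auto simp: out_arcs_def)
  then show ?thesis by simp
qed

lemma inj_on_e_star: "p \<in> Adr \<Longrightarrow> even (length p) = b \<Longrightarrow> inj_on e (star p)"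
  using bij_e star_iff by (auto simp: bij_betw_def inj_on_def)

lemma ends_source:
  assumes "a \<in> arcs Q"
  shows "is_source Q (tail Q a) \<and> \<not> is_source Q (head Q a)"
proof -
  obtain r where r: "r \<in> Adr" "r \<noteq> []" "a = e r" using assms by (auto simp: arcs_eq)
  then show ?thesis
    using is_source_w[of "src b r"] is_source_w[of "snk b r"] even_length_src[OF r(2), of b]
      even_length_snk[OF r(2), of b] by (simp add: tail_e head_e)
qed

lemma exact_at_model:
  assumes C': "coded_quiver (opposite Q) w e (\<not> b)" and p: "p \<in> Adr" "even (length p) = b"
    and ex: "exact_dims b A D A' D' p"
  shows "exact_at Q (model A D) (coded_quiver.model (opposite Q) w e (\<not> b) A' D') (w p)"
proof -
  interpret C': coded_quiver "opposite Q" w e "\<not> b" by fact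
  let ?N = "model A D" and ?N' = "C'.model A' D'"
  have star: "r \<in> Adr" "r \<noteq> []" "src b r = p" if "r \<in> star p" for r
    using that star_iff[OF p] by auto
  have sum: "(\<Sum>a\<in>out_arcs Q (w p). rmap ?N' a (g a)) = (\<Sum>r\<in>star p. trunc (D' p) (A' r (g (e r))))" for g
    unfolding out_arcs_w[OF p] sum.reindex[OF inj_on_e_star[OF p]]
    by (rule sum.cong) (use star in \<open>auto simp: snk_Not\<close>)
  have out_sum: "g \<in> out_sum Q ?N (w p) \<longleftrightarrow>
      (\<forall>r\<in>star p. g (e r) \<in> kn (D (snk b r))) \<and> (\<forall>a. a \<notin> e ` star p \<longrightarrow> g a = 0)" for g
    using star unfolding out_sum_def out_arcs_w[OF p] by (auto simp: head_e)
  have out_map: "out_map Q ?N (w p) x (e r) = trunc (D (snk b r)) (A r x)" if "r \<in> star p" for x r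
    using star[OF that] that unfolding out_map_def out_arcs_w[OF p] by auto
  have out_map0: "out_map Q ?N (w p) x a = 0" if "a \<notin> e ` star p" for x a
    using that unfolding out_map_def out_arcs_w[OF p] by (simp only: if_False)
  show ?thesis
    unfolding exact_at_def sum
  proof (intro conjI ballI)
    fix g assume g: "g \<in> out_sum Q ?N (w p)"
    show "(\<Sum>r\<in>star p. trunc (D' p) (A' r (g (e r)))) = 0 \<longleftrightarrow> g \<in> out_map Q ?N (w p) ` rspace ?N (w p)"
    proof
      assume 0: "(\<Sum>r\<in>star p. trunc (D' p) (A' r (g (e r)))) = 0"
      have "\<forall>r\<in>star p. g (e r) \<in> kn (D (snk b r))" using g unfolding out_sum by blast
      with ex[unfolded exact_dims_def, THEN conjunct2, THEN conjunct1, rule_format, of "\<lambda>r. g (e r)"] 0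
      have "\<exists>x\<in>kn (D p). \<forall>r\<in>star p. g (e r) = trunc (D (snk b r)) (A r x)" by simp
      then obtain x where x: "x \<in> kn (D p)" "\<forall>r\<in>star p. g (e r) = trunc (D (snk b r)) (A r x)" by blast
      have "g a = out_map Q ?N (w p) x a" for a
      proof (cases "a \<in> e ` star p")
        case True
        then obtain r where "r \<in> star p" "a = e r" by blast
        then show ?thesis using x(2) out_map by simp
      next
        case False
        then have "g a = 0" using g unfolding out_sum by blast
        then show ?thesis using out_map0[OF False] by simp
      qed
      then have "g = out_map Q ?N (w p) x" by blast
      then show "g \<in> out_map Q ?N (w p) ` rspace ?N (w p)" using x(1) p(1) by simp
    next
      assume "g \<in> out_map Q ?N (w p) ` rspace ?N (w p)"
      then obtain x where x: "x \<in> kn (D p)" "g = out_map Q ?N (w p) x" using p(1) by auto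
      then have "(\<Sum>r\<in>star p. trunc (D' p) (A' r (g (e r)))) =
          (\<Sum>r\<in>star p. trunc (D' p) (A' r (trunc (D (snk b r)) (A r x))))"
        using out_map by (intro sum.cong) auto
      then show "(\<Sum>r\<in>star p. trunc (D' p) (A' r (g (e r)))) = 0"
        using ex x(1) unfolding exact_dims_def by simp
    qed
  next
    fix y assume "y \<in> rspace ?N' (w p)"
    then have "y \<in> kn (D' p)" using p(1) by simp
    then obtain h where h: "\<forall>r\<in>star p. h r \<in> kn (D (snk b r))" "(\<Sum>r\<in>star p. trunc (D' p) (A' r (h r))) = y"
      using ex unfolding exact_dims_def by blast
    define g where "g a = (if a \<in> e ` star p then h (eadr a) else 0)" for a
    have ge: "g (e r) = h r" if "r \<in> star p" for r using star[OF that] that by (simp add: g_def)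
    have "g \<in> out_sum Q ?N (w p)" unfolding out_sum using h(1) ge by (auto simp: g_def)
    moreover have "(\<Sum>r\<in>star p. trunc (D' p) (A' r (g (e r)))) = y"
      unfolding h(2)[symmetric] by (rule sum.cong) (simp_all add: ge)
    ultimately show "\<exists>g\<in>out_sum Q ?N (w p). (\<Sum>r\<in>star p. trunc (D' p) (A' r (g (e r)))) = y" by blast
  qed
qed

text \<open>The conclusion repeats the assumption on \<open>M\<close> for \<open>opposite Q\<close>
  and the other parity, so that the lemma can be iterated.\<close>

lemma reflect_model:
  assumes C': "coded_quiver (opposite Q) w e (\<not> b)"
    and lin: "all_linear A" "all_linear A'" and fin: "finite_dims D" "finite_dims D'"
    and sinks: "\<And>p. p \<in> Adr \<Longrightarrow> even (length p) \<noteq> b \<Longrightarrow> D' p = D p"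
    and ex: "\<And>p. p \<in> Adr \<Longrightarrow> even (length p) = b \<Longrightarrow> exact_dims b A D A' D' p"
    and M: "is_rep Q M \<and> (\<exists>\<phi>. rep_iso Q M (model A D) \<phi>)"
  shows "is_rep (opposite Q) (sigma_minus Q M) \<and>
    (\<exists>\<psi>. rep_iso (opposite Q) (sigma_minus Q M) (coded_quiver.model (opposite Q) w e (\<not> b) A' D') \<psi>)"
proof -
  interpret C': coded_quiver "opposite Q" w e "\<not> b" by fact
  obtain \<phi> where rep: "is_rep Q M" and iso: "rep_iso Q M (model A D) \<phi>" using M by blast
  show ?thesis
  proof (rule sigma_minus_iso[OF wf finite_out_arcs ends_source rep is_rep_model[OF lin(1) fin(1)] iso
        C'.is_rep_model[OF lin(2) fin(2)]])
    fix v assume v: "v \<in> verts Q" "\<not> is_source Q v"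
    then obtain p where "p \<in> Adr" "v = w p" by (auto simp: verts_eq)
    then show "rspace (C'.model A' D') v = rspace (model A D) v"
      using sinks v(2) is_source_w by simp
  next
    fix q assume q: "is_source Q q"
    then obtain p where p: "p \<in> Adr" "q = w p" by (auto simp: is_source_def verts_eq)
    then show "exact_at Q (model A D) (C'.model A' D') q"
      using exact_at_model[OF C' p(1) _ ex] q is_source_w by simp
  qed
qed

end

text \<open>Every vector at the sink is the image of a vector on which \<open>f\<close> is already
  known to be \<open>c\<close>.\<close>

lemma scalar_at_sink:
  fixes A :: "nat list \<Rightarrow> (nat \<Rightarrow> 'k::field) \<Rightarrow> (nat \<Rightarrow> 'k)"
  assumes lin: "all_linear A" and f: "endo b A D f" and r: "r \<in> Adr" "r \<noteq> []" "snk b r = p"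
    and sc: "scalar_at D f c (src b r)"
    and surj: "\<And>y. y \<in> kn (D p) \<Longrightarrow> \<exists>x\<in>kn (D (src b r)). y = trunc (D p) (A r x)"
  shows "scalar_at D f c p"
  unfolding scalar_at_def
proof
  fix y :: "nat \<Rightarrow> 'k" assume "y \<in> kn (D p)"
  then obtain x where x: "x \<in> kn (D (src b r))" "y = trunc (D p) (A r x)" using surj by blast
  then have "f p y = trunc (D p) (A r (kscale c x))"
    using endo_commute[OF f r(1,2) x(1)] r(3) sc by (simp add: scalar_at_def)
  also have "\<dots> = kscale c y"
    using lin x(2) by (simp add: all_linear_def linear_on_def trunc_scale)
  finally show "f p y = kscale c y" .
qed

text \<open>The defect \<open>f p x - kscale c x\<close> is mapped to zero, and the map is
  injective.\<close>

lemma scalar_at_source: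
  fixes A :: "nat list \<Rightarrow> (nat \<Rightarrow> 'k::field) \<Rightarrow> (nat \<Rightarrow> 'k)"
  assumes lin: "all_linear A" and f: "endo b A D f" and r: "r \<in> Adr" "r \<noteq> []" "src b r = p"
    and sc: "scalar_at D f c (snk b r)"
    and inj: "\<And>x. x \<in> kn (D p) \<Longrightarrow> trunc (D (snk b r)) (A r x) = 0 \<Longrightarrow> x = 0"
  shows "scalar_at D f c p"
  unfolding scalar_at_def
proof
  fix x :: "nat \<Rightarrow> 'k" assume x: "x \<in> kn (D p)"
  have p: "p \<in> Adr" using r by auto
  have "f p x - kscale c x = 0"
  proof (rule inj)
    show "f p x - kscale c x \<in> kn (D p)"
      using endoD(2)[OF f p x] x by (intro kvec.subspace_diff kvec.subspace_scale) auto
    have "f (snk b r) (trunc (D (snk b r)) (A r x)) = kscale c (trunc (D (snk b r)) (A r x))"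
      using sc by (simp add: scalar_at_def)
    then have eq: "trunc (D (snk b r)) (A r (f p x)) = trunc (D (snk b r)) (A r (kscale c x))"
      using endo_commute[OF f r(1,2)] x r(3) lin by (simp add: all_linear_def linear_on_def trunc_scale)
    have "A r (f p x) = A r (f p x - kscale c x) + A r (kscale c x)"
      using lin linear_on_add[of kscale kscale UNIV "A r" "f p x - kscale c x" "kscale c x"]
      by (simp add: all_linear_def)
    then show "trunc (D (snk b r)) (A r (f p x - kscale c x)) = 0" using eq by (simp add: trunc_add)
  qed
  then show "f p x = kscale c x" by simp
qed

definition vcons :: "'k \<Rightarrow> (nat \<Rightarrow> 'k) \<Rightarrow> nat \<Rightarrow> 'k" where
  "vcons a v = (\<lambda>i. case i of 0 \<Rightarrow> a | Suc j \<Rightarrow> v j)"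

text \<open>Padding with zeros lets one list denote a vector in every \<open>kn n\<close> that is
  large enough; truncation and membership become rewriting.\<close>

primrec vec :: "'k list \<Rightarrow> nat \<Rightarrow> 'k::zero" where
  "vec [] = 0"
| "vec (a # xs) = vcons a (vec xs)"

lemma vcons_nth [simp]:
  "vcons a v 0 = a" "vcons a v (Suc i) = v i" "vcons a v (numeral k) = v (pred_numeral k)"
  by (auto simp: vcons_def numeral_eq_Suc)

lemma vcons_eq [simp]: "vcons a v = vcons c u \<longleftrightarrow> a = c \<and> v = u"
  by (auto simp: vcons_def fun_eq_iff split: nat.splits)

lemma vcons_eq_0 [simp]: "vcons a v = 0 \<longleftrightarrow> a = 0 \<and> v = 0" "0 = vcons a v \<longleftrightarrow> a = 0 \<and> v = 0"
  by (auto simp: vcons_def fun_eq_iff split: nat.splits)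

lemma vcons_add [simp]:
  fixes a :: "'k::field"
  shows "vcons a v + vcons c u = vcons (a + c) (v + u)"
  by (auto simp: vcons_def fun_eq_iff split: nat.splits)

lemma vcons_uminus [simp]:
  fixes a :: "'k::field"
  shows "- vcons a v = vcons (- a) (- v)"
  by (auto simp: vcons_def fun_eq_iff split: nat.splits)

lemma vcons_diff [simp]:
  fixes a :: "'k::field"
  shows "vcons a v - vcons c u = vcons (a - c) (v - u)"
  by (auto simp: vcons_def fun_eq_iff split: nat.splits)

lemma kscale_vcons [simp]: "kscale c (vcons a v) = vcons (c * a) (kscale c v)"
  by (auto simp: vcons_def kscale_def fun_eq_iff split: nat.splits)

lemma trunc_vcons [simp]:
  "trunc (Suc n) (vcons a v) = vcons a (trunc n v)"
  "trunc (numeral k) (vcons a v) = vcons a (trunc (pred_numeral k) v)"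
  by (auto simp: vcons_def trunc_def fun_eq_iff numeral_eq_Suc split: nat.splits)

lemma vcons_kn [simp]:
  "vcons a v \<in> kn (Suc n) \<longleftrightarrow> v \<in> kn n" "vcons a v \<in> kn (numeral k) \<longleftrightarrow> v \<in> kn (pred_numeral k)"
  by (auto simp: vcons_def kn_def numeral_eq_Suc le_Suc_eq Suc_le_eq split: nat.splits)

lemma kn_SucE:
  assumes "x \<in> kn (Suc n)"
  obtains a v where "v \<in> kn n" "x = vcons a v"
proof
  show "(\<lambda>i. x (Suc i)) \<in> kn n" using assms by (auto simp: kn_def)
  show "x = vcons (x 0) (\<lambda>i. x (Suc i))" by (auto simp: vcons_def fun_eq_iff split: nat.splits)
qed

lemma Bex_kn [simp]: "(\<exists>x\<in>kn (Suc n). P x) \<longleftrightarrow> (\<exists>a. \<exists>v\<in>kn n. P (vcons a v))"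
  by (metis kn_SucE vcons_kn(1))

lemma Ball_kn [simp]: "(\<forall>x\<in>kn (Suc n). P x) \<longleftrightarrow> (\<forall>a. \<forall>v\<in>kn n. P (vcons a v))"
  by (metis kn_SucE vcons_kn(1))

lemma Bex_kn_numeral [simp]: "(\<exists>x\<in>kn (numeral k). P x) \<longleftrightarrow> (\<exists>a. \<exists>v\<in>kn (pred_numeral k). P (vcons a v))"
  by (simp add: numeral_eq_Suc)

lemma Ball_kn_numeral [simp]: "(\<forall>x\<in>kn (numeral k). P x) \<longleftrightarrow> (\<forall>a. \<forall>v\<in>kn (pred_numeral k). P (vcons a v))"
  by (simp add: numeral_eq_Suc)

lemma linear_kn1:
  fixes f :: "(nat \<Rightarrow> 'k::field) \<Rightarrow> nat \<Rightarrow> 'k"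
  assumes "linear_on kscale kscale (kn 1) f" "f ` kn 1 \<subseteq> kn 1"
  obtains m where "\<And>x. f (vec [x]) = vec [m * x]"
proof -
  have "f (vec [1]) \<in> kn 1" using assms by auto
  then obtain m where m: "f (vec [1]) = vec [m]" by (auto elim!: kn_SucE)
  have "f (vec [x]) = vec [m * x]" for x
    using linear_on_scale[OF assms(1), of "vec [1]" x] m by (simp add: mult.commute)
  then show ?thesis by (rule that)
qed

lemma linear_kn2:
  fixes f :: "(nat \<Rightarrow> 'k::field) \<Rightarrow> nat \<Rightarrow> 'k"
  assumes "linear_on kscale kscale (kn 2) f" "f ` kn 2 \<subseteq> kn 2"
  obtains m00 m01 m10 m11 where "\<And>x y. f (vec [x, y]) = vec [m00 * x + m01 * y, m10 * x + m11 * y]"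
proof -
  have "f (vec [1,0]) \<in> kn 2" "f (vec [0,1]) \<in> kn 2" using assms by auto
  then obtain a c a' c' where m: "f (vec [1,0]) = vec [a,c]" "f (vec [0,1]) = vec [a',c']"
    by (auto elim!: kn_SucE simp: numeral_2_eq_2)
  have "f (vec [x, y]) = vec [a * x + a' * y, c * x + c' * y]" for x y
  proof -
    have "f (vec [x,y]) = f (vec [x,0]) + f (vec [0,y])"
      using linear_on_add[OF assms(1), of "vec [x,0]" "vec [0,y]"] by simp
    also have "f (vec [x,0]) = kscale x (f (vec [1,0]))"
      using linear_on_scale[OF assms(1), of "vec [1,0]" x] by simp
    also have "f (vec [0,y]) = kscale y (f (vec [0,1]))"
      using linear_on_scale[OF assms(1), of "vec [0,1]" y] by simp
    finally show ?thesis unfolding m by (simp add: mult.commute)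
  qed
  then show ?thesis by (rule that)
qed

lemma linear_kn3:
  fixes f :: "(nat \<Rightarrow> 'k::field) \<Rightarrow> nat \<Rightarrow> 'k"
  assumes "linear_on kscale kscale (kn 3) f" "f ` kn 3 \<subseteq> kn 3"
  obtains m00 m01 m02 m10 m11 m12 m20 m21 m22 where
    "\<And>x y z. f (vec [x, y, z]) = vec [m00 * x + m01 * y + m02 * z, m10 * x + m11 * y + m12 * z, m20 * x + m21 * y + m22 * z]"
proof -
  have "f (vec [1,0,0]) \<in> kn 3" "f (vec [0,1,0]) \<in> kn 3" "f (vec [0,0,1]) \<in> kn 3" using assms by auto
  then obtain a c d a' c' d' a'' c'' d'' where m: "f (vec [1,0,0]) = vec [a,c,d]" "f (vec [0,1,0]) = vec [a',c',d']"
    "f (vec [0,0,1]) = vec [a'',c'',d'']"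
    by (auto elim!: kn_SucE simp: numeral_3_eq_3)
  have "f (vec [x, y, z]) = vec [a * x + a' * y + a'' * z, c * x + c' * y + c'' * z, d * x + d' * y + d'' * z]" for x y z
  proof -
    have "vec [x,y,z] = vec [x,y,0] + vec [0,0,z]" "vec [x,y,0] = vec [x,0,0] + vec [0,y,0]" by simp_all
    then have "f (vec [x,y,z]) = f (vec [x,0,0]) + f (vec [0,y,0]) + f (vec [0,0,z])"
      using linear_on_add[OF assms(1), of "vec [x,y,0]" "vec [0,0,z]"]
        linear_on_add[OF assms(1), of "vec [x,0,0]" "vec [0,y,0]"] by simp
    also have "f (vec [x,0,0]) = kscale x (f (vec [1,0,0]))"
      using linear_on_scale[OF assms(1), of "vec [1,0,0]" x] by simp
    also have "f (vec [0,y,0]) = kscale y (f (vec [0,1,0]))"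
      using linear_on_scale[OF assms(1), of "vec [0,1,0]" y] by simp
    also have "f (vec [0,0,z]) = kscale z (f (vec [0,0,1]))"
      using linear_on_scale[OF assms(1), of "vec [0,0,1]" z] by simp
    finally show ?thesis unfolding m by (simp add: mult.commute)
  qed
  then show ?thesis by (rule that)
qed

section \<open>Coordinates for the chain\<close>

declare One_nat_def [simp del]

text \<open>With \<open>One_nat_def\<close> removed from the simplifier, the \<open>1\<close> in
  addresses such as \<open>[1]\<close> and in dimensions stays as it is and needs its own
  rules.\<close>

lemma vcons_1 [simp]:
  fixes a :: "'k::field"
  shows "vcons a v 1 = v 0" "trunc 1 (vcons a v) = vcons a 0" "vcons a v \<in> kn 1 \<longleftrightarrow> v = 0"
  by (simp_all add: One_nat_def)

lemma kn_1_iff: "x \<in> kn 1 \<longleftrightarrow> (\<exists>a. x = vcons a (0 :: nat \<Rightarrow> 'k::field))"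
  by (auto simp: One_nat_def elim: kn_SucE)

lemma Adr_singles: "[0] \<in> Adr" "[1] \<in> Adr" "[2] \<in> Adr"
  by simp_all

lemma Ball_Bex_kn_1 [simp]:
  fixes P :: "(nat \<Rightarrow> 'k::field) \<Rightarrow> bool"
  shows "(\<forall>x\<in>kn 1. P x) \<longleftrightarrow> (\<forall>a. P (vcons a 0))" "(\<exists>x\<in>kn 1. P x) \<longleftrightarrow> (\<exists>a. P (vcons a 0))"
  by (simp_all add: One_nat_def)

lemma less_2_iff: "i < (2::nat) \<longleftrightarrow> i = 0 \<or> i = 1"
  by auto

lemma less_3_iff: "i < (3::nat) \<longleftrightarrow> i = 0 \<or> i = 1 \<or> i = 2"
  by auto

text \<open>
  The matrices \<open>vmap t i\<close> and \<open>wmap t i j\<close> were found by a search for coordinates in which all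
  truncations along the chain have scalar endomorphisms only. To cover all characteristics at once,
  \<open>t\<close> will be a root of \<open>x\<^sup>2 = x + 1\<close>, which always differs from 0, 1 and 2. The leaves \<open>[i, j, k]\<close> are attached such that
  they force endomorphisms to preserve the line through \<open>line t i j\<close>.
\<close>

definition vmap :: "'k \<Rightarrow> nat \<Rightarrow> (nat \<Rightarrow> 'k) \<Rightarrow> nat \<Rightarrow> 'k::field" where
  "vmap t i x =
     (if i = 0 then vec [x 0 + t * x 2, x 1, x 2, 0, 0, 0, 0]
      else if i = 1 then vec [t * x 0 + x 1 - t * x 2, - x 1, x 0 - x 2, x 1, - x 0, x 2, 0]
      else vec [(1 + t) * x 0 + x 1, 0, x 0, x 1, - x 0, x 2, x 2])"

definition wmap :: "'k \<Rightarrow> nat \<Rightarrow> nat \<Rightarrow> (nat \<Rightarrow> 'k) \<Rightarrow> nat \<Rightarrow> 'k::field" where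
  "wmap t i j x =
     (if j = 0
      then (if i = 0 then vec [x 0 - x 1 + t * x 2, x 0, x 2]
            else if i = 1 then vec [x 0 - x 2, x 1, x 2]
            else vec [t * x 0 - x 1 + x 2, x 0, x 2])
      else (if i = 0 then vec [t * x 0 - x 1 - x 2, x 0 - t * x 2, x 2]
            else vec [x 0, x 1, x 2]))"

text \<open>For each \<open>i\<close> the two vectors differ by \<open>(1, 0, 0)\<close>,
  \<open>(0, 1, 0)\<close> and \<open>(1, 1, 0)\<close> respectively. Up to the sign put into
  \<open>A3\<close>, these are the three vectors by which the neighbours map to the root in the
  second reflection, which is what exactness at \<open>[i]\<close> demands.\<close>

definition line :: "'k \<Rightarrow> nat \<Rightarrow> nat \<Rightarrow> nat \<Rightarrow> 'k::field" where
  "line t i j =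
     (if i = 0 then (if j = 0 then vec [0, 1, 1] else vec [1, 1, 1])
      else if i = 1 then (if j = 0 then vec [1, 0, t] else vec [1, 1, t])
      else (if j = 0 then vec [0, 0, 1] else vec [1, 1, 1]))"

text \<open>The extra entry in coordinate 3 of the leaf images disappears as long as
  \<open>[i, j]\<close> has dimension at most 3. The factors \<open>t\<close> and
  \<open>t - 1\<close> are both nonzero, so each leaf alone marks the line; and they differ by 1, so
  the difference of the two leaf images is exactly the image of \<open>line t i j\<close>.\<close>

definition A4 :: "'k \<Rightarrow> nat list \<Rightarrow> (nat \<Rightarrow> 'k) \<Rightarrow> nat \<Rightarrow> 'k::field" where
  "A4 t p x = (case p of
       [] \<Rightarrow> 0
     | [i] \<Rightarrow> vmap t i x
     | [i, j] \<Rightarrow> wmap t i j x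
     | [i, j, k] \<Rightarrow> kscale (x 0) (kscale (if k = 0 then t else t - 1) (wmap t i j (line t i j)) + vec [0, 0, 0, 1])
     | _ \<Rightarrow> vec [x 0])"

lemma A4_simps:
  "A4 t [i] x = vmap t i x"
  "A4 t [i, j] x = wmap t i j x"
  "A4 t [i, j, k] x = kscale (x 0) (kscale (if k = 0 then t else t - 1) (wmap t i j (line t i j)) + vec [0, 0, 0, 1])"
  "A4 t [i, j, k, h] x = vec [x 0]"
  by (simp_all add: A4_def)

lemma vmap_simps:
  "vmap t 0 x = vec [x 0 + t * x 2, x 1, x 2, 0, 0, 0, 0]"
  "vmap t 1 x = vec [t * x 0 + x 1 - t * x 2, - x 1, x 0 - x 2, x 1, - x 0, x 2, 0]"
  "vmap t 2 x = vec [(1 + t) * x 0 + x 1, 0, x 0, x 1, - x 0, x 2, x 2]"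
  by (simp_all add: vmap_def)

lemma wmap_simps:
  "wmap t 0 0 x = vec [x 0 - x 1 + t * x 2, x 0, x 2]"
  "wmap t 0 1 x = vec [t * x 0 - x 1 - x 2, x 0 - t * x 2, x 2]"
  "wmap t 1 0 x = vec [x 0 - x 2, x 1, x 2]"
  "wmap t 1 1 x = vec [x 0, x 1, x 2]"
  "wmap t 2 0 x = vec [t * x 0 - x 1 + x 2, x 0, x 2]"
  "wmap t 2 1 x = vec [x 0, x 1, x 2]"
  by (simp_all add: wmap_def)

lemma all_linear_A4: "all_linear (A4 t)"
  unfolding all_linear_def linear_on_def A4_def
  by (auto split: list.split simp: vmap_def wmap_def kvec.scale_left_distrib algebra_simps)
     (auto simp: kscale_def fun_eq_iff algebra_simps)

text \<open>Dimension vectors up to total dimension 40, where the second leaves and the outer sinks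
  are still absent.\<close>

definition dims :: "nat \<Rightarrow> nat list \<Rightarrow> nat list \<Rightarrow> nat list \<Rightarrow> nat list \<Rightarrow> nat" where
  "dims X Vs Ws Ls p = (case p of
       [] \<Rightarrow> X
     | [i] \<Rightarrow> Vs ! i
     | [i, j] \<Rightarrow> if j < 2 then Ws ! (2 * i + j) else 0
     | [i, j, k] \<Rightarrow> if j < 2 \<and> k = 0 then Ls ! (2 * i + j) else 0
     | _ \<Rightarrow> 0)"

lemma dims_simps [simp]:
  "dims X Vs Ws Ls [] = X"
  "dims X Vs Ws Ls [i] = Vs ! i"
  "dims X Vs Ws Ls [i, 0] = Ws ! (2 * i)"
  "dims X Vs Ws Ls [i, 1] = Ws ! (2 * i + 1)"
  "dims X Vs Ws Ls [i, 0, 0] = Ls ! (2 * i)"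
  "dims X Vs Ws Ls [i, 1, 0] = Ls ! (2 * i + 1)"
  "dims X Vs Ws Ls [i, j, Suc k] = 0"
  "dims X Vs Ws Ls (i # j # k # h # r) = 0"
  by (simp_all add: dims_def)

lemma endo_zero: "endo b A D f \<Longrightarrow> p \<in> Adr \<Longrightarrow> f p 0 = 0"
  using linear_on_zero[OF endoD(1)] by simp

text \<open>All three maps end at the root, so applying \<open>f []\<close> to a relation between
  three images yields the relation between the images of the transformed vectors.\<close>

lemma endo_root_relation:
  fixes f :: "nat list \<Rightarrow> (nat \<Rightarrow> 'k::field) \<Rightarrow> nat \<Rightarrow> 'k"
  assumes f: "endo False (A4 t) D f"
    and x: "x \<in> kn (D [0])" "y \<in> kn (D [1])" "z \<in> kn (D [2])"
    and eq: "trunc (D []) (vmap t 0 x + vmap t 1 y + vmap t 2 z) = 0"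
  shows "trunc (D []) (vmap t 0 (f [0] x) + vmap t 1 (f [1] y) + vmap t 2 (f [2] z)) = 0"
proof -
  let ?T = "trunc (D [])"
  have c: "f [] (?T (vmap t i u)) = ?T (vmap t i (f [i] u))" if "i < 3" "u \<in> kn (D [i])" for i u
    using endo_commute[OF f, of "[i]" u] that by (simp add: src_def snk_def A4_simps)
  have "f [] (?T (vmap t 0 x) + ?T (vmap t 1 y) + ?T (vmap t 2 z)) =
      f [] (?T (vmap t 0 x)) + f [] (?T (vmap t 1 y)) + f [] (?T (vmap t 2 z))"
    by (simp add: linear_on_add[OF endoD(1)[OF f Adr_Nil]] kvec.subspace_add)
  then show ?thesis
    using eq c[of 0 x] c[of 1 y] c[of 2 z] x linear_on_zero[OF endoD(1)[OF f Adr_Nil]]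
    by (simp add: trunc_add)
qed

lemma endo_W:
  assumes f: "endo False (A4 t) D f" and "i < 3" "j < 2" "x \<in> kn (D [i])"
  shows "f [i, j] (trunc (D [i, j]) (wmap t i j x)) = trunc (D [i, j]) (wmap t i j (f [i] x))"
  using endo_commute[OF f, of "[i, j]" x] assms(2-4) by (simp add: src_def snk_def A4_simps)

text \<open>Commutation with the map to \<open>[i, j]\<close> makes its kernel invariant under
  \<open>f [i]\<close>; this is one source of invariant lines.\<close>

lemma endo_kernel:
  assumes f: "endo False (A4 t) D f" and "i < 3" "j < 2" "x \<in> kn (D [i])"
    and "trunc (D [i, j]) (wmap t i j x) = 0"
  shows "trunc (D [i, j]) (wmap t i j (f [i] x)) = 0"
  using endo_W[OF assms(1-4)] assms(5) linear_on_zero[OF endoD(1)[OF f, of "[i, j]"]] assms(2,3) by simp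

lemma scalar_at_iff:
  "D p = 0 \<Longrightarrow> scalar_at D f c p \<longleftrightarrow> f p 0 = 0"
  "D p = 1 \<Longrightarrow> scalar_at D f c p \<longleftrightarrow> (\<forall>x. f p (vec [x]) = kscale c (vec [x]))"
  "D p = 2 \<Longrightarrow> scalar_at D f c p \<longleftrightarrow> (\<forall>x y. f p (vec [x, y]) = kscale c (vec [x, y]))"
  "D p = 3 \<Longrightarrow> scalar_at D f c p \<longleftrightarrow> (\<forall>x y z. f p (vec [x, y, z]) = kscale c (vec [x, y, z]))"
  by (simp_all add: scalar_at_def)

definition V_scalar :: "(nat list \<Rightarrow> nat) \<Rightarrow> (nat list \<Rightarrow> (nat \<Rightarrow> 'k::field) \<Rightarrow> nat \<Rightarrow> 'k) \<Rightarrow> bool" where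
  "V_scalar D f \<longleftrightarrow> (\<exists>c. \<forall>i<3. scalar_at D f c [i])"

context
  fixes t :: "'k::field"
  assumes t2: "t * t = t + 1"
begin

text \<open>All of these are units by \<open>t * (t - 1) = 1\<close> and
  \<open>1 + t = t * t\<close>.\<close>

lemma t_neq: "t \<noteq> 0" "t \<noteq> 1" "1 + t \<noteq> 0" "t - 1 \<noteq> 0" "1 - t \<noteq> 0"
proof -
  show "t \<noteq> 0" using t2 by auto
  then show "1 + t \<noteq> 0" using t2 by (metis add.commute mult_eq_0_iff)
  have "t = 1 \<Longrightarrow> (1 :: 'k) = 1 + 1" using t2 by simp
  then show "t \<noteq> 1" by (metis add_cancel_right_right zero_neq_one)
  then show "t - 1 \<noteq> 0" "1 - t \<noteq> 0" by auto
qed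

text \<open>The leaf is a line, so its image is an eigenline of \<open>f [i, j]\<close>, and
  injectivity of the truncated map pulls it back to \<open>[i]\<close>. The vector \<open>x\<close>
  may differ from \<open>line t i j\<close>: in a truncated situation the preimage has to lie in
  \<open>kn (D [i])\<close> and to match only the remaining coordinates.\<close>

lemma endo_line:
  assumes f: "endo False (A4 t) D f" and ij: "i < 3" "j < 2"
    and D: "D [i, j] \<le> 3" "D [i, j, 0] = 1"
    and x: "x \<in> kn (D [i])" "trunc (D [i, j]) (wmap t i j x) = trunc (D [i, j]) (wmap t i j (line t i j))"
    and inj: "\<forall>y\<in>kn (D [i]). trunc (D [i, j]) (wmap t i j y) = 0 \<longrightarrow> y = 0"
  shows "\<exists>l. f [i] x = kscale l x"
proof -
  let ?T = "trunc (D [i, j])" and ?W = "wmap t i j"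
  have lin: "linear_on kscale kscale UNIV ?W"
    using all_linear_A4[of t] A4_simps(2)[of t i j] unfolding all_linear_def by (metis ext)
  note fW = endoD(1)[OF f, of "[i, j]"]
  obtain l where l: "f [i, j, 0] (vec [1]) = vec [l]"
    using endoD(2)[OF f, of "[i, j, 0]" "vec [1]"] D ij by (auto simp: kn_1_iff)
  \<comment> \<open>At most three coordinates are kept, so the extra entry of the leaf image is cut
    off.\<close>
  have T3: "?T (vec [0, 0, 0, 1]) = 0" using D(1) by (auto simp: trunc_def vcons_def fun_eq_iff split: nat.splits)
  have "f [i, j] (?T (A4 t [i, j, 0] (vec [1]))) = ?T (A4 t [i, j, 0] (vec [l]))"
    using endo_commute[OF f, of "[i, j, 0]" "vec [1]"] l D ij by (simp add: src_def snk_def)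
  then have "f [i, j] (kscale t (?T (?W x))) = kscale (l * t) (?T (?W x))"
    by (simp add: A4_simps trunc_add trunc_scale T3[simplified] x)
  then have "kscale t (?T (?W (f [i] x))) = kscale (l * t) (?T (?W x))"
    using linear_on_scale[OF fW, of "?T (?W x)" t] endo_W[OF f ij x(1)] ij by simp
  then have "kscale (inverse t) (kscale t (?T (?W (f [i] x)))) = kscale (inverse t) (kscale (l * t) (?T (?W x)))"
    by simp
  then have 1: "?T (?W (f [i] x)) = ?T (?W (kscale l x))"
    using t_neq(1) linear_on_scale[OF lin, of x l] by (simp add: trunc_scale mult.commute)
  have fx: "f [i] x \<in> kn (D [i])" using endoD(2)[OF f _ x(1)] ij by simp
  have "?W (f [i] x) = ?W (f [i] x - kscale l x) + ?W (kscale l x)"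
    using linear_on_add[OF lin, of "f [i] x - kscale l x" "kscale l x"] by simp
  then have "?T (?W (f [i] x - kscale l x)) = 0" using 1 by (simp add: trunc_add)
  moreover have "f [i] x - kscale l x \<in> kn (D [i])"
    using fx x(1) by (intro kvec.subspace_diff kvec.subspace_scale) auto
  ultimately have "f [i] x = kscale l x" using inj by fastforce
  then show ?thesis ..
qed

lemma endo_matrix3:
  fixes f :: "nat list \<Rightarrow> (nat \<Rightarrow> 'k::field) \<Rightarrow> nat \<Rightarrow> 'k"
  assumes "endo b A D f" "p \<in> Adr" "D p = 3"
  obtains a00 a01 a02 a10 a11 a12 a20 a21 a22 where
    "\<And>x y z. f p (vec [x, y, z]) =
       vec [a00 * x + a01 * y + a02 * z, a10 * x + a11 * y + a12 * z, a20 * x + a21 * y + a22 * z]"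
proof -
  have "linear_on kscale kscale (kn 3) (f p)" "f p ` kn 3 \<subseteq> kn 3"
    using endoD[OF assms(1,2)] assms(3) by auto
  then show ?thesis by (rule linear_kn3) (rule that)
qed

lemma endo_matrix2:
  fixes f :: "nat list \<Rightarrow> (nat \<Rightarrow> 'k::field) \<Rightarrow> nat \<Rightarrow> 'k"
  assumes "endo b A D f" "p \<in> Adr" "D p = 2"
  obtains a00 a01 a10 a11 where
    "\<And>x y. f p (vec [x, y]) = vec [a00 * x + a01 * y, a10 * x + a11 * y]"
proof -
  have "linear_on kscale kscale (kn 2) (f p)" "f p ` kn 2 \<subseteq> kn 2"
    using endoD[OF assms(1,2)] assms(3) by auto
  then show ?thesis by (rule linear_kn2) (rule that)
qed

lemma endo_matrix1:
  fixes f :: "nat list \<Rightarrow> (nat \<Rightarrow> 'k::field) \<Rightarrow> nat \<Rightarrow> 'k"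
  assumes "endo b A D f" "p \<in> Adr" "D p = 1"
  obtains a where "\<And>x. f p (vec [x]) = vec [a * x]"
proof -
  have "linear_on kscale kscale (kn 1) (f p)" "f p ` kn 1 \<subseteq> kn 1"
    using endoD[OF assms(1,2)] assms(3) by auto
  then show ?thesis by (rule linear_kn1) (rule that)
qed

section \<open>Invariant lines force a common scalar at the three neighbours of the root\<close>

lemma V_scalar_start:
  assumes D: "D [0] = 1" "D [1] = 0" "D [2] = 0"
    and f: "endo False (A4 t) D f"
  shows "V_scalar D f"
proof -
  obtain a where a:
    "\<And>x. f [0] (vec [x]) = vec [a * x]"
    by (rule endo_matrix1[OF f Adr_singles(1) D(1)]) (rule that)
  show ?thesis
    unfolding V_scalar_def
    by (intro exI[of _ a] allI impI) (auto simp: less_3_iff scalar_at_iff D endo_zero[OF f] a[unfolded vec.simps])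
qed

text \<open>The digits in these names are the dimensions of the root and of its three neighbours.
  Three distinct lines in the plane at \<open>[0]\<close> are invariant: the kernels
  \<open>(1, 1)\<close> and \<open>(1, t)\<close> of the maps away from the root and the kernel
  \<open>(0, 1)\<close> of the map to the root.\<close>

lemma V_scalar_1_200:
  assumes D: "D [] = 1" "D [0] = 2" "D [1] = 0" "D [2] = 0"
    and W: "D [0, 0] = 1" "D [0, 1] = 1"
    and f: "endo False (A4 t) D f"
  shows "V_scalar D f"
proof -
  obtain a00 a01 a10 a11 where a:
    "\<And>x y. f [0] (vec [x, y]) = vec [a00 * x + a01 * y, a10 * x + a11 * y]"
    by (rule endo_matrix2[OF f Adr_singles(1) D(2)]) (rule that)
  have k1: "trunc 1 (wmap t 0 0 (f [0] (vec [1, 1]))) = 0"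
    by (rule endo_kernel[OF f, of 0 0, unfolded W]) (simp_all add: D wmap_simps algebra_simps t2)
  have k2: "trunc 1 (wmap t 0 1 (f [0] (vec [1, t]))) = 0"
    by (rule endo_kernel[OF f, of 0 1, unfolded W]) (simp_all add: D wmap_simps algebra_simps t2)
  have r1: "trunc 1 (vmap t 0 (f [0] (vec [0, 1])) + vmap t 1 (f [1] (0)) + vmap t 2 (f [2] (0))) = 0"
    by (rule endo_root_relation[OF f, unfolded D]) (simp_all add: vmap_simps algebra_simps)
  note eqs = k1[unfolded a] k2[unfolded a] r1[unfolded a]
  have "a01 = 0 \<and> a10 = 0 \<and> a11 = a00"
    using eqs t2 by (simp add: wmap_simps vmap_simps endo_zero[OF f]) (algebra | (clarify, algebra))
  then show ?thesis
    unfolding V_scalar_def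
    by (intro exI[of _ a00] allI impI) (auto simp: less_3_iff scalar_at_iff D endo_zero[OF f] a[unfolded vec.simps])
qed

text \<open>The three lines persist, and the relation between \<open>[0]\<close> and
  \<open>[1]\<close> at the root passes the scalar on to \<open>[1]\<close>.\<close>

lemma V_scalar_1_210:
  assumes D: "D [] = 1" "D [0] = 2" "D [1] = 1" "D [2] = 0"
    and W: "D [0, 0] = 1" "D [0, 1] = 1"
    and f: "endo False (A4 t) D f"
  shows "V_scalar D f"
proof -
  obtain a00 a01 a10 a11 where a:
    "\<And>x y. f [0] (vec [x, y]) = vec [a00 * x + a01 * y, a10 * x + a11 * y]"
    by (rule endo_matrix2[OF f Adr_singles(1) D(2)]) (rule that)
  obtain b where b:
    "\<And>x. f [1] (vec [x]) = vec [b * x]"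
    by (rule endo_matrix1[OF f Adr_singles(2) D(3)]) (rule that)
  have k1: "trunc 1 (wmap t 0 0 (f [0] (vec [1, 1]))) = 0"
    by (rule endo_kernel[OF f, of 0 0, unfolded W]) (simp_all add: D wmap_simps algebra_simps t2)
  have k2: "trunc 1 (wmap t 0 1 (f [0] (vec [1, t]))) = 0"
    by (rule endo_kernel[OF f, of 0 1, unfolded W]) (simp_all add: D wmap_simps algebra_simps t2)
  have r1: "trunc 1 (vmap t 0 (f [0] (vec [0, 1])) + vmap t 1 (f [1] (vec [0])) + vmap t 2 (f [2] (0))) = 0"
    by (rule endo_root_relation[OF f, unfolded D]) (simp_all add: vmap_simps algebra_simps)
  have r2: "trunc 1 (vmap t 0 (f [0] (vec [t, 0])) + vmap t 1 (f [1] (vec [- 1])) + vmap t 2 (f [2] (0))) = 0"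
    by (rule endo_root_relation[OF f, unfolded D]) (simp_all add: vmap_simps algebra_simps)
  note eqs = k1[unfolded a b] k2[unfolded a b] r1[unfolded a b] r2[unfolded a b]
  have "a01 = 0 \<and> a10 = 0 \<and> a11 = a00 \<and> b = a00"
    using eqs t2 by (simp add: wmap_simps vmap_simps endo_zero[OF f]) (algebra | (clarify, algebra))
  then show ?thesis
    unfolding V_scalar_def
    by (intro exI[of _ a00] allI impI) (auto simp: less_3_iff scalar_at_iff D endo_zero[OF f] a[unfolded vec.simps] b[unfolded vec.simps])
qed

text \<open>The map from \<open>[0]\<close> to the root has become injective, so its kernel
  \<open>(0, 1)\<close> is lost. In exchange the image of \<open>[1]\<close> at the root singles out
  the line \<open>(1, 0)\<close>.\<close>

lemma V_scalar_2_210a: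
  assumes D: "D [] = 2" "D [0] = 2" "D [1] = 1" "D [2] = 0"
    and W: "D [0, 0] = 1" "D [0, 1] = 1"
    and f: "endo False (A4 t) D f"
  shows "V_scalar D f"
proof -
  obtain a00 a01 a10 a11 where a:
    "\<And>x y. f [0] (vec [x, y]) = vec [a00 * x + a01 * y, a10 * x + a11 * y]"
    by (rule endo_matrix2[OF f Adr_singles(1) D(2)]) (rule that)
  obtain b where b:
    "\<And>x. f [1] (vec [x]) = vec [b * x]"
    by (rule endo_matrix1[OF f Adr_singles(2) D(3)]) (rule that)
  have k1: "trunc 1 (wmap t 0 0 (f [0] (vec [1, 1]))) = 0"
    by (rule endo_kernel[OF f, of 0 0, unfolded W]) (simp_all add: D wmap_simps algebra_simps t2)
  have k2: "trunc 1 (wmap t 0 1 (f [0] (vec [1, t]))) = 0"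
    by (rule endo_kernel[OF f, of 0 1, unfolded W]) (simp_all add: D wmap_simps algebra_simps t2)
  have r1: "trunc 2 (vmap t 0 (f [0] (vec [t, 0])) + vmap t 1 (f [1] (vec [- 1])) + vmap t 2 (f [2] (0))) = 0"
    by (rule endo_root_relation[OF f, unfolded D]) (simp_all add: vmap_simps algebra_simps)
  note eqs = k1[unfolded a b] k2[unfolded a b] r1[unfolded a b]
  have "a01 = 0 \<and> a10 = 0 \<and> a11 = a00 \<and> b = a00"
    using eqs t2 by (simp add: wmap_simps vmap_simps endo_zero[OF f]) (algebra | (clarify, algebra))
  then show ?thesis
    unfolding V_scalar_def
    by (intro exI[of _ a00] allI impI) (auto simp: less_3_iff scalar_at_iff D endo_zero[OF f] a[unfolded vec.simps] b[unfolded vec.simps])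
qed

text \<open>With \<open>[0, 0]\<close> of dimension 2 the kernel \<open>(1, 1)\<close> is lost; the
  leaf behind it supplies the line \<open>(0, 1)\<close> instead.\<close>

lemma V_scalar_2_210b:
  assumes D: "D [] = 2" "D [0] = 2" "D [1] = 1" "D [2] = 0"
    and W: "D [0, 0] = 2" "D [0, 1] = 1" "D [0, 0, 0] = 1"
    and f: "endo False (A4 t) D f"
  shows "V_scalar D f"
proof -
  obtain a00 a01 a10 a11 where a:
    "\<And>x y. f [0] (vec [x, y]) = vec [a00 * x + a01 * y, a10 * x + a11 * y]"
    by (rule endo_matrix2[OF f Adr_singles(1) D(2)]) (rule that)
  obtain b where b:
    "\<And>x. f [1] (vec [x]) = vec [b * x]"
    by (rule endo_matrix1[OF f Adr_singles(2) D(3)]) (rule that)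
  \<comment> \<open>\<open>(0, 1 - t)\<close> is the vector of \<open>kn 2\<close> whose image
    agrees with that of \<open>line t 0 0\<close> in the first two coordinates.\<close>
  have "\<exists>l. f [0] (vec [0, 1 - t]) = kscale l (vec [0, 1 - t])"
    by (rule endo_line[OF f, of 0 0]) (simp_all add: D W line_def wmap_simps algebra_simps t2)
  then obtain l1 where l1: "f [0] (vec [0, 1 - t]) = kscale l1 (vec [0, 1 - t])" ..
  have k1: "trunc 1 (wmap t 0 1 (f [0] (vec [1, t]))) = 0"
    by (rule endo_kernel[OF f, of 0 1, unfolded W]) (simp_all add: D wmap_simps algebra_simps t2)
  have r1: "trunc 2 (vmap t 0 (f [0] (vec [t, 0])) + vmap t 1 (f [1] (vec [- 1])) + vmap t 2 (f [2] (0))) = 0"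
    by (rule endo_root_relation[OF f, unfolded D]) (simp_all add: vmap_simps algebra_simps)
  note eqs = l1[unfolded a b] k1[unfolded a b] r1[unfolded a b]
  have "a01 = 0 \<and> a10 = 0 \<and> a11 = a00 \<and> b = a00"
    using eqs t2 by (simp add: wmap_simps vmap_simps endo_zero[OF f]) (algebra | (clarify, algebra))
  then show ?thesis
    unfolding V_scalar_def
    by (intro exI[of _ a00] allI impI) (auto simp: less_3_iff scalar_at_iff D endo_zero[OF f] a[unfolded vec.simps] b[unfolded vec.simps])
qed

text \<open>Now both kernels are replaced by leaf lines, spanned by \<open>(0, 1)\<close> and
  \<open>(1, 1)\<close>.\<close>

lemma V_scalar_2_210c:
  assumes D: "D [] = 2" "D [0] = 2" "D [1] = 1" "D [2] = 0"
    and W: "D [0, 0] = 2" "D [0, 1] = 2" "D [0, 0, 0] = 1" "D [0, 1, 0] = 1"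
    and f: "endo False (A4 t) D f"
  shows "V_scalar D f"
proof -
  obtain a00 a01 a10 a11 where a:
    "\<And>x y. f [0] (vec [x, y]) = vec [a00 * x + a01 * y, a10 * x + a11 * y]"
    by (rule endo_matrix2[OF f Adr_singles(1) D(2)]) (rule that)
  obtain b where b:
    "\<And>x. f [1] (vec [x]) = vec [b * x]"
    by (rule endo_matrix1[OF f Adr_singles(2) D(3)]) (rule that)
  have "\<exists>l. f [0] (vec [0, 1 - t]) = kscale l (vec [0, 1 - t])"
    by (rule endo_line[OF f, of 0 0]) (simp_all add: D W line_def wmap_simps algebra_simps t2)
  then obtain l1 where l1: "f [0] (vec [0, 1 - t]) = kscale l1 (vec [0, 1 - t])" ..
  have "\<exists>l. f [0] (vec [1 - t, 1 - t]) = kscale l (vec [1 - t, 1 - t])"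
    by (rule endo_line[OF f, of 0 1]) (simp_all add: D W line_def wmap_simps algebra_simps t2)
  then obtain l2 where l2: "f [0] (vec [1 - t, 1 - t]) = kscale l2 (vec [1 - t, 1 - t])" ..
  have r1: "trunc 2 (vmap t 0 (f [0] (vec [t, 0])) + vmap t 1 (f [1] (vec [- 1])) + vmap t 2 (f [2] (0))) = 0"
    by (rule endo_root_relation[OF f, unfolded D]) (simp_all add: vmap_simps algebra_simps)
  note eqs = l1[unfolded a b] l2[unfolded a b] r1[unfolded a b]
  have "a01 = 0 \<and> a10 = 0 \<and> a11 = a00 \<and> b = a00"
    using eqs t2 by (simp add: wmap_simps vmap_simps endo_zero[OF f]) (algebra | (clarify, algebra))
  then show ?thesis
    unfolding V_scalar_def
    by (intro exI[of _ a00] allI impI) (auto simp: less_3_iff scalar_at_iff D endo_zero[OF f] a[unfolded vec.simps] b[unfolded vec.simps])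
qed

text \<open>The image of \<open>[2]\<close> at the root is the same line as that of
  \<open>(1, 0)\<close>, with the nonzero factor \<open>1 + t\<close>.\<close>

lemma V_scalar_2_211:
  assumes D: "D [] = 2" "D [0] = 2" "D [1] = 1" "D [2] = 1"
    and W: "D [0, 0] = 2" "D [0, 1] = 2" "D [0, 0, 0] = 1" "D [0, 1, 0] = 1"
    and f: "endo False (A4 t) D f"
  shows "V_scalar D f"
proof -
  obtain a00 a01 a10 a11 where a:
    "\<And>x y. f [0] (vec [x, y]) = vec [a00 * x + a01 * y, a10 * x + a11 * y]"
    by (rule endo_matrix2[OF f Adr_singles(1) D(2)]) (rule that)
  obtain b where b:
    "\<And>x. f [1] (vec [x]) = vec [b * x]"
    by (rule endo_matrix1[OF f Adr_singles(2) D(3)]) (rule that)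
  obtain c where c:
    "\<And>x. f [2] (vec [x]) = vec [c * x]"
    by (rule endo_matrix1[OF f Adr_singles(3) D(4)]) (rule that)
  have "\<exists>l. f [0] (vec [0, 1 - t]) = kscale l (vec [0, 1 - t])"
    by (rule endo_line[OF f, of 0 0]) (simp_all add: D W line_def wmap_simps algebra_simps t2)
  then obtain l1 where l1: "f [0] (vec [0, 1 - t]) = kscale l1 (vec [0, 1 - t])" ..
  have "\<exists>l. f [0] (vec [1 - t, 1 - t]) = kscale l (vec [1 - t, 1 - t])"
    by (rule endo_line[OF f, of 0 1]) (simp_all add: D W line_def wmap_simps algebra_simps t2)
  then obtain l2 where l2: "f [0] (vec [1 - t, 1 - t]) = kscale l2 (vec [1 - t, 1 - t])" ..
  have r1: "trunc 2 (vmap t 0 (f [0] (vec [t, 0])) + vmap t 1 (f [1] (vec [- 1])) + vmap t 2 (f [2] (vec [0]))) = 0"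
    by (rule endo_root_relation[OF f, unfolded D]) (simp_all add: vmap_simps algebra_simps)
  have r2: "trunc 2 (vmap t 0 (f [0] (vec [1 + t, 0])) + vmap t 1 (f [1] (vec [0])) + vmap t 2 (f [2] (vec [- 1]))) = 0"
    by (rule endo_root_relation[OF f, unfolded D]) (simp_all add: vmap_simps algebra_simps)
  note eqs = l1[unfolded a b c] l2[unfolded a b c] r1[unfolded a b c] r2[unfolded a b c]
  have "a01 = 0 \<and> a10 = 0 \<and> a11 = a00 \<and> b = a00 \<and> c = a00"
    using eqs t2 by (simp add: wmap_simps vmap_simps endo_zero[OF f]) (algebra | (clarify, algebra))
  then show ?thesis
    unfolding V_scalar_def
    by (intro exI[of _ a00] allI impI) (auto simp: less_3_iff scalar_at_iff D endo_zero[OF f] a[unfolded vec.simps] b[unfolded vec.simps] c[unfolded vec.simps])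
qed

text \<open>The relations at the root now form a line. Its generator ties \<open>(1, 0)\<close> to
  generators of \<open>[1]\<close> and \<open>[2]\<close>, so it gives the third line and the common
  scalar at once.\<close>

lemma V_scalar_3_211:
  assumes D: "D [] = 3" "D [0] = 2" "D [1] = 1" "D [2] = 1"
    and W: "D [0, 0] = 2" "D [0, 1] = 2" "D [0, 0, 0] = 1" "D [0, 1, 0] = 1"
    and f: "endo False (A4 t) D f"
  shows "V_scalar D f"
proof -
  obtain a00 a01 a10 a11 where a:
    "\<And>x y. f [0] (vec [x, y]) = vec [a00 * x + a01 * y, a10 * x + a11 * y]"
    by (rule endo_matrix2[OF f Adr_singles(1) D(2)]) (rule that)
  obtain b where b:
    "\<And>x. f [1] (vec [x]) = vec [b * x]"
    by (rule endo_matrix1[OF f Adr_singles(2) D(3)]) (rule that)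
  obtain c where c:
    "\<And>x. f [2] (vec [x]) = vec [c * x]"
    by (rule endo_matrix1[OF f Adr_singles(3) D(4)]) (rule that)
  have "\<exists>l. f [0] (vec [0, 1 - t]) = kscale l (vec [0, 1 - t])"
    by (rule endo_line[OF f, of 0 0]) (simp_all add: D W line_def wmap_simps algebra_simps t2)
  then obtain l1 where l1: "f [0] (vec [0, 1 - t]) = kscale l1 (vec [0, 1 - t])" ..
  have "\<exists>l. f [0] (vec [1 - t, 1 - t]) = kscale l (vec [1 - t, 1 - t])"
    by (rule endo_line[OF f, of 0 1]) (simp_all add: D W line_def wmap_simps algebra_simps t2)
  then obtain l2 where l2: "f [0] (vec [1 - t, 1 - t]) = kscale l2 (vec [1 - t, 1 - t])" ..
  have r1: "trunc 3 (vmap t 0 (f [0] (vec [1, 0])) + vmap t 1 (f [1] (vec [1])) + vmap t 2 (f [2] (vec [- 1]))) = 0"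
    by (rule endo_root_relation[OF f, unfolded D]) (simp_all add: vmap_simps algebra_simps)
  note eqs = l1[unfolded a b c] l2[unfolded a b c] r1[unfolded a b c]
  have "a01 = 0 \<and> a10 = 0 \<and> a11 = a00 \<and> b = a00 \<and> c = a00"
    using eqs t2 by (simp add: wmap_simps vmap_simps endo_zero[OF f]) (algebra | (clarify, algebra))
  then show ?thesis
    unfolding V_scalar_def
    by (intro exI[of _ a00] allI impI) (auto simp: less_3_iff scalar_at_iff D endo_zero[OF f] a[unfolded vec.simps] b[unfolded vec.simps] c[unfolded vec.simps])
qed

text \<open>Four lines in general position at \<open>[0]\<close>: the kernels
  \<open>(0, t, 1)\<close> and \<open>(t, t, 1)\<close>, and \<open>(0, 0, 1)\<close> and
  \<open>(1, 0, 1)\<close>, which are the images of \<open>[1]\<close> and \<open>[2]\<close> seen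
  through the isomorphism of \<open>[0]\<close> with the root.\<close>

lemma V_scalar_3_311a:
  assumes D: "D [] = 3" "D [0] = 3" "D [1] = 1" "D [2] = 1"
    and W: "D [0, 0] = 2" "D [0, 1] = 2"
    and f: "endo False (A4 t) D f"
  shows "V_scalar D f"
proof -
  obtain a00 a01 a02 a10 a11 a12 a20 a21 a22 where a:
    "\<And>x y z. f [0] (vec [x, y, z]) = vec [a00 * x + a01 * y + a02 * z, a10 * x + a11 * y + a12 * z, a20 * x + a21 * y + a22 * z]"
    by (rule endo_matrix3[OF f Adr_singles(1) D(2)]) (rule that)
  obtain b where b:
    "\<And>x. f [1] (vec [x]) = vec [b * x]"
    by (rule endo_matrix1[OF f Adr_singles(2) D(3)]) (rule that)
  obtain c where c:
    "\<And>x. f [2] (vec [x]) = vec [c * x]"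
    by (rule endo_matrix1[OF f Adr_singles(3) D(4)]) (rule that)
  have k1: "trunc 2 (wmap t 0 0 (f [0] (vec [0, t, 1]))) = 0"
    by (rule endo_kernel[OF f, of 0 0, unfolded W]) (simp_all add: D wmap_simps algebra_simps t2)
  have k2: "trunc 2 (wmap t 0 1 (f [0] (vec [t, t, 1]))) = 0"
    by (rule endo_kernel[OF f, of 0 1, unfolded W]) (simp_all add: D wmap_simps algebra_simps t2)
  have r1: "trunc 3 (vmap t 0 (f [0] (vec [0, 0, 1])) + vmap t 1 (f [1] (vec [- 1])) + vmap t 2 (f [2] (vec [0]))) = 0"
    by (rule endo_root_relation[OF f, unfolded D]) (simp_all add: vmap_simps algebra_simps)
  have r2: "trunc 3 (vmap t 0 (f [0] (vec [1, 0, 1])) + vmap t 1 (f [1] (vec [0])) + vmap t 2 (f [2] (vec [- 1]))) = 0"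
    by (rule endo_root_relation[OF f, unfolded D]) (simp_all add: vmap_simps algebra_simps)
  note eqs = k1[unfolded a b c] k2[unfolded a b c] r1[unfolded a b c] r2[unfolded a b c]
  have "a01 = 0 \<and> a02 = 0 \<and> a10 = 0 \<and> a11 = a00 \<and> a12 = 0 \<and> a20 = 0 \<and> a21 = 0 \<and> a22 = a00 \<and> b = a00 \<and> c = a00"
    using eqs t2 by (simp add: wmap_simps vmap_simps endo_zero[OF f]) (clarsimp, algebra)
  then show ?thesis
    unfolding V_scalar_def
    by (intro exI[of _ a00] allI impI) (auto simp: less_3_iff scalar_at_iff D endo_zero[OF f] a[unfolded vec.simps] b[unfolded vec.simps] c[unfolded vec.simps])
qed

text \<open>The leaf line \<open>(1, 1, 1)\<close> takes the place of the kernel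
  \<open>(t, t, 1)\<close>.\<close>

lemma V_scalar_3_311b:
  assumes D: "D [] = 3" "D [0] = 3" "D [1] = 1" "D [2] = 1"
    and W: "D [0, 0] = 2" "D [0, 1] = 3" "D [0, 1, 0] = 1"
    and f: "endo False (A4 t) D f"
  shows "V_scalar D f"
proof -
  obtain a00 a01 a02 a10 a11 a12 a20 a21 a22 where a:
    "\<And>x y z. f [0] (vec [x, y, z]) = vec [a00 * x + a01 * y + a02 * z, a10 * x + a11 * y + a12 * z, a20 * x + a21 * y + a22 * z]"
    by (rule endo_matrix3[OF f Adr_singles(1) D(2)]) (rule that)
  obtain b where b:
    "\<And>x. f [1] (vec [x]) = vec [b * x]"
    by (rule endo_matrix1[OF f Adr_singles(2) D(3)]) (rule that)
  obtain c where c: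
    "\<And>x. f [2] (vec [x]) = vec [c * x]"
    by (rule endo_matrix1[OF f Adr_singles(3) D(4)]) (rule that)
  have "\<exists>l. f [0] (vec [1, 1, 1]) = kscale l (vec [1, 1, 1])"
    by (rule endo_line[OF f, of 0 1]) (simp_all add: D W line_def wmap_simps algebra_simps t2)
  then obtain l1 where l1: "f [0] (vec [1, 1, 1]) = kscale l1 (vec [1, 1, 1])" ..
  have k1: "trunc 2 (wmap t 0 0 (f [0] (vec [0, t, 1]))) = 0"
    by (rule endo_kernel[OF f, of 0 0, unfolded W]) (simp_all add: D wmap_simps algebra_simps t2)
  have r1: "trunc 3 (vmap t 0 (f [0] (vec [0, 0, 1])) + vmap t 1 (f [1] (vec [- 1])) + vmap t 2 (f [2] (vec [0]))) = 0"
    by (rule endo_root_relation[OF f, unfolded D]) (simp_all add: vmap_simps algebra_simps)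
  have r2: "trunc 3 (vmap t 0 (f [0] (vec [1, 0, 1])) + vmap t 1 (f [1] (vec [0])) + vmap t 2 (f [2] (vec [- 1]))) = 0"
    by (rule endo_root_relation[OF f, unfolded D]) (simp_all add: vmap_simps algebra_simps)
  note eqs = l1[unfolded a b c] k1[unfolded a b c] r1[unfolded a b c] r2[unfolded a b c]
  have "a01 = 0 \<and> a02 = 0 \<and> a10 = 0 \<and> a11 = a00 \<and> a12 = 0 \<and> a20 = 0 \<and> a21 = 0 \<and> a22 = a00 \<and> b = a00 \<and> c = a00"
    using eqs t2 by (simp add: wmap_simps vmap_simps endo_zero[OF f]) (algebra | (clarify, algebra))
  then show ?thesis
    unfolding V_scalar_def
    by (intro exI[of _ a00] allI impI) (auto simp: less_3_iff scalar_at_iff D endo_zero[OF f] a[unfolded vec.simps] b[unfolded vec.simps] c[unfolded vec.simps])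
qed

text \<open>The leaf line \<open>(0, 1, 1)\<close> takes the place of the kernel
  \<open>(0, t, 1)\<close>.\<close>

lemma V_scalar_3_311c:
  assumes D: "D [] = 3" "D [0] = 3" "D [1] = 1" "D [2] = 1"
    and W: "D [0, 0] = 3" "D [0, 1] = 3" "D [0, 0, 0] = 1" "D [0, 1, 0] = 1"
    and f: "endo False (A4 t) D f"
  shows "V_scalar D f"
proof -
  obtain a00 a01 a02 a10 a11 a12 a20 a21 a22 where a:
    "\<And>x y z. f [0] (vec [x, y, z]) = vec [a00 * x + a01 * y + a02 * z, a10 * x + a11 * y + a12 * z, a20 * x + a21 * y + a22 * z]"
    by (rule endo_matrix3[OF f Adr_singles(1) D(2)]) (rule that)
  obtain b where b:
    "\<And>x. f [1] (vec [x]) = vec [b * x]"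
    by (rule endo_matrix1[OF f Adr_singles(2) D(3)]) (rule that)
  obtain c where c:
    "\<And>x. f [2] (vec [x]) = vec [c * x]"
    by (rule endo_matrix1[OF f Adr_singles(3) D(4)]) (rule that)
  have "\<exists>l. f [0] (vec [0, 1, 1]) = kscale l (vec [0, 1, 1])"
    by (rule endo_line[OF f, of 0 0]) (simp_all add: D W line_def wmap_simps algebra_simps t2)
  then obtain l1 where l1: "f [0] (vec [0, 1, 1]) = kscale l1 (vec [0, 1, 1])" ..
  have "\<exists>l. f [0] (vec [1, 1, 1]) = kscale l (vec [1, 1, 1])"
    by (rule endo_line[OF f, of 0 1]) (simp_all add: D W line_def wmap_simps algebra_simps t2)
  then obtain l2 where l2: "f [0] (vec [1, 1, 1]) = kscale l2 (vec [1, 1, 1])" ..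
  have r1: "trunc 3 (vmap t 0 (f [0] (vec [0, 0, 1])) + vmap t 1 (f [1] (vec [- 1])) + vmap t 2 (f [2] (vec [0]))) = 0"
    by (rule endo_root_relation[OF f, unfolded D]) (simp_all add: vmap_simps algebra_simps)
  have r2: "trunc 3 (vmap t 0 (f [0] (vec [1, 0, 1])) + vmap t 1 (f [1] (vec [0])) + vmap t 2 (f [2] (vec [- 1]))) = 0"
    by (rule endo_root_relation[OF f, unfolded D]) (simp_all add: vmap_simps algebra_simps)
  note eqs = l1[unfolded a b c] l2[unfolded a b c] r1[unfolded a b c] r2[unfolded a b c]
  have "a01 = 0 \<and> a02 = 0 \<and> a10 = 0 \<and> a11 = a00 \<and> a12 = 0 \<and> a20 = 0 \<and> a21 = 0 \<and> a22 = a00 \<and> b = a00 \<and> c = a00"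
    using eqs t2 by (simp add: wmap_simps vmap_simps endo_zero[OF f]) (algebra | (clarify, algebra))
  then show ?thesis
    unfolding V_scalar_def
    by (intro exI[of _ a00] allI impI) (auto simp: less_3_iff scalar_at_iff D endo_zero[OF f] a[unfolded vec.simps] b[unfolded vec.simps] c[unfolded vec.simps])
qed

text \<open>Through the root, the plane at \<open>[2]\<close> embeds into \<open>[0]\<close>. Its
  kernel line \<open>(1, t)\<close> becomes \<open>(1 + t, 0, 1)\<close>, which replaces
  \<open>(1, 0, 1)\<close> among the four lines.\<close>

lemma V_scalar_3_312:
  assumes D: "D [] = 3" "D [0] = 3" "D [1] = 1" "D [2] = 2"
    and W: "D [0, 0] = 3" "D [0, 1] = 3" "D [2, 0] = 1" "D [0, 0, 0] = 1" "D [0, 1, 0] = 1"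
    and f: "endo False (A4 t) D f"
  shows "V_scalar D f"
proof -
  obtain a00 a01 a02 a10 a11 a12 a20 a21 a22 where a:
    "\<And>x y z. f [0] (vec [x, y, z]) = vec [a00 * x + a01 * y + a02 * z, a10 * x + a11 * y + a12 * z, a20 * x + a21 * y + a22 * z]"
    by (rule endo_matrix3[OF f Adr_singles(1) D(2)]) (rule that)
  obtain b where b:
    "\<And>x. f [1] (vec [x]) = vec [b * x]"
    by (rule endo_matrix1[OF f Adr_singles(2) D(3)]) (rule that)
  obtain c00 c01 c10 c11 where c:
    "\<And>x y. f [2] (vec [x, y]) = vec [c00 * x + c01 * y, c10 * x + c11 * y]"
    by (rule endo_matrix2[OF f Adr_singles(3) D(4)]) (rule that)
  have "\<exists>l. f [0] (vec [0, 1, 1]) = kscale l (vec [0, 1, 1])"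
    by (rule endo_line[OF f, of 0 0]) (simp_all add: D W line_def wmap_simps algebra_simps t2)
  then obtain l1 where l1: "f [0] (vec [0, 1, 1]) = kscale l1 (vec [0, 1, 1])" ..
  have "\<exists>l. f [0] (vec [1, 1, 1]) = kscale l (vec [1, 1, 1])"
    by (rule endo_line[OF f, of 0 1]) (simp_all add: D W line_def wmap_simps algebra_simps t2)
  then obtain l2 where l2: "f [0] (vec [1, 1, 1]) = kscale l2 (vec [1, 1, 1])" ..
  have k1: "trunc 1 (wmap t 2 0 (f [2] (vec [1, t]))) = 0"
    by (rule endo_kernel[OF f, of 2 0, unfolded W]) (simp_all add: D wmap_simps algebra_simps t2)
  have r1: "trunc 3 (vmap t 0 (f [0] (vec [0, 0, 1])) + vmap t 1 (f [1] (vec [- 1])) + vmap t 2 (f [2] (vec [0, 0]))) = 0"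
    by (rule endo_root_relation[OF f, unfolded D]) (simp_all add: vmap_simps algebra_simps)
  have r2: "trunc 3 (vmap t 0 (f [0] (vec [1, 0, 1])) + vmap t 1 (f [1] (vec [0])) + vmap t 2 (f [2] (vec [- 1, 0]))) = 0"
    by (rule endo_root_relation[OF f, unfolded D]) (simp_all add: vmap_simps algebra_simps)
  have r3: "trunc 3 (vmap t 0 (f [0] (vec [1, 0, 0])) + vmap t 1 (f [1] (vec [0])) + vmap t 2 (f [2] (vec [0, - 1]))) = 0"
    by (rule endo_root_relation[OF f, unfolded D]) (simp_all add: vmap_simps algebra_simps)
  note eqs = l1[unfolded a b c] l2[unfolded a b c] k1[unfolded a b c] r1[unfolded a b c] r2[unfolded a b c] r3[unfolded a b c]
  have "a01 = 0 \<and> a02 = 0 \<and> a10 = 0 \<and> a11 = a00 \<and> a12 = 0 \<and> a20 = 0 \<and> a21 = 0 \<and> a22 = a00 \<and> b = a00 \<and> c00 = a00 \<and> c01 = 0 \<and> c10 = 0 \<and> c11 = a00"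
    using eqs t2 by (simp add: wmap_simps vmap_simps endo_zero[OF f]) (algebra | (clarify, algebra))
  then show ?thesis
    unfolding V_scalar_def
    by (intro exI[of _ a00] allI impI) (auto simp: less_3_iff scalar_at_iff D endo_zero[OF f] a[unfolded vec.simps] b[unfolded vec.simps] c[unfolded vec.simps])
qed

text \<open>The plane at \<open>[1]\<close> embeds into \<open>[0]\<close> as well and meets the
  plane of \<open>[2]\<close> in \<open>(0, 0, 1)\<close>, so that the four lines of the preceding
  case are still invariant.\<close>

lemma V_scalar_3_322:
  assumes D: "D [] = 3" "D [0] = 3" "D [1] = 2" "D [2] = 2"
    and W: "D [0, 0] = 3" "D [0, 1] = 3" "D [1, 0] = 1" "D [2, 0] = 1" "D [0, 0, 0] = 1" "D [0, 1, 0] = 1"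
    and f: "endo False (A4 t) D f"
  shows "V_scalar D f"
proof -
  obtain a00 a01 a02 a10 a11 a12 a20 a21 a22 where a:
    "\<And>x y z. f [0] (vec [x, y, z]) = vec [a00 * x + a01 * y + a02 * z, a10 * x + a11 * y + a12 * z, a20 * x + a21 * y + a22 * z]"
    by (rule endo_matrix3[OF f Adr_singles(1) D(2)]) (rule that)
  obtain b00 b01 b10 b11 where b:
    "\<And>x y. f [1] (vec [x, y]) = vec [b00 * x + b01 * y, b10 * x + b11 * y]"
    by (rule endo_matrix2[OF f Adr_singles(2) D(3)]) (rule that)
  obtain c00 c01 c10 c11 where c:
    "\<And>x y. f [2] (vec [x, y]) = vec [c00 * x + c01 * y, c10 * x + c11 * y]"
    by (rule endo_matrix2[OF f Adr_singles(3) D(4)]) (rule that)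
  have "\<exists>l. f [0] (vec [0, 1, 1]) = kscale l (vec [0, 1, 1])"
    by (rule endo_line[OF f, of 0 0]) (simp_all add: D W line_def wmap_simps algebra_simps t2)
  then obtain l1 where l1: "f [0] (vec [0, 1, 1]) = kscale l1 (vec [0, 1, 1])" ..
  have "\<exists>l. f [0] (vec [1, 1, 1]) = kscale l (vec [1, 1, 1])"
    by (rule endo_line[OF f, of 0 1]) (simp_all add: D W line_def wmap_simps algebra_simps t2)
  then obtain l2 where l2: "f [0] (vec [1, 1, 1]) = kscale l2 (vec [1, 1, 1])" ..
  have k1: "trunc 1 (wmap t 1 0 (f [1] (vec [0, 1]))) = 0"
    by (rule endo_kernel[OF f, of 1 0, unfolded W]) (simp_all add: D wmap_simps algebra_simps t2)
  have k2: "trunc 1 (wmap t 2 0 (f [2] (vec [1, t]))) = 0"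
    by (rule endo_kernel[OF f, of 2 0, unfolded W]) (simp_all add: D wmap_simps algebra_simps t2)
  have r1: "trunc 3 (vmap t 0 (f [0] (vec [0, 0, 1])) + vmap t 1 (f [1] (vec [- 1, 0])) + vmap t 2 (f [2] (vec [0, 0]))) = 0"
    by (rule endo_root_relation[OF f, unfolded D]) (simp_all add: vmap_simps algebra_simps)
  have r2: "trunc 3 (vmap t 0 (f [0] (vec [1, - 1, 0])) + vmap t 1 (f [1] (vec [0, - 1])) + vmap t 2 (f [2] (vec [0, 0]))) = 0"
    by (rule endo_root_relation[OF f, unfolded D]) (simp_all add: vmap_simps algebra_simps)
  have r3: "trunc 3 (vmap t 0 (f [0] (vec [1, 0, 1])) + vmap t 1 (f [1] (vec [0, 0])) + vmap t 2 (f [2] (vec [- 1, 0]))) = 0"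
    by (rule endo_root_relation[OF f, unfolded D]) (simp_all add: vmap_simps algebra_simps)
  have r4: "trunc 3 (vmap t 0 (f [0] (vec [1, 0, 0])) + vmap t 1 (f [1] (vec [0, 0])) + vmap t 2 (f [2] (vec [0, - 1]))) = 0"
    by (rule endo_root_relation[OF f, unfolded D]) (simp_all add: vmap_simps algebra_simps)
  note eqs = l1[unfolded a b c] l2[unfolded a b c] k1[unfolded a b c] k2[unfolded a b c] r1[unfolded a b c] r2[unfolded a b c] r3[unfolded a b c] r4[unfolded a b c]
  have "a01 = 0 \<and> a02 = 0 \<and> a10 = 0 \<and> a11 = a00 \<and> a12 = 0 \<and> a20 = 0 \<and> a21 = 0 \<and> a22 = a00 \<and> b00 = a00 \<and> b01 = 0 \<and> b10 = 0 \<and> b11 = a00 \<and> c00 = a00 \<and> c01 = 0 \<and> c10 = 0 \<and> c11 = a00"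
    using eqs t2 by (simp add: wmap_simps vmap_simps endo_zero[OF f]) (algebra | (clarify, algebra))
  then show ?thesis
    unfolding V_scalar_def
    by (intro exI[of _ a00] allI impI) (auto simp: less_3_iff scalar_at_iff D endo_zero[OF f] a[unfolded vec.simps] b[unfolded vec.simps] c[unfolded vec.simps])
qed

text \<open>The relations at the root have dimension 3 and project isomorphically to
  \<open>[0]\<close>. Those without a part at \<open>[2]\<close> give the line
  \<open>(0, 0, 1)\<close>, those without a part at \<open>[1]\<close> the line
  \<open>(1, 0, 1)\<close>; the leaf lines complete them to four lines in general position.\<close>

lemma V_scalar_4_322:
  assumes D: "D [] = 4" "D [0] = 3" "D [1] = 2" "D [2] = 2"
    and W: "D [0, 0] = 3" "D [0, 1] = 3" "D [0, 0, 0] = 1" "D [0, 1, 0] = 1"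
    and f: "endo False (A4 t) D f"
  shows "V_scalar D f"
proof -
  obtain a00 a01 a02 a10 a11 a12 a20 a21 a22 where a:
    "\<And>x y z. f [0] (vec [x, y, z]) = vec [a00 * x + a01 * y + a02 * z, a10 * x + a11 * y + a12 * z, a20 * x + a21 * y + a22 * z]"
    by (rule endo_matrix3[OF f Adr_singles(1) D(2)]) (rule that)
  obtain b00 b01 b10 b11 where b:
    "\<And>x y. f [1] (vec [x, y]) = vec [b00 * x + b01 * y, b10 * x + b11 * y]"
    by (rule endo_matrix2[OF f Adr_singles(2) D(3)]) (rule that)
  obtain c00 c01 c10 c11 where c:
    "\<And>x y. f [2] (vec [x, y]) = vec [c00 * x + c01 * y, c10 * x + c11 * y]"
    by (rule endo_matrix2[OF f Adr_singles(3) D(4)]) (rule that)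
  have "\<exists>l. f [0] (vec [0, 1, 1]) = kscale l (vec [0, 1, 1])"
    by (rule endo_line[OF f, of 0 0]) (simp_all add: D W line_def wmap_simps algebra_simps t2)
  then obtain l1 where l1: "f [0] (vec [0, 1, 1]) = kscale l1 (vec [0, 1, 1])" ..
  have "\<exists>l. f [0] (vec [1, 1, 1]) = kscale l (vec [1, 1, 1])"
    by (rule endo_line[OF f, of 0 1]) (simp_all add: D W line_def wmap_simps algebra_simps t2)
  then obtain l2 where l2: "f [0] (vec [1, 1, 1]) = kscale l2 (vec [1, 1, 1])" ..
  have r1: "trunc 4 (vmap t 0 (f [0] (vec [1, 0, 0])) + vmap t 1 (f [1] (vec [1, 0])) + vmap t 2 (f [2] (vec [- 1, 0]))) = 0"
    by (rule endo_root_relation[OF f, unfolded D]) (simp_all add: vmap_simps algebra_simps)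
  have r2: "trunc 4 (vmap t 0 (f [0] (vec [0, 1, 0])) + vmap t 1 (f [1] (vec [0, 1])) + vmap t 2 (f [2] (vec [0, - 1]))) = 0"
    by (rule endo_root_relation[OF f, unfolded D]) (simp_all add: vmap_simps algebra_simps)
  have r3: "trunc 4 (vmap t 0 (f [0] (vec [0, 0, 1])) + vmap t 1 (f [1] (vec [- 1, 0])) + vmap t 2 (f [2] (vec [0, 0]))) = 0"
    by (rule endo_root_relation[OF f, unfolded D]) (simp_all add: vmap_simps algebra_simps)
  note eqs = l1[unfolded a b c] l2[unfolded a b c] r1[unfolded a b c] r2[unfolded a b c] r3[unfolded a b c]
  have "a01 = 0 \<and> a02 = 0 \<and> a10 = 0 \<and> a11 = a00 \<and> a12 = 0 \<and> a20 = 0 \<and> a21 = 0 \<and> a22 = a00 \<and> b00 = a00 \<and> b01 = 0 \<and> b10 = 0 \<and> b11 = a00 \<and> c00 = a00 \<and> c01 = 0 \<and> c10 = 0 \<and> c11 = a00"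
    using eqs t2 by (simp add: wmap_simps vmap_simps endo_zero[OF f]) (algebra | (clarify, algebra))
  then show ?thesis
    unfolding V_scalar_def
    by (intro exI[of _ a00] allI impI) (auto simp: less_3_iff scalar_at_iff D endo_zero[OF f] a[unfolded vec.simps] b[unfolded vec.simps] c[unfolded vec.simps])
qed

text \<open>The relations form a plane that identifies the first two coordinates of
  \<open>[0]\<close> with \<open>[1]\<close> and with \<open>[2]\<close>. In it lie the kernel lines
  \<open>(0, 1)\<close> and \<open>(1, t)\<close>, and also \<open>(1, 0)\<close>, where the span of
  the two leaf lines meets it. The leaf vectors differ by \<open>(1, 0, 0)\<close>, so the scalar
  extends to all of \<open>[0]\<close>.\<close>

lemma V_scalar_5_322:
  assumes D: "D [] = 5" "D [0] = 3" "D [1] = 2" "D [2] = 2"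
    and W: "D [0, 0] = 3" "D [0, 1] = 3" "D [1, 0] = 1" "D [2, 0] = 1" "D [0, 0, 0] = 1" "D [0, 1, 0] = 1"
    and f: "endo False (A4 t) D f"
  shows "V_scalar D f"
proof -
  obtain a00 a01 a02 a10 a11 a12 a20 a21 a22 where a:
    "\<And>x y z. f [0] (vec [x, y, z]) = vec [a00 * x + a01 * y + a02 * z, a10 * x + a11 * y + a12 * z, a20 * x + a21 * y + a22 * z]"
    by (rule endo_matrix3[OF f Adr_singles(1) D(2)]) (rule that)
  obtain b00 b01 b10 b11 where b:
    "\<And>x y. f [1] (vec [x, y]) = vec [b00 * x + b01 * y, b10 * x + b11 * y]"
    by (rule endo_matrix2[OF f Adr_singles(2) D(3)]) (rule that)
  obtain c00 c01 c10 c11 where c: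
    "\<And>x y. f [2] (vec [x, y]) = vec [c00 * x + c01 * y, c10 * x + c11 * y]"
    by (rule endo_matrix2[OF f Adr_singles(3) D(4)]) (rule that)
  have "\<exists>l. f [0] (vec [0, 1, 1]) = kscale l (vec [0, 1, 1])"
    by (rule endo_line[OF f, of 0 0]) (simp_all add: D W line_def wmap_simps algebra_simps t2)
  then obtain l1 where l1: "f [0] (vec [0, 1, 1]) = kscale l1 (vec [0, 1, 1])" ..
  have "\<exists>l. f [0] (vec [1, 1, 1]) = kscale l (vec [1, 1, 1])"
    by (rule endo_line[OF f, of 0 1]) (simp_all add: D W line_def wmap_simps algebra_simps t2)
  then obtain l2 where l2: "f [0] (vec [1, 1, 1]) = kscale l2 (vec [1, 1, 1])" ..
  have k1: "trunc 1 (wmap t 1 0 (f [1] (vec [0, 1]))) = 0"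
    by (rule endo_kernel[OF f, of 1 0, unfolded W]) (simp_all add: D wmap_simps algebra_simps t2)
  have k2: "trunc 1 (wmap t 2 0 (f [2] (vec [1, t]))) = 0"
    by (rule endo_kernel[OF f, of 2 0, unfolded W]) (simp_all add: D wmap_simps algebra_simps t2)
  have r1: "trunc 5 (vmap t 0 (f [0] (vec [1, 0, 0])) + vmap t 1 (f [1] (vec [1, 0])) + vmap t 2 (f [2] (vec [- 1, 0]))) = 0"
    by (rule endo_root_relation[OF f, unfolded D]) (simp_all add: vmap_simps algebra_simps)
  have r2: "trunc 5 (vmap t 0 (f [0] (vec [0, 1, 0])) + vmap t 1 (f [1] (vec [0, 1])) + vmap t 2 (f [2] (vec [0, - 1]))) = 0"
    by (rule endo_root_relation[OF f, unfolded D]) (simp_all add: vmap_simps algebra_simps)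
  note eqs = l1[unfolded a b c] l2[unfolded a b c] k1[unfolded a b c] k2[unfolded a b c] r1[unfolded a b c] r2[unfolded a b c]
  have "a01 = 0 \<and> a02 = 0 \<and> a10 = 0 \<and> a11 = a00 \<and> a12 = 0 \<and> a20 = 0 \<and> a21 = 0 \<and> a22 = a00 \<and> b00 = a00 \<and> b01 = 0 \<and> b10 = 0 \<and> b11 = a00 \<and> c00 = a00 \<and> c01 = 0 \<and> c10 = 0 \<and> c11 = a00"
    using eqs t2 by (simp add: wmap_simps vmap_simps endo_zero[OF f]) (algebra | (clarify, algebra))
  then show ?thesis
    unfolding V_scalar_def
    by (intro exI[of _ a00] allI impI) (auto simp: less_3_iff scalar_at_iff D endo_zero[OF f] a[unfolded vec.simps] b[unfolded vec.simps] c[unfolded vec.simps])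
qed

text \<open>The relations identify \<open>[0]\<close> with \<open>[1]\<close>, and
  \<open>[2]\<close> with the quotient by the line \<open>(0, 0, 1)\<close>. Together with the leaf
  lines \<open>(0, 1, 1)\<close> and \<open>(1, 1, 1)\<close> this gives a basis of eigenvectors.
  Their eigenvalues are equated by two invariant planes: the kernel of the map to
  \<open>[1, 0]\<close> and the preimage of the kernel line at \<open>[2]\<close>.\<close>

lemma V_scalar_5_332a:
  assumes D: "D [] = 5" "D [0] = 3" "D [1] = 3" "D [2] = 2"
    and W: "D [0, 0] = 3" "D [0, 1] = 3" "D [1, 0] = 1" "D [2, 0] = 1" "D [0, 0, 0] = 1" "D [0, 1, 0] = 1"
    and f: "endo False (A4 t) D f"
  shows "V_scalar D f"
proof -
  obtain a00 a01 a02 a10 a11 a12 a20 a21 a22 where a: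
    "\<And>x y z. f [0] (vec [x, y, z]) = vec [a00 * x + a01 * y + a02 * z, a10 * x + a11 * y + a12 * z, a20 * x + a21 * y + a22 * z]"
    by (rule endo_matrix3[OF f Adr_singles(1) D(2)]) (rule that)
  obtain b00 b01 b02 b10 b11 b12 b20 b21 b22 where b:
    "\<And>x y z. f [1] (vec [x, y, z]) = vec [b00 * x + b01 * y + b02 * z, b10 * x + b11 * y + b12 * z, b20 * x + b21 * y + b22 * z]"
    by (rule endo_matrix3[OF f Adr_singles(2) D(3)]) (rule that)
  obtain c00 c01 c10 c11 where c:
    "\<And>x y. f [2] (vec [x, y]) = vec [c00 * x + c01 * y, c10 * x + c11 * y]"
    by (rule endo_matrix2[OF f Adr_singles(3) D(4)]) (rule that)
  have "\<exists>l. f [0] (vec [0, 1, 1]) = kscale l (vec [0, 1, 1])"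
    by (rule endo_line[OF f, of 0 0]) (simp_all add: D W line_def wmap_simps algebra_simps t2)
  then obtain l1 where l1: "f [0] (vec [0, 1, 1]) = kscale l1 (vec [0, 1, 1])" ..
  have "\<exists>l. f [0] (vec [1, 1, 1]) = kscale l (vec [1, 1, 1])"
    by (rule endo_line[OF f, of 0 1]) (simp_all add: D W line_def wmap_simps algebra_simps t2)
  then obtain l2 where l2: "f [0] (vec [1, 1, 1]) = kscale l2 (vec [1, 1, 1])" ..
  have k1: "trunc 1 (wmap t 1 0 (f [1] (vec [0, 1, 0]))) = 0"
    by (rule endo_kernel[OF f, of 1 0, unfolded W]) (simp_all add: D wmap_simps algebra_simps t2)
  have k2: "trunc 1 (wmap t 1 0 (f [1] (vec [1, 0, 1]))) = 0"
    by (rule endo_kernel[OF f, of 1 0, unfolded W]) (simp_all add: D wmap_simps algebra_simps t2)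
  have k3: "trunc 1 (wmap t 2 0 (f [2] (vec [1, t]))) = 0"
    by (rule endo_kernel[OF f, of 2 0, unfolded W]) (simp_all add: D wmap_simps algebra_simps t2)
  have r1: "trunc 5 (vmap t 0 (f [0] (vec [1, 0, 0])) + vmap t 1 (f [1] (vec [1, 0, 0])) + vmap t 2 (f [2] (vec [- 1, 0]))) = 0"
    by (rule endo_root_relation[OF f, unfolded D]) (simp_all add: vmap_simps algebra_simps)
  have r2: "trunc 5 (vmap t 0 (f [0] (vec [0, 1, 0])) + vmap t 1 (f [1] (vec [0, 1, 0])) + vmap t 2 (f [2] (vec [0, - 1]))) = 0"
    by (rule endo_root_relation[OF f, unfolded D]) (simp_all add: vmap_simps algebra_simps)
  have r3: "trunc 5 (vmap t 0 (f [0] (vec [0, 0, 1])) + vmap t 1 (f [1] (vec [0, 0, 1])) + vmap t 2 (f [2] (vec [0, 0]))) = 0"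
    by (rule endo_root_relation[OF f, unfolded D]) (simp_all add: vmap_simps algebra_simps)
  note eqs = l1[unfolded a b c] l2[unfolded a b c] k1[unfolded a b c] k2[unfolded a b c] k3[unfolded a b c] r1[unfolded a b c] r2[unfolded a b c] r3[unfolded a b c]
  have "a01 = 0 \<and> a02 = 0 \<and> a10 = 0 \<and> a11 = a00 \<and> a12 = 0 \<and> a20 = 0 \<and> a21 = 0 \<and> a22 = a00 \<and> b00 = a00 \<and> b01 = 0 \<and> b02 = 0 \<and> b10 = 0 \<and> b11 = a00 \<and> b12 = 0 \<and> b20 = 0 \<and> b21 = 0 \<and> b22 = a00 \<and> c00 = a00 \<and> c01 = 0 \<and> c10 = 0 \<and> c11 = a00"
    using eqs t2 by (simp add: wmap_simps vmap_simps endo_zero[OF f]) (algebra | (clarify, algebra))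
  then show ?thesis
    unfolding V_scalar_def
    by (intro exI[of _ a00] allI impI) (auto simp: less_3_iff scalar_at_iff D endo_zero[OF f] a[unfolded vec.simps] b[unfolded vec.simps] c[unfolded vec.simps])
qed

text \<open>A leaf line replaces the kernel plane: \<open>(1, 1, t)\<close> lies in the span of
  \<open>(1, 1, 1)\<close> and \<open>(0, 0, 1)\<close> and equates their eigenvalues.\<close>

lemma V_scalar_5_332b:
  assumes D: "D [] = 5" "D [0] = 3" "D [1] = 3" "D [2] = 2"
    and W: "D [0, 0] = 3" "D [0, 1] = 3" "D [1, 1] = 3" "D [2, 0] = 1" "D [0, 0, 0] = 1" "D [0, 1, 0] = 1" "D [1, 1, 0] = 1"
    and f: "endo False (A4 t) D f"
  shows "V_scalar D f"
proof -
  obtain a00 a01 a02 a10 a11 a12 a20 a21 a22 where a: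
    "\<And>x y z. f [0] (vec [x, y, z]) = vec [a00 * x + a01 * y + a02 * z, a10 * x + a11 * y + a12 * z, a20 * x + a21 * y + a22 * z]"
    by (rule endo_matrix3[OF f Adr_singles(1) D(2)]) (rule that)
  obtain b00 b01 b02 b10 b11 b12 b20 b21 b22 where b:
    "\<And>x y z. f [1] (vec [x, y, z]) = vec [b00 * x + b01 * y + b02 * z, b10 * x + b11 * y + b12 * z, b20 * x + b21 * y + b22 * z]"
    by (rule endo_matrix3[OF f Adr_singles(2) D(3)]) (rule that)
  obtain c00 c01 c10 c11 where c:
    "\<And>x y. f [2] (vec [x, y]) = vec [c00 * x + c01 * y, c10 * x + c11 * y]"
    by (rule endo_matrix2[OF f Adr_singles(3) D(4)]) (rule that)
  have "\<exists>l. f [0] (vec [0, 1, 1]) = kscale l (vec [0, 1, 1])"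
    by (rule endo_line[OF f, of 0 0]) (simp_all add: D W line_def wmap_simps algebra_simps t2)
  then obtain l1 where l1: "f [0] (vec [0, 1, 1]) = kscale l1 (vec [0, 1, 1])" ..
  have "\<exists>l. f [0] (vec [1, 1, 1]) = kscale l (vec [1, 1, 1])"
    by (rule endo_line[OF f, of 0 1]) (simp_all add: D W line_def wmap_simps algebra_simps t2)
  then obtain l2 where l2: "f [0] (vec [1, 1, 1]) = kscale l2 (vec [1, 1, 1])" ..
  have "\<exists>l. f [1] (vec [1, 1, t]) = kscale l (vec [1, 1, t])"
    by (rule endo_line[OF f, of 1 1]) (simp_all add: D W line_def wmap_simps algebra_simps t2)
  then obtain l3 where l3: "f [1] (vec [1, 1, t]) = kscale l3 (vec [1, 1, t])" ..
  have k1: "trunc 1 (wmap t 2 0 (f [2] (vec [1, t]))) = 0"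
    by (rule endo_kernel[OF f, of 2 0, unfolded W]) (simp_all add: D wmap_simps algebra_simps t2)
  have r1: "trunc 5 (vmap t 0 (f [0] (vec [1, 0, 0])) + vmap t 1 (f [1] (vec [1, 0, 0])) + vmap t 2 (f [2] (vec [- 1, 0]))) = 0"
    by (rule endo_root_relation[OF f, unfolded D]) (simp_all add: vmap_simps algebra_simps)
  have r2: "trunc 5 (vmap t 0 (f [0] (vec [0, 1, 0])) + vmap t 1 (f [1] (vec [0, 1, 0])) + vmap t 2 (f [2] (vec [0, - 1]))) = 0"
    by (rule endo_root_relation[OF f, unfolded D]) (simp_all add: vmap_simps algebra_simps)
  have r3: "trunc 5 (vmap t 0 (f [0] (vec [0, 0, 1])) + vmap t 1 (f [1] (vec [0, 0, 1])) + vmap t 2 (f [2] (vec [0, 0]))) = 0"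
    by (rule endo_root_relation[OF f, unfolded D]) (simp_all add: vmap_simps algebra_simps)
  note eqs = l1[unfolded a b c] l2[unfolded a b c] l3[unfolded a b c] k1[unfolded a b c] r1[unfolded a b c] r2[unfolded a b c] r3[unfolded a b c]
  have "a01 = 0 \<and> a02 = 0 \<and> a10 = 0 \<and> a11 = a00 \<and> a12 = 0 \<and> a20 = 0 \<and> a21 = 0 \<and> a22 = a00 \<and> b00 = a00 \<and> b01 = 0 \<and> b02 = 0 \<and> b10 = 0 \<and> b11 = a00 \<and> b12 = 0 \<and> b20 = 0 \<and> b21 = 0 \<and> b22 = a00 \<and> c00 = a00 \<and> c01 = 0 \<and> c10 = 0 \<and> c11 = a00"
    using eqs t2 by (simp add: wmap_simps vmap_simps endo_zero[OF f]) (algebra | (clarify, algebra))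
  then show ?thesis
    unfolding V_scalar_def
    by (intro exI[of _ a00] allI impI) (auto simp: less_3_iff scalar_at_iff D endo_zero[OF f] a[unfolded vec.simps] b[unfolded vec.simps] c[unfolded vec.simps])
qed

text \<open>Again the relations give one plane common to all neighbours. The spans of the leaf lines
  at \<open>[0]\<close> and at \<open>[1]\<close> meet it in \<open>(1, 0)\<close> and
  \<open>(0, 1)\<close>, and the kernel at \<open>[2]\<close> is \<open>(1, t)\<close>.\<close>

lemma V_scalar_6_332:
  assumes D: "D [] = 6" "D [0] = 3" "D [1] = 3" "D [2] = 2"
    and W: "D [0, 0] = 3" "D [0, 1] = 3" "D [1, 0] = 3" "D [1, 1] = 3" "D [2, 0] = 1" "D [0, 0, 0] = 1" "D [0, 1, 0] = 1" "D [1, 0, 0] = 1" "D [1, 1, 0] = 1"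
    and f: "endo False (A4 t) D f"
  shows "V_scalar D f"
proof -
  obtain a00 a01 a02 a10 a11 a12 a20 a21 a22 where a:
    "\<And>x y z. f [0] (vec [x, y, z]) = vec [a00 * x + a01 * y + a02 * z, a10 * x + a11 * y + a12 * z, a20 * x + a21 * y + a22 * z]"
    by (rule endo_matrix3[OF f Adr_singles(1) D(2)]) (rule that)
  obtain b00 b01 b02 b10 b11 b12 b20 b21 b22 where b:
    "\<And>x y z. f [1] (vec [x, y, z]) = vec [b00 * x + b01 * y + b02 * z, b10 * x + b11 * y + b12 * z, b20 * x + b21 * y + b22 * z]"
    by (rule endo_matrix3[OF f Adr_singles(2) D(3)]) (rule that)
  obtain c00 c01 c10 c11 where c:
    "\<And>x y. f [2] (vec [x, y]) = vec [c00 * x + c01 * y, c10 * x + c11 * y]"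
    by (rule endo_matrix2[OF f Adr_singles(3) D(4)]) (rule that)
  have "\<exists>l. f [0] (vec [0, 1, 1]) = kscale l (vec [0, 1, 1])"
    by (rule endo_line[OF f, of 0 0]) (simp_all add: D W line_def wmap_simps algebra_simps t2)
  then obtain l1 where l1: "f [0] (vec [0, 1, 1]) = kscale l1 (vec [0, 1, 1])" ..
  have "\<exists>l. f [0] (vec [1, 1, 1]) = kscale l (vec [1, 1, 1])"
    by (rule endo_line[OF f, of 0 1]) (simp_all add: D W line_def wmap_simps algebra_simps t2)
  then obtain l2 where l2: "f [0] (vec [1, 1, 1]) = kscale l2 (vec [1, 1, 1])" ..
  have "\<exists>l. f [1] (vec [1, 0, t]) = kscale l (vec [1, 0, t])"
    by (rule endo_line[OF f, of 1 0]) (simp_all add: D W line_def wmap_simps algebra_simps t2)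
  then obtain l3 where l3: "f [1] (vec [1, 0, t]) = kscale l3 (vec [1, 0, t])" ..
  have "\<exists>l. f [1] (vec [1, 1, t]) = kscale l (vec [1, 1, t])"
    by (rule endo_line[OF f, of 1 1]) (simp_all add: D W line_def wmap_simps algebra_simps t2)
  then obtain l4 where l4: "f [1] (vec [1, 1, t]) = kscale l4 (vec [1, 1, t])" ..
  have k1: "trunc 1 (wmap t 2 0 (f [2] (vec [1, t]))) = 0"
    by (rule endo_kernel[OF f, of 2 0, unfolded W]) (simp_all add: D wmap_simps algebra_simps t2)
  have r1: "trunc 6 (vmap t 0 (f [0] (vec [1, 0, 0])) + vmap t 1 (f [1] (vec [1, 0, 0])) + vmap t 2 (f [2] (vec [- 1, 0]))) = 0"
    by (rule endo_root_relation[OF f, unfolded D]) (simp_all add: vmap_simps algebra_simps)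
  have r2: "trunc 6 (vmap t 0 (f [0] (vec [0, 1, 0])) + vmap t 1 (f [1] (vec [0, 1, 0])) + vmap t 2 (f [2] (vec [0, - 1]))) = 0"
    by (rule endo_root_relation[OF f, unfolded D]) (simp_all add: vmap_simps algebra_simps)
  note eqs = l1[unfolded a b c] l2[unfolded a b c] l3[unfolded a b c] l4[unfolded a b c] k1[unfolded a b c] r1[unfolded a b c] r2[unfolded a b c]
  have "a01 = 0 \<and> a02 = 0 \<and> a10 = 0 \<and> a11 = a00 \<and> a12 = 0 \<and> a20 = 0 \<and> a21 = 0 \<and> a22 = a00 \<and> b00 = a00 \<and> b01 = 0 \<and> b02 = 0 \<and> b10 = 0 \<and> b11 = a00 \<and> b12 = 0 \<and> b20 = 0 \<and> b21 = 0 \<and> b22 = a00 \<and> c00 = a00 \<and> c01 = 0 \<and> c10 = 0 \<and> c11 = a00"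
    using eqs t2 by (simp add: wmap_simps vmap_simps endo_zero[OF f]) (algebra | (clarify, algebra))
  then show ?thesis
    unfolding V_scalar_def
    by (intro exI[of _ a00] allI impI) (auto simp: less_3_iff scalar_at_iff D endo_zero[OF f] a[unfolded vec.simps] b[unfolded vec.simps] c[unfolded vec.simps])
qed

text \<open>The relations identify all three neighbours up to sign, and the four leaf lines of
  \<open>[0]\<close> and \<open>[1]\<close> are in general position. This leaves the vertices behind
  \<open>[2]\<close> free to grow.\<close>

lemma V_scalar_6_333:
  assumes D: "D [] = 6" "D [0] = 3" "D [1] = 3" "D [2] = 3"
    and W: "D [0, 0] = 3" "D [0, 1] = 3" "D [1, 0] = 3" "D [1, 1] = 3" "D [0, 0, 0] = 1" "D [0, 1, 0] = 1" "D [1, 0, 0] = 1" "D [1, 1, 0] = 1"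
    and f: "endo False (A4 t) D f"
  shows "V_scalar D f"
proof -
  obtain a00 a01 a02 a10 a11 a12 a20 a21 a22 where a:
    "\<And>x y z. f [0] (vec [x, y, z]) = vec [a00 * x + a01 * y + a02 * z, a10 * x + a11 * y + a12 * z, a20 * x + a21 * y + a22 * z]"
    by (rule endo_matrix3[OF f Adr_singles(1) D(2)]) (rule that)
  obtain b00 b01 b02 b10 b11 b12 b20 b21 b22 where b:
    "\<And>x y z. f [1] (vec [x, y, z]) = vec [b00 * x + b01 * y + b02 * z, b10 * x + b11 * y + b12 * z, b20 * x + b21 * y + b22 * z]"
    by (rule endo_matrix3[OF f Adr_singles(2) D(3)]) (rule that)
  obtain c00 c01 c02 c10 c11 c12 c20 c21 c22 where c:
    "\<And>x y z. f [2] (vec [x, y, z]) = vec [c00 * x + c01 * y + c02 * z, c10 * x + c11 * y + c12 * z, c20 * x + c21 * y + c22 * z]"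
    by (rule endo_matrix3[OF f Adr_singles(3) D(4)]) (rule that)
  have "\<exists>l. f [0] (vec [0, 1, 1]) = kscale l (vec [0, 1, 1])"
    by (rule endo_line[OF f, of 0 0]) (simp_all add: D W line_def wmap_simps algebra_simps t2)
  then obtain l1 where l1: "f [0] (vec [0, 1, 1]) = kscale l1 (vec [0, 1, 1])" ..
  have "\<exists>l. f [0] (vec [1, 1, 1]) = kscale l (vec [1, 1, 1])"
    by (rule endo_line[OF f, of 0 1]) (simp_all add: D W line_def wmap_simps algebra_simps t2)
  then obtain l2 where l2: "f [0] (vec [1, 1, 1]) = kscale l2 (vec [1, 1, 1])" ..
  have "\<exists>l. f [1] (vec [1, 0, t]) = kscale l (vec [1, 0, t])"
    by (rule endo_line[OF f, of 1 0]) (simp_all add: D W line_def wmap_simps algebra_simps t2)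
  then obtain l3 where l3: "f [1] (vec [1, 0, t]) = kscale l3 (vec [1, 0, t])" ..
  have "\<exists>l. f [1] (vec [1, 1, t]) = kscale l (vec [1, 1, t])"
    by (rule endo_line[OF f, of 1 1]) (simp_all add: D W line_def wmap_simps algebra_simps t2)
  then obtain l4 where l4: "f [1] (vec [1, 1, t]) = kscale l4 (vec [1, 1, t])" ..
  have r1: "trunc 6 (vmap t 0 (f [0] (vec [1, 0, 0])) + vmap t 1 (f [1] (vec [1, 0, 0])) + vmap t 2 (f [2] (vec [- 1, 0, 0]))) = 0"
    by (rule endo_root_relation[OF f, unfolded D]) (simp_all add: vmap_simps algebra_simps)
  have r2: "trunc 6 (vmap t 0 (f [0] (vec [0, 1, 0])) + vmap t 1 (f [1] (vec [0, 1, 0])) + vmap t 2 (f [2] (vec [0, - 1, 0]))) = 0"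
    by (rule endo_root_relation[OF f, unfolded D]) (simp_all add: vmap_simps algebra_simps)
  have r3: "trunc 6 (vmap t 0 (f [0] (vec [0, 0, 1])) + vmap t 1 (f [1] (vec [0, 0, 1])) + vmap t 2 (f [2] (vec [0, 0, - 1]))) = 0"
    by (rule endo_root_relation[OF f, unfolded D]) (simp_all add: vmap_simps algebra_simps)
  note eqs = l1[unfolded a b c] l2[unfolded a b c] l3[unfolded a b c] l4[unfolded a b c] r1[unfolded a b c] r2[unfolded a b c] r3[unfolded a b c]
  have "a01 = 0 \<and> a02 = 0 \<and> a10 = 0 \<and> a11 = a00 \<and> a12 = 0 \<and> a20 = 0 \<and> a21 = 0 \<and> a22 = a00 \<and> b00 = a00 \<and> b01 = 0 \<and> b02 = 0 \<and> b10 = 0 \<and> b11 = a00 \<and> b12 = 0 \<and> b20 = 0 \<and> b21 = 0 \<and> b22 = a00 \<and> c00 = a00 \<and> c01 = 0 \<and> c02 = 0 \<and> c10 = 0 \<and> c11 = a00 \<and> c12 = 0 \<and> c20 = 0 \<and> c21 = 0 \<and> c22 = a00"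
    using eqs t2 by (simp add: wmap_simps vmap_simps endo_zero[OF f]) (algebra | (clarify, algebra))
  then show ?thesis
    unfolding V_scalar_def
    by (intro exI[of _ a00] allI impI) (auto simp: less_3_iff scalar_at_iff D endo_zero[OF f] a[unfolded vec.simps] b[unfolded vec.simps] c[unfolded vec.simps])
qed

text \<open>The common plane of the relations meets the spans of the three pairs of leaf lines in
  \<open>(1, 0)\<close>, \<open>(0, 1)\<close> and \<open>(1, 1)\<close>. The lines are an
  assumption because they arise differently for \<open>[i, j]\<close> of dimension 3 and 4.\<close>

lemma V_scalar_7_333:
  assumes D: "D [] = 7" "D [0] = 3" "D [1] = 3" "D [2] = 3"
    and lines: "\<And>i j. i < 3 \<Longrightarrow> j < 2 \<Longrightarrow> \<exists>l. f [i] (line t i j) = kscale l (line t i j)"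
    and f: "endo False (A4 t) D f"
  shows "V_scalar D f"
proof -
  obtain a00 a01 a02 a10 a11 a12 a20 a21 a22 where a:
    "\<And>x y z. f [0] (vec [x, y, z]) = vec [a00 * x + a01 * y + a02 * z, a10 * x + a11 * y + a12 * z, a20 * x + a21 * y + a22 * z]"
    by (rule endo_matrix3[OF f Adr_singles(1) D(2)]) (rule that)
  obtain b00 b01 b02 b10 b11 b12 b20 b21 b22 where b:
    "\<And>x y z. f [1] (vec [x, y, z]) = vec [b00 * x + b01 * y + b02 * z, b10 * x + b11 * y + b12 * z, b20 * x + b21 * y + b22 * z]"
    by (rule endo_matrix3[OF f Adr_singles(2) D(3)]) (rule that)
  obtain c00 c01 c02 c10 c11 c12 c20 c21 c22 where c:
    "\<And>x y z. f [2] (vec [x, y, z]) = vec [c00 * x + c01 * y + c02 * z, c10 * x + c11 * y + c12 * z, c20 * x + c21 * y + c22 * z]"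
    by (rule endo_matrix3[OF f Adr_singles(3) D(4)]) (rule that)
  obtain l1 where l1: "f [0] (vec [0, 1, 1]) = kscale l1 (vec [0, 1, 1])"
    using lines[of 0 0] by (auto simp: line_def)
  obtain l2 where l2: "f [0] (vec [1, 1, 1]) = kscale l2 (vec [1, 1, 1])"
    using lines[of 0 1] by (auto simp: line_def)
  obtain l3 where l3: "f [1] (vec [1, 0, t]) = kscale l3 (vec [1, 0, t])"
    using lines[of 1 0] by (auto simp: line_def)
  obtain l4 where l4: "f [1] (vec [1, 1, t]) = kscale l4 (vec [1, 1, t])"
    using lines[of 1 1] by (auto simp: line_def)
  obtain l5 where l5: "f [2] (vec [0, 0, 1]) = kscale l5 (vec [0, 0, 1])"
    using lines[of 2 0] by (auto simp: line_def)
  obtain l6 where l6: "f [2] (vec [1, 1, 1]) = kscale l6 (vec [1, 1, 1])"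
    using lines[of 2 1] by (auto simp: line_def)
  have r1: "trunc 7 (vmap t 0 (f [0] (vec [1, 0, 0])) + vmap t 1 (f [1] (vec [1, 0, 0])) + vmap t 2 (f [2] (vec [- 1, 0, 0]))) = 0"
    by (rule endo_root_relation[OF f, unfolded D]) (simp_all add: vmap_simps algebra_simps)
  have r2: "trunc 7 (vmap t 0 (f [0] (vec [0, 1, 0])) + vmap t 1 (f [1] (vec [0, 1, 0])) + vmap t 2 (f [2] (vec [0, - 1, 0]))) = 0"
    by (rule endo_root_relation[OF f, unfolded D]) (simp_all add: vmap_simps algebra_simps)
  note eqs = l1[unfolded a b c] l2[unfolded a b c] l3[unfolded a b c] l4[unfolded a b c] l5[unfolded a b c] l6[unfolded a b c] r1[unfolded a b c] r2[unfolded a b c]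
  have "a01 = 0 \<and> a02 = 0 \<and> a10 = 0 \<and> a11 = a00 \<and> a12 = 0 \<and> a20 = 0 \<and> a21 = 0 \<and> a22 = a00 \<and> b00 = a00 \<and> b01 = 0 \<and> b02 = 0 \<and> b10 = 0 \<and> b11 = a00 \<and> b12 = 0 \<and> b20 = 0 \<and> b21 = 0 \<and> b22 = a00 \<and> c00 = a00 \<and> c01 = 0 \<and> c02 = 0 \<and> c10 = 0 \<and> c11 = a00 \<and> c12 = 0 \<and> c20 = 0 \<and> c21 = 0 \<and> c22 = a00"
    using eqs t2 by (simp add: wmap_simps vmap_simps endo_zero[OF f]) (algebra | (clarify, algebra))
  then show ?thesis
    unfolding V_scalar_def
    by (intro exI[of _ a00] allI impI) (auto simp: less_3_iff scalar_at_iff D endo_zero[OF f] a[unfolded vec.simps] b[unfolded vec.simps] c[unfolded vec.simps])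
qed

end

section \<open>From the neighbours of the root to the whole tree\<close>

lemma all_less_2: "(\<forall>i<2::nat. P i) \<longleftrightarrow> P 0 \<and> P 1"
  by (auto simp: less_2_iff)

lemma all_less_3: "(\<forall>i<3::nat. P i) \<longleftrightarrow> P 0 \<and> P 1 \<and> P 2"
  by (auto simp: less_3_iff)

lemma Adr_cases:
  assumes "p \<in> Adr"
  obtains "p = []" | i where "p = [i]" "i < 3" | i j where "p = [i, j]" "i < 3" "j < 2"
    | i j k where "p = [i, j, k]" "i < 3" "j < 2" "k < 2"
    | i j k h where "p = [i, j, k, h]" "i < 3" "j < 2" "k < 2" "h < 2"
    | "length p > 4"
proof -
  consider "p = []" | i where "p = [i]" | i j where "p = [i, j]" | i j k where "p = [i, j, k]"
    | i j k h where "p = [i, j, k, h]" | i j k h l r where "p = i # j # k # h # l # r"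
    by (metis list.exhaust)
  then show ?thesis using assms that by cases auto
qed

lemma vec_in_kn: "length xs \<le> n \<Longrightarrow> vec xs \<in> kn n"
proof (induction xs arbitrary: n)
  case (Cons x xs)
  then show ?case by (cases n) auto
qed simp

text \<open>Conditions that let a scalar spread outwards: the map to \<open>[i, j]\<close> is onto
  or, in dimension 4, is complemented by the leaves; the maps from the leaves are injective; the
  maps to the outer sinks are onto.\<close>

definition shape :: "(nat list \<Rightarrow> nat) \<Rightarrow> bool" where
  "shape D \<longleftrightarrow>
     (\<forall>i<3. D [i] \<le> 3 \<and> (\<forall>j<2.
        (D [i, j] \<le> D [i] \<or> D [i, j] = 4 \<and> D [i] = 3 \<and> D [i, j, 0] = 1 \<and> D [i, j, 1] = 1) \<and>
        (\<forall>k<2. D [i, j, k] \<le> 1 \<and> D [i, j, k] \<le> D [i, j] \<and> (\<forall>h<2. D [i, j, k, h] \<le> D [i, j, k])))) \<and>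
     (\<forall>p\<in>Adr. length p > 4 \<longrightarrow> D p = 0)"

definition root_surj :: "'k::field \<Rightarrow> (nat list \<Rightarrow> nat) \<Rightarrow> bool" where
  "root_surj t D \<longleftrightarrow> (\<forall>y\<in>kn (D []). \<exists>xs ys zs. length xs \<le> D [0] \<and> length ys \<le> D [1] \<and> length zs \<le> D [2] \<and>
     y = trunc (D []) (vmap t 0 (vec xs) + vmap t 1 (vec ys) + vmap t 2 (vec zs)))"

section \<open>The neighbours of the root span it\<close>

lemma root_surj_2:
  assumes "D [] \<le> D [0]" "D [0] \<le> 2"
  shows "root_surj t D"
proof -
  have "\<exists>xs. length xs \<le> D [0] \<and> y = trunc (D []) (vmap t 0 (vec xs) + vmap t 1 (vec []) + vmap t 2 (vec []))"
    if y: "y \<in> kn (D [])" for y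
  proof -
    consider "D [] = 0" | "D [] = 1" | "D [] = 2" using assms by linarith
    then show ?thesis
    proof cases
      case 1
      then show ?thesis using y by (intro exI[of _ "[]"]) simp
    next
      case 2
      then show ?thesis using y assms by (intro exI[of _ "[y 0]"]) (auto simp: vmap_simps kn_1_iff)
    next
      case 3
      then obtain a c where "y = vcons a (vcons c 0)" using y by (auto elim!: kn_SucE simp: numeral_2_eq_2)
      then show ?thesis using 3 assms by (intro exI[of _ "[a, c]"]) (auto simp: vmap_simps)
    qed
  qed
  then show ?thesis unfolding root_surj_def by (metis le0 list.size(3))
qed

lemma root_surj_3_211:
  assumes "D [] = 3" "D [0] = 2" "D [1] = 1"
  shows "root_surj t D"
  unfolding root_surj_def assms Ball_kn_numeral pred_numeral_simps Ball_kn
proof (simp, intro allI)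
  fix a c d :: 'a
  show "\<exists>xs. length xs \<le> 2 \<and> (\<exists>ys. length ys \<le> 1 \<and> (\<exists>zs. length zs \<le> D [2] \<and>
     vcons a (vcons c (vcons d 0)) = trunc 3 (vmap t 0 (vec xs) + vmap t 1 (vec ys) + vmap t 2 (vec zs))))"
    by (rule exI[of _ "[a - t * d, c]"], simp, rule exI[of _ "[d]"], simp, rule exI[of _ "[]"]) (simp add: vmap_simps)
qed

lemma root_surj_3:
  assumes "D [] = 3" "D [0] = 3"
  shows "root_surj t D"
  unfolding root_surj_def assms Ball_kn_numeral pred_numeral_simps Ball_kn
proof (simp, intro allI)
  fix a c d :: 'a
  show "\<exists>xs. length xs \<le> 3 \<and> (\<exists>ys. length ys \<le> D [1] \<and> (\<exists>zs. length zs \<le> D [2] \<and>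
     vcons a (vcons c (vcons d 0)) = trunc 3 (vmap t 0 (vec xs) + vmap t 1 (vec ys) + vmap t 2 (vec zs))))"
    by (rule exI[of _ "[a - t * d, c, d]"], simp, rule exI[of _ "[]"], simp, rule exI[of _ "[]"]) (simp add: vmap_simps)
qed

lemma root_surj_4:
  assumes "D [] = 4" "D [0] = 3" "D [1] = 2"
  shows "root_surj t D"
  unfolding root_surj_def assms Ball_kn_numeral pred_numeral_simps Ball_kn
proof (simp, intro allI)
  fix a c d u :: 'a
  show "\<exists>xs. length xs \<le> 3 \<and> (\<exists>ys. length ys \<le> 2 \<and> (\<exists>zs. length zs \<le> D [2] \<and>
     vcons a (vcons c (vcons d (vcons u 0))) = trunc 4 (vmap t 0 (vec xs) + vmap t 1 (vec ys) + vmap t 2 (vec zs))))"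
    by (rule exI[of _ "[a - t * d - u, c + u, d]"], simp, rule exI[of _ "[0, u]"], simp, rule exI[of _ "[]"])
      (simp add: vmap_simps algebra_simps)
qed

lemma root_surj_5:
  assumes "D [] = 5" "D [0] = 3" "D [1] \<ge> 2"
  shows "root_surj t D"
  unfolding root_surj_def assms Ball_kn_numeral pred_numeral_simps Ball_kn
proof (simp, intro allI)
  fix a c d u v :: 'a
  show "\<exists>xs. length xs \<le> 3 \<and> (\<exists>ys. length ys \<le> D [1] \<and> (\<exists>zs. length zs \<le> D [2] \<and>
     vcons a (vcons c (vcons d (vcons u (vcons v 0)))) =
       trunc 5 (vmap t 0 (vec xs) + vmap t 1 (vec ys) + vmap t 2 (vec zs))))"
    by (rule exI[of _ "[a - t * d - u, c + u, d + v]"], simp, rule exI[of _ "[- v, u]"],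
        simp add: assms(3)[unfolded numeral_2_eq_2],
        rule exI[of _ "[]"]) (simp add: vmap_simps algebra_simps)
qed

lemma root_surj_6:
  assumes "D [] = 6" "D [0] = 3" "D [1] = 3"
  shows "root_surj t D"
  unfolding root_surj_def assms Ball_kn_numeral pred_numeral_simps Ball_kn
proof (simp, intro allI)
  fix a c d u v x :: 'a
  show "\<exists>xs. length xs \<le> 3 \<and> (\<exists>ys. length ys \<le> 3 \<and> (\<exists>zs. length zs \<le> D [2] \<and>
     vcons a (vcons c (vcons d (vcons u (vcons v (vcons x 0))))) =
       trunc 6 (vmap t 0 (vec xs) + vmap t 1 (vec ys) + vmap t 2 (vec zs))))"
    by (rule exI[of _ "[a - t * d - u, c + u, d + v + x]"], simp, rule exI[of _ "[- v, u, x]"], simp,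
        rule exI[of _ "[]"]) (simp add: vmap_simps algebra_simps)
qed

lemma root_surj_7:
  assumes "D [] = 7" "D [0] = 3" "D [1] = 3" "D [2] = 3"
  shows "root_surj t D"
  unfolding root_surj_def assms Ball_kn_numeral pred_numeral_simps Ball_kn
proof (simp, intro allI)
  fix a c d u v x y :: 'a
  show "\<exists>xs. length xs \<le> 3 \<and> (\<exists>ys. length ys \<le> 3 \<and> (\<exists>zs. length zs \<le> 3 \<and>
     vcons a (vcons c (vcons d (vcons u (vcons v (vcons x (vcons y 0)))))) =
       trunc 7 (vmap t 0 (vec xs) + vmap t 1 (vec ys) + vmap t 2 (vec zs))))"
    \<comment> \<open>Back substitution: coordinate 6 determines the entry at \<open>[2]\<close>,
      coordinates 3 to 5 those at \<open>[1]\<close>, and coordinates 0 to 2 those at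
      \<open>[0]\<close>.\<close>
    by (rule exI[of _ "[a - t * d - u, c + u, d + v + x - y]"], simp, rule exI[of _ "[- v, u, x - y]"], simp,
        rule exI[of _ "[0, 0, y]"]) (simp add: vmap_simps algebra_simps)
qed

context
  fixes t :: "'k::field"
  assumes t2: "t * t = t + 1"
begin

text \<open>For \<open>t = 2\<close> the equation of \<open>t\<close> would read 4 = 3, which is
  false in every characteristic.\<close>

lemma t_neq_2: "t - 1 - 1 \<noteq> 0" "t - 2 \<noteq> 0"
proof -
  show "t - 1 - 1 \<noteq> 0"
  proof
    assume "t - 1 - 1 = 0"
    then have "t = 1 + 1" by (simp add: algebra_simps)
    then have "(1 + 1) * (1 + 1) = (1 + 1) + (1 :: 'k)" using t2 by metis
    then have "1 + 1 = (1 :: 'k)" by (simp only: distrib_left mult_1_right add_left_cancel)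
    then show False by (metis add_cancel_right_right one_neq_zero)
  qed
  then show "t - 2 \<noteq> 0" by (simp add: diff_diff_eq)
qed

text \<open>All leading minors of the six matrices are nonzero, so the first \<open>n\<close>
  coordinates already suffice to reach \<open>kn n\<close>.\<close>

lemma wmap_surj:
  assumes ij: "i < 3" "j < 2" and n: "n \<le> m" "m \<le> 3" and y: "y \<in> kn n"
  shows "\<exists>x\<in>kn m. y = trunc n (wmap t i j x)"
proof -
  note t0 = t_neq[OF t2]
  \<comment> \<open>The entry in the upper left corner, which is \<open>t\<close> for two of the six
    matrices.\<close>
  let ?c = "if i = 0 \<and> j = 1 \<or> i = 2 \<and> j = 0 then t else 1"
  \<comment> \<open>The inverse matrix applied to \<open>y\<close>. It also serves dimension 2,
    where \<open>y 2\<close> is zero.\<close>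
  let ?x = "if i = 0 \<and> j = 0 then vec [y 1, y 1 + t * y 2 - y 0, y 2]
    else if i = 0 then vec [y 1 + t * y 2, t * (y 1 + t * y 2) - y 0 - y 2, y 2]
    else if j = 0 then (if i = 1 then vec [y 0 + y 2, y 1, y 2] else vec [y 1, t * y 1 + y 2 - y 0, y 2])
    else vec [y 0, y 1, y 2]"
  consider "n = 0" | "n = 1" | "n = 2" | "n = 3" using n by linarith
  then have "\<exists>x\<in>kn n. y = trunc n (wmap t i j x)"
  proof cases
    case 1
    then show ?thesis using y by simp
  next
    case 2
    then obtain a where "y = vcons a 0" using y by (auto simp: kn_1_iff)
    then show ?thesis
      using 2 ij t0 by (intro bexI[of _ "vec [a / ?c]"]) (auto simp: less_2_iff less_3_iff wmap_simps)
  next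
    case 3
    then obtain a c where "y = vcons a (vcons c 0)" using y by (auto elim!: kn_SucE simp: numeral_2_eq_2)
    then show ?thesis
      using 3 ij by (intro bexI[of _ ?x]) (auto simp: less_2_iff less_3_iff wmap_simps algebra_simps)
  next
    case 4
    then obtain a c d where "y = vcons a (vcons c (vcons d 0))"
      using y by (auto elim!: kn_SucE simp: numeral_3_eq_3)
    then show ?thesis
      using 4 ij by (intro bexI[of _ ?x]) (auto simp: less_2_iff less_3_iff wmap_simps algebra_simps)
  qed
  then show ?thesis using kn_mono[OF n(1)] by blast
qed

lemma wmap_inj:
  assumes ij: "i < 3" "j < 2" and n: "m \<le> n" "m \<le> 3" and x: "x \<in> kn m" "trunc n (wmap t i j x) = 0"
  shows "x = 0"
proof -
  note t0 = t_neq[OF t2]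
  have 0: "trunc m (wmap t i j x) = 0" using x(2) trunc_trunc[OF n(1), of "wmap t i j x"] by simp
  consider "m = 0" | "m = 1" | "m = 2" | "m = 3" using n by linarith
  then show ?thesis
  proof cases
    case 1
    then show ?thesis using x by simp
  next
    case 2
    then obtain a where a: "x = vcons a 0" using x by (auto simp: kn_1_iff)
    show ?thesis using 0 ij t0 unfolding 2 a less_2_iff less_3_iff by (elim disjE) (auto simp: wmap_simps)
  next
    case 3
    then obtain a c where a: "x = vcons a (vcons c 0)" using x by (auto elim!: kn_SucE simp: numeral_2_eq_2)
    show ?thesis using 0 ij t0 unfolding 3 a less_2_iff less_3_iff by (elim disjE) (auto simp: wmap_simps)
  next
    case 4
    then obtain a c d where a: "x = vcons a (vcons c (vcons d 0))"
      using x by (auto elim!: kn_SucE simp: numeral_3_eq_3)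
    show ?thesis using 0 ij t0 unfolding 4 a less_2_iff less_3_iff by (elim disjE) (auto simp: wmap_simps)
  qed
qed

text \<open>Coordinate 0 of the image of \<open>line t i j\<close> is one of 1,
  \<open>t - 1\<close>, \<open>1 - t\<close> and \<open>t - 2\<close>, so the leaf survives every
  truncation of \<open>[i, j]\<close> to a positive dimension.\<close>

lemma A4_leaf_inj:
  assumes ijk: "i < 3" "j < 2" and n: "n \<ge> 1" and x: "x \<in> kn 1" "trunc n (A4 t [i, j, k] x) = 0"
  shows "x = 0"
proof -
  note t0 = t_neq[OF t2] t_neq_2
  obtain a where a: "x = vcons a 0" using x by (auto simp: kn_1_iff)
  have "A4 t [i, j, k] x 0 = trunc n (A4 t [i, j, k] x) 0" using n by (simp add: trunc_def)
  then have 0: "A4 t [i, j, k] x 0 = 0" using x(2) by simp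
  have "a * ((if k = 0 then t else t - 1) * wmap t i j (line t i j) 0) = 0"
    using 0 a by (simp add: A4_simps kscale_def)
  moreover have "wmap t i j (line t i j) 0 \<noteq> 0"
    using ijk t0 by (auto simp: less_2_iff less_3_iff wmap_simps line_def algebra_simps)
  ultimately show ?thesis using a t0 by (auto split: if_splits)
qed

text \<open>Both leaf images \<open>l0\<close> and \<open>l1\<close> are eigenvectors of
  \<open>f [i, j]\<close>. Their difference is the image of \<open>line t i j\<close> and has
  coordinate 3 equal to zero; as this is also true of its image under \<open>f [i, j]\<close>, the
  two eigenvalues agree.\<close>

lemma endo_line4:
  assumes f: "endo False (A4 t) D f" and ij: "i < 3" "j < 2"
    and D: "D [i, j] = 4" "D [i] = 3" "D [i, j, 0] = 1" "D [i, j, 1] = 1"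
  obtains l where "f [i] (line t i j) = kscale l (line t i j)" "f [i, j, 0] (vec [1]) = vec [l]"
proof -
  let ?W = "wmap t i j" and ?v = "line t i j"
  have lin: "linear_on kscale kscale UNIV ?W"
    using all_linear_A4[of t] A4_simps(2)[of t i j] unfolding all_linear_def by (metis ext)
  note fW = endoD(1)[OF f, of "[i, j]"]
  define l0 where "l0 = A4 t [i, j, 0] (vec [1])"
  define l1 where "l1 = A4 t [i, j, 1] (vec [1])"
  have W3: "?W x \<in> kn 3" for x
    using ij by (auto simp: less_2_iff less_3_iff wmap_simps)
  then have W4: "?W x \<in> kn 4" for x using kn_mono[of 3 4] by auto
  have W_3: "?W x 3 = 0" for x using W3[of x] by (simp add: kn_def)
  have v: "?v \<in> kn 3" using ij by (auto simp: less_2_iff less_3_iff line_def)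
  have l0_eq: "l0 = kscale t (?W ?v) + vec [0, 0, 0, 1]" and l1_eq: "l1 = kscale (t - 1) (?W ?v) + vec [0, 0, 0, 1]"
    by (simp_all add: l0_def l1_def A4_simps)
  have lk: "l0 \<in> kn 4" "l1 \<in> kn 4"
    unfolding l0_eq l1_eq using W4 by (auto intro!: kvec.subspace_add kvec.subspace_scale)
  obtain a where a: "f [i, j, 0] (vec [1]) = vec [a]"
    using endoD(2)[OF f, of "[i, j, 0]" "vec [1]"] D ij by (auto simp: kn_1_iff)
  obtain c where c: "f [i, j, 1] (vec [1]) = vec [c]"
    using endoD(2)[OF f, of "[i, j, 1]" "vec [1]"] D ij by (auto simp: kn_1_iff)
  have A_scale: "A4 t [i, j, k] (vec [d]) = kscale d (A4 t [i, j, k] (vec [1]))" for k d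
    by (simp add: A4_simps)
  have "f [i, j] (trunc 4 l0) = trunc 4 (A4 t [i, j, 0] (vec [a]))"
    using endo_commute[OF f, of "[i, j, 0]" "vec [1]"] ij D a unfolding l0_def
    by (simp add: src_def snk_def)
  then have f0: "f [i, j] l0 = kscale a l0"
    unfolding A_scale[of 0 a] l0_def[symmetric] using lk by (simp add: trunc_scale)
  have "f [i, j] (trunc 4 l1) = trunc 4 (A4 t [i, j, 1] (vec [c]))"
    using endo_commute[OF f, of "[i, j, 1]" "vec [1]"] ij D c unfolding l1_def
    by (simp add: src_def snk_def)
  then have f1: "f [i, j] l1 = kscale c l1"
    unfolding A_scale[of 1 c] l1_def[symmetric] using lk by (simp add: trunc_scale)
  have fv: "f [i, j] (?W ?v) = ?W (f [i] ?v)"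
    using endo_W[OF f ij, of ?v] v D W4 by simp
  have diff: "?W ?v = l0 - l1"
    by (simp add: l0_eq l1_eq kvec.scale_left_diff_distrib)
  have "f [i, j] (?W ?v) = kscale a l0 - kscale c l1"
    unfolding diff using kvec_linear_on_diff[OF fW, of l0 l1] f0 f1 lk ij D by simp
  then have eq: "?W (f [i] ?v) = kscale a l0 - kscale c l1" using fv by simp
  \<comment> \<open>Both leaf images have entry 1 in coordinate 3, while images under
    \<open>?W\<close> have entry 0.\<close>
  have "kscale a l0 3 - kscale c l1 3 = 0" using eq W_3[of "f [i] ?v"] by (metis fun_diff_def)
  then have "a = c" by (simp add: kscale_def l0_eq l1_eq W_3)
  then have "?W (f [i] ?v) = kscale a (?W ?v)"
    using eq diff by (simp add: kvec.scale_right_diff_distrib)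
  also have "\<dots> = ?W (kscale a ?v)" using linear_on_scale[OF lin] by simp
  finally have "?W (f [i] ?v) = ?W (kscale a ?v)" .
  moreover have "?W (f [i] ?v) = ?W (f [i] ?v - kscale a ?v) + ?W (kscale a ?v)"
    using linear_on_add[OF lin, of "f [i] ?v - kscale a ?v" "kscale a ?v"] by simp
  ultimately have "?W (f [i] ?v - kscale a ?v) = 0" by simp
  then have "f [i] ?v - kscale a ?v = 0"
    using wmap_inj[OF ij, of 3 3 "f [i] ?v - kscale a ?v"] endoD(2)[OF f, of "[i]" ?v] v ij D
    by (simp add: kvec.subspace_diff kvec.subspace_scale)
  then show ?thesis using that[of a] a by simp
qed

text \<open>In dimension 4 the map from \<open>[i]\<close> only reaches the first three coordinates;
  the image \<open>l0\<close> of a leaf, with last entry 1, spans the rest.\<close>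

lemma scalar_at_W:
  assumes f: "endo False (A4 t) D f" and ij: "i < 3" "j < 2" and sc: "scalar_at D f c [i]"
    and D: "D [i] \<le> 3" "D [i, j] \<le> D [i] \<or> D [i, j] = 4 \<and> D [i] = 3 \<and> D [i, j, 0] = 1 \<and> D [i, j, 1] = 1"
  shows "scalar_at D f c [i, j]"
  using D(2)
proof
  assume le: "D [i, j] \<le> D [i]"
  have ends: "src False [i, j] = [i]" "snk False [i, j] = [i, j]" by (simp_all add: src_def snk_def)
  have surj: "\<exists>x\<in>kn (D [i]). y = trunc (D [i, j]) (A4 t [i, j] x)" if "y \<in> kn (D [i, j])" for y
    unfolding A4_simps by (rule wmap_surj[OF ij le D(1) that])
  show ?thesis
    by (rule scalar_at_sink[OF all_linear_A4 f, of "[i, j]" "[i, j]" c]) (use ij sc ends surj in simp_all)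
next
  assume D4: "D [i, j] = 4 \<and> D [i] = 3 \<and> D [i, j, 0] = 1 \<and> D [i, j, 1] = 1"
  let ?W = "wmap t i j" and ?v = "line t i j"
  obtain l where l: "f [i] ?v = kscale l ?v" "f [i, j, 0] (vec [1]) = vec [l]"
    using endo_line4[OF f ij] D4 by blast
  have v: "?v \<in> kn 3" "?v \<noteq> 0" using ij by (auto simp: less_2_iff less_3_iff line_def)
  then have "kscale l ?v = kscale c ?v" using l(1) sc D4 unfolding scalar_at_def by metis
  then have lc: "l = c" using v(2) by simp
  define l0 where "l0 = A4 t [i, j, 0] (vec [1])"
  have W4: "?W x \<in> kn 4" for x
    using ij by (auto simp: less_2_iff less_3_iff wmap_simps)
  have l0_eq: "l0 = kscale t (?W ?v) + vec [0, 0, 0, 1]"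
    by (simp add: l0_def A4_simps)
  have lk: "l0 \<in> kn 4"
    unfolding l0_eq using W4 by (auto intro!: kvec.subspace_add kvec.subspace_scale)
  have f0: "f [i, j] l0 = kscale c l0"
    using endo_commute[OF f, of "[i, j, 0]" "vec [1]"] ij D4 l(2) lk lc
    by (simp add: src_def snk_def l0_def A4_simps trunc_scale kvec.subspace_scale)
  have lin: "linear_on kscale kscale UNIV ?W"
    using all_linear_A4[of t] A4_simps(2)[of t i j] unfolding all_linear_def by (metis ext)
  have fWx: "f [i, j] (?W x) = kscale c (?W x)" if x: "x \<in> kn 3" for x
  proof -
    have "f [i] x = kscale c x" using sc D4 x unfolding scalar_at_def by metis
    then show ?thesis using endo_W[OF f ij, of x] x D4 W4 linear_on_scale[OF lin, of x c]
      by (simp add: trunc_scale)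
  qed
  note fW = endoD(1)[OF f, of "[i, j]"]
  show ?thesis
    unfolding scalar_at_def
  proof
    fix y :: "nat \<Rightarrow> 'k" assume "y \<in> kn (D [i, j])"
    then have y: "y \<in> kn 4" using D4 by simp
    let ?z = "y - kscale (y 3) l0"
    have "l0 3 = 1"
      using ij by (auto simp: l0_eq less_2_iff less_3_iff wmap_simps kscale_def)
    then have "?z n = 0" if "n \<ge> 3" for n
    proof (cases "n = 3")
      case True
      then show ?thesis using \<open>l0 3 = 1\<close> by (simp add: kscale_def)
    next
      case False
      then have "n \<ge> 4" using that by simp
      then have "y n = 0" "l0 n = 0" using y lk unfolding kn_def by blast+
      then show ?thesis by (simp add: kscale_def)
    qed
    then have z: "?z \<in> kn 3" unfolding kn_def by blast
    obtain x where x: "x \<in> kn 3" "?z = ?W x"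
    proof -
      obtain x where "x \<in> kn 3" "?z = trunc 3 (?W x)" using wmap_surj[OF ij order_refl order_refl z] by blast
      moreover have "?W x \<in> kn 3" using ij by (auto simp: less_2_iff less_3_iff wmap_simps)
      ultimately show ?thesis using that by simp
    qed
    have y_eq: "y = ?W x + kscale (y 3) l0" using x(2) by (simp add: algebra_simps)
    have "f [i, j] y = f [i, j] (?W x) + f [i, j] (kscale (y 3) l0)"
      by (subst y_eq, rule linear_on_add[OF fW]) (use ij D4 W4 lk in \<open>auto intro: kvec.subspace_scale\<close>)
    also have "f [i, j] (kscale (y 3) l0) = kscale (y 3) (kscale c l0)"
      using linear_on_scale[OF fW, of l0 "y 3"] f0 lk ij D4 by simp
    also have "f [i, j] (?W x) + kscale (y 3) (kscale c l0) = kscale c (?W x + kscale (y 3) l0)"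
      using fWx[OF x(1)] by (simp add: kvec.scale_right_distrib mult.commute)
    finally show "f [i, j] y = kscale c y" using y_eq by simp
  qed
qed

text \<open>The scalar passes from \<open>[i]\<close> to \<open>[i, j]\<close> and to the root by
  surjectivity, from there to the leaves by injectivity, and on to the outer sinks by
  surjectivity.\<close>

lemma brick_from_V:
  assumes D: "shape D" "root_surj t D" and V: "\<And>f. endo False (A4 t) D f \<Longrightarrow> V_scalar D f"
  shows "brick_dims False (A4 t) D"
  unfolding brick_dims_def
proof (intro allI impI)
  fix f assume f: "endo False (A4 t) D f"
  obtain c where c: "\<And>i. i < 3 \<Longrightarrow> scalar_at D f c [i]"
    using V[OF f] unfolding V_scalar_def by blast
  note sh = D(1)[unfolded shape_def]
  have W: "scalar_at D f c [i, j]" if "i < 3" "j < 2" for i j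
    using scalar_at_W[OF f that c[OF that(1)]] sh that by blast
  have L: "scalar_at D f c [i, j, k]" if ijk: "i < 3" "j < 2" "k < 2" for i j k
  proof -
    have le: "D [i, j, k] \<le> 1" "D [i, j, k] \<le> D [i, j]" using sh ijk by auto
    show ?thesis
      by (rule scalar_at_source[OF all_linear_A4 f, of "[i, j, k]" "[i, j, k]" c])
        (use A4_leaf_inj[OF ijk(1,2), of "D [i, j]" _ k] ijk W le in
          \<open>auto simp: src_def snk_def le_Suc_eq One_nat_def\<close>)
  qed
  have Z: "scalar_at D f c [i, j, k, h]" if ijk: "i < 3" "j < 2" "k < 2" "h < 2" for i j k h
  proof -
    have le: "D [i, j, k] \<le> 1" "D [i, j, k, h] \<le> D [i, j, k]" using sh ijk by auto
    have "\<exists>x\<in>kn (D [i, j, k]). y = trunc (D [i, j, k, h]) (A4 t [i, j, k, h] x)"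
      if y: "y \<in> kn (D [i, j, k, h])" for y
    proof (cases "D [i, j, k, h] = 0")
      case True
      then show ?thesis using y by (intro bexI[of _ 0]) auto
    next
      case False
      then have 1: "D [i, j, k, h] = 1" "D [i, j, k] = 1" using le by auto
      then obtain a where "y = vcons a 0" using y by (auto simp: kn_1_iff)
      then show ?thesis using 1 by (auto simp: A4_simps)
    qed
    note surj = this
    show ?thesis
      by (rule scalar_at_sink[OF all_linear_A4 f, of "[i, j, k, h]" "[i, j, k, h]" c])
        (use ijk L surj in \<open>auto simp: src_def snk_def\<close>)
  qed
  have root: "scalar_at D f c []"
    unfolding scalar_at_def
  proof
    fix y :: "nat \<Rightarrow> 'k" assume "y \<in> kn (D [])"
    then obtain xs ys zs where l: "length xs \<le> D [0]" "length ys \<le> D [1]" "length zs \<le> D [2]"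
      and y: "y = trunc (D []) (vmap t 0 (vec xs) + vmap t 1 (vec ys) + vmap t 2 (vec zs))"
      using D(2) unfolding root_surj_def by blast
    have fi: "f [] (trunc (D []) (vmap t i x)) = kscale c (trunc (D []) (vmap t i x))"
      if i: "i < 3" "x \<in> kn (D [i])" for i x
    proof -
      have "linear_on kscale kscale UNIV (vmap t i)"
        using all_linear_A4[of t] A4_simps(1)[of t i] unfolding all_linear_def by (metis ext)
      then show ?thesis
        using endo_commute[OF f, of "[i]" x] c[OF i(1)] i linear_on_scale[of kscale kscale UNIV "vmap t i" x c]
        by (simp add: src_def snk_def A4_simps scalar_at_def trunc_scale)
    qed
    show "f [] y = kscale c y"
      unfolding y trunc_add kvec.scale_right_distrib
      using fi[of 0 "vec xs"] fi[of 1 "vec ys"] fi[of 2 "vec zs"] vec_in_kn[OF l(1)] vec_in_kn[OF l(2)] vec_in_kn[OF l(3)]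
      by (simp add: linear_on_add[OF endoD(1)[OF f Adr_Nil]] kvec.subspace_add)
  qed
  have "scalar_at D f c p" if p: "p \<in> Adr" for p
    using p
  proof (cases rule: Adr_cases)
    case 6
    then have "D p = 0" using sh p by blast
    then show ?thesis using endo_zero[OF f p] by (simp add: scalar_at_def)
  qed (use root c W L Z in auto)
  then show "\<exists>c. \<forall>p\<in>Adr. scalar_at D f c p" by blast
qed

end

section \<open>The chain of accessible representations\<close>

text \<open>\<open>dims\<close>, \<open>top_dims\<close> and their updates differ off
  \<open>Adr\<close>, so the chain has to pass between dimension vectors that agree on addresses
  only.\<close>

lemma endo_cong:
  assumes "\<And>p. p \<in> Adr \<Longrightarrow> D p = D' p"
  shows "endo b A D f \<longleftrightarrow> endo b A D' f"
  using assms unfolding endo_def by simp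

lemma brick_dims_cong:
  assumes "\<And>p. p \<in> Adr \<Longrightarrow> D p = D' p"
  shows "brick_dims b A D \<longleftrightarrow> brick_dims b A D'"
  using assms endo_cong[OF assms, where b = b and A = A] unfolding brick_dims_def scalar_at_def by simp

context coded_quiver
begin

lemma model_cong:
  assumes "\<And>p. p \<in> Adr \<Longrightarrow> D p = D' p"
  shows "model A D = model A D'"
  by (simp add: model_def fun_eq_iff verts_eq arcs_eq assms image_iff) (use assms in auto)

lemma good_cong:
  fixes A :: "nat list \<Rightarrow> (nat \<Rightarrow> 'k::field) \<Rightarrow> nat \<Rightarrow> 'k"
  assumes D: "\<And>p. p \<in> Adr \<Longrightarrow> D p = D' p"
  shows "good A D \<longleftrightarrow> good A D'"
proof -
  have model: "model A D = model A D'" by (rule model_cong) (rule D)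
  have "{p \<in> Adr. D p \<noteq> 0} = {p \<in> Adr. D' p \<noteq> 0}" using D by auto
  then show ?thesis
    unfolding good_def finite_dims_def model using brick_dims_cong[OF D, where b = b and A = A] by simp
qed

end

lemma dims_upd:
  "(dims X Vs Ws Ls)([] := n) = dims n Vs Ws Ls"
  "i < length Vs \<Longrightarrow> (dims X Vs Ws Ls)([i] := n) = dims X (Vs[i := n]) Ws Ls"
  "j < 2 \<Longrightarrow> 2 * i + j < length Ws \<Longrightarrow> (dims X Vs Ws Ls)([i, j] := n) = dims X Vs (Ws[2 * i + j := n]) Ls"
  "j < 2 \<Longrightarrow> 2 * i + j < length Ls \<Longrightarrow> (dims X Vs Ws Ls)([i, j, 0] := n) = dims X Vs Ws (Ls[2 * i + j := n])"
  by (auto simp: dims_def fun_eq_iff nth_list_update less_2_iff split: list.split)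

lemma case_nat_1: "(case 1 of 0 \<Rightarrow> a | Suc j \<Rightarrow> g j) = g 0"
  by (simp add: One_nat_def)

lemma nth_Cons_1: "(x # xs) ! 1 = xs ! 0"
  by (simp add: One_nat_def)

lemma dims_leaf [simp]: "dims X Vs Ws Ls [i, j, 1] = 0"
  by (simp add: dims_def)

lemma shape_dims: "length p > 4 \<Longrightarrow> dims X Vs Ws Ls p = 0"
  by (auto simp: dims_def split: list.split)

text \<open>Dimension vectors from total dimension 40 on: \<open>S\<close> records where the second
  leaf and the fourth coordinate have been added, \<open>T\<close> which outer sinks have been
  attached.\<close>

definition top_dims :: "(nat \<times> nat) set \<Rightarrow> nat list set \<Rightarrow> nat list \<Rightarrow> nat" where
  "top_dims S T p = (case p of
       [] \<Rightarrow> 7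
     | [i] \<Rightarrow> 3
     | [i, j] \<Rightarrow> if (i, j) \<in> S then 4 else 3
     | [i, j, k] \<Rightarrow> if k = 0 \<or> (i, j) \<in> S then 1 else 0
     | _ \<Rightarrow> if p \<in> T \<and> length p = 4 then 1 else 0)"

lemma top_dims_simps [simp]:
  "top_dims S T [] = 7"
  "top_dims S T [i] = 3"
  "top_dims S T [i, j] = (if (i, j) \<in> S then 4 else 3)"
  "top_dims S T [i, j, k] = (if k = 0 \<or> (i, j) \<in> S then 1 else 0)"
  "top_dims S T [i, j, k, h] = (if [i, j, k, h] \<in> T then 1 else 0)"
  "length p > 4 \<Longrightarrow> top_dims S T p = 0"
  by (auto simp: top_dims_def split: list.split)

context
  fixes t :: "'k::field"
  assumes t2: "t * t = t + 1"
begin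

lemma V_scalar_top:
  assumes D: "D [] = 7" "\<And>i. i < 3 \<Longrightarrow> D [i] = 3"
    "\<And>i j. i < 3 \<Longrightarrow> j < 2 \<Longrightarrow> D [i, j, 0] = 1"
    "\<And>i j. i < 3 \<Longrightarrow> j < 2 \<Longrightarrow> D [i, j] = 3 \<or> D [i, j] = 4 \<and> D [i, j, 1] = 1"
    and f: "endo False (A4 t) D f"
  shows "V_scalar D f"
proof (rule V_scalar_7_333[OF t2 _ _ _ _ _ f])
  fix i j :: nat assume ij: "i < 3" "j < 2"
  show "\<exists>l. f [i] (line t i j) = kscale l (line t i j)"
  proof (cases "D [i, j] = 3")
    case True
    show ?thesis
    proof (rule endo_line[OF t2 f ij])
      have "line t i j \<in> kn 3" using ij by (auto simp: less_2_iff less_3_iff line_def)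
      then show "line t i j \<in> kn (D [i])" using D(2)[OF ij(1)] by simp
      show "\<forall>y\<in>kn (D [i]). trunc (D [i, j]) (wmap t i j y) = 0 \<longrightarrow> y = 0"
        unfolding D(2)[OF ij(1)] True using wmap_inj[OF t2 ij order_refl order_refl] by blast
      show "D [i, j] \<le> 3" "D [i, j, 0] = 1" using True D(3)[OF ij] by simp_all
    qed simp
  next
    case False
    then have "D [i, j] = 4" "D [i, j, 1] = 1" using D(4)[OF ij] by auto
    then show ?thesis using endo_line4[OF t2 f ij] D(2)[OF ij(1)] D(3)[OF ij] by metis
  qed
qed (simp_all add: D(1,2))

end

locale Q3_cover = coded_quiver Q w e False for Q :: "('v, 'e) pre_digraph" and w e
begin

context
  fixes t :: "'k::field"
  assumes t2: "t * t = t + 1"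
begin

lemma good_step_V:
  assumes g: "good (A4 t) D" and p: "p \<in> Adr" and D': "D' = D(p := Suc (D p))"
    and sh: "shape D'" "root_surj t D'" and V: "\<And>f. endo False (A4 t) D' f \<Longrightarrow> V_scalar D' f"
  shows "good (A4 t) D'"
  unfolding D' by (rule good_step[OF all_linear_A4 g p]) (use brick_from_V[OF t2 sh V] in \<open>simp add: D'\<close>)

lemma good_top_step:
  assumes g: "good (A4 t) D" and p: "p \<in> Adr" and D': "D' = D(p := Suc (D p))"
    and sh: "shape D'" "D' [] = 7" "\<And>i. i < 3 \<Longrightarrow> D' [i] = 3" "\<And>i j. i < 3 \<Longrightarrow> j < 2 \<Longrightarrow> D' [i, j, 0] = 1"
    "\<And>i j. i < 3 \<Longrightarrow> j < 2 \<Longrightarrow> D' [i, j] = 3 \<or> D' [i, j] = 4 \<and> D' [i, j, 1] = 1"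
  shows "good (A4 t) D'"
  by (rule good_step_V[OF g p D' sh(1) root_surj_7 V_scalar_top[OF t2 sh(2-5)]]) (simp_all add: sh)

lemmas step_simps = dims_upd case_nat_1 nth_Cons_1 shape_def all_less_2 all_less_3 shape_dims One_nat_def[symmetric]

text \<open>The number is the total dimension. A step is possible once every invariant line that it
  destroys has a substitute, which accounts for the zigzag between root, sinks and leaves.\<close>

lemma good_40: "good (A4 t) (dims 7 [3, 3, 3] [3, 3, 3, 3, 3, 3] [1, 1, 1, 1, 1, 1])"
proof -
  have "((\<lambda>_. 0)([0] := 1)) p = dims 0 [1, 0, 0] [0, 0, 0, 0, 0, 0] [0, 0, 0, 0, 0, 0] p" if "p \<in> Adr" for p
    using that by (cases rule: Adr_cases) (auto simp: less_2_iff less_3_iff shape_dims)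
  from good_cong[of "(\<lambda>_. 0)([0] := 1)" "dims 0 [1, 0, 0] [0, 0, 0, 0, 0, 0] [0, 0, 0, 0, 0, 0]" "A4 t", OF this]
  have g: "good (A4 t) (dims 0 [1, 0, 0] [0, 0, 0, 0, 0, 0] [0, 0, 0, 0, 0, 0])"
    using good_simple[OF all_linear_A4[of t], of "[0]"] by simp
  from g have g: "good (A4 t) (dims 0 [1, 0, 0] [1, 0, 0, 0, 0, 0] [0, 0, 0, 0, 0, 0])"
    by (rule good_step_V[of _ "[0, 0]"]) (simp_all add: step_simps root_surj_2 V_scalar_start[OF t2])
  from g have g: "good (A4 t) (dims 0 [1, 0, 0] [1, 1, 0, 0, 0, 0] [0, 0, 0, 0, 0, 0])"
    by (rule good_step_V[of _ "[0, 1]"]) (simp_all add: step_simps root_surj_2 V_scalar_start[OF t2])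
  from g have g: "good (A4 t) (dims 1 [1, 0, 0] [1, 1, 0, 0, 0, 0] [0, 0, 0, 0, 0, 0])"
    by (rule good_step_V[of _ "[]"]) (simp_all add: step_simps root_surj_2 V_scalar_start[OF t2])
  from g have g: "good (A4 t) (dims 1 [2, 0, 0] [1, 1, 0, 0, 0, 0] [0, 0, 0, 0, 0, 0])"
    by (rule good_step_V[of _ "[0]"]) (simp_all add: step_simps root_surj_2 V_scalar_1_200[OF t2])
  from g have g: "good (A4 t) (dims 1 [2, 1, 0] [1, 1, 0, 0, 0, 0] [0, 0, 0, 0, 0, 0])"
    by (rule good_step_V[of _ "[1]"]) (simp_all add: step_simps root_surj_2 V_scalar_1_210[OF t2])
  from g have g: "good (A4 t) (dims 2 [2, 1, 0] [1, 1, 0, 0, 0, 0] [0, 0, 0, 0, 0, 0])"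
    by (rule good_step_V[of _ "[]"]) (simp_all add: step_simps root_surj_2 V_scalar_2_210a[OF t2])
  \<comment> \<open>The leaf is attached before \<open>[0, 0]\<close> grows, because the growth
    removes the kernel line at \<open>[0]\<close>.\<close>
  from g have g: "good (A4 t) (dims 2 [2, 1, 0] [1, 1, 0, 0, 0, 0] [1, 0, 0, 0, 0, 0])"
    by (rule good_step_V[of _ "[0, 0, 0]"]) (simp_all add: step_simps root_surj_2 V_scalar_2_210a[OF t2])
  from g have g: "good (A4 t) (dims 2 [2, 1, 0] [2, 1, 0, 0, 0, 0] [1, 0, 0, 0, 0, 0])"
    by (rule good_step_V[of _ "[0, 0]"]) (simp_all add: step_simps root_surj_2 V_scalar_2_210b[OF t2])
  from g have g: "good (A4 t) (dims 2 [2, 1, 0] [2, 1, 0, 0, 0, 0] [1, 1, 0, 0, 0, 0])"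
    by (rule good_step_V[of _ "[0, 1, 0]"]) (simp_all add: step_simps root_surj_2 V_scalar_2_210b[OF t2])
  from g have g: "good (A4 t) (dims 2 [2, 1, 0] [2, 2, 0, 0, 0, 0] [1, 1, 0, 0, 0, 0])"
    by (rule good_step_V[of _ "[0, 1]"]) (simp_all add: step_simps root_surj_2 V_scalar_2_210c[OF t2])
  from g have g: "good (A4 t) (dims 2 [2, 1, 1] [2, 2, 0, 0, 0, 0] [1, 1, 0, 0, 0, 0])"
    by (rule good_step_V[of _ "[2]"]) (simp_all add: step_simps root_surj_2 V_scalar_2_211[OF t2])
  from g have g: "good (A4 t) (dims 3 [2, 1, 1] [2, 2, 0, 0, 0, 0] [1, 1, 0, 0, 0, 0])"
    by (rule good_step_V[of _ "[]"]) (simp_all add: step_simps root_surj_3_211 V_scalar_3_211[OF t2])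
  from g have g: "good (A4 t) (dims 3 [3, 1, 1] [2, 2, 0, 0, 0, 0] [1, 1, 0, 0, 0, 0])"
    by (rule good_step_V[of _ "[0]"]) (simp_all add: step_simps root_surj_3 V_scalar_3_311a[OF t2])
  from g have g: "good (A4 t) (dims 3 [3, 1, 1] [2, 3, 0, 0, 0, 0] [1, 1, 0, 0, 0, 0])"
    by (rule good_step_V[of _ "[0, 1]"]) (simp_all add: step_simps root_surj_3 V_scalar_3_311b[OF t2])
  from g have g: "good (A4 t) (dims 3 [3, 1, 1] [3, 3, 0, 0, 0, 0] [1, 1, 0, 0, 0, 0])"
    by (rule good_step_V[of _ "[0, 0]"]) (simp_all add: step_simps root_surj_3 V_scalar_3_311c[OF t2])
  \<comment> \<open>\<open>[2, 0]\<close> comes before the second dimension of \<open>[2]\<close>,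
    so that the plane at \<open>[2]\<close> has its kernel line from the beginning.\<close>
  from g have g: "good (A4 t) (dims 3 [3, 1, 1] [3, 3, 0, 0, 1, 0] [1, 1, 0, 0, 0, 0])"
    by (rule good_step_V[of _ "[2, 0]"]) (simp_all add: step_simps root_surj_3 V_scalar_3_311c[OF t2])
  from g have g: "good (A4 t) (dims 3 [3, 1, 2] [3, 3, 0, 0, 1, 0] [1, 1, 0, 0, 0, 0])"
    by (rule good_step_V[of _ "[2]"]) (simp_all add: step_simps root_surj_3 V_scalar_3_312[OF t2])
  from g have g: "good (A4 t) (dims 3 [3, 1, 2] [3, 3, 1, 0, 1, 0] [1, 1, 0, 0, 0, 0])"
    by (rule good_step_V[of _ "[1, 0]"]) (simp_all add: step_simps root_surj_3 V_scalar_3_312[OF t2])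
  from g have g: "good (A4 t) (dims 3 [3, 2, 2] [3, 3, 1, 0, 1, 0] [1, 1, 0, 0, 0, 0])"
    by (rule good_step_V[of _ "[1]"]) (simp_all add: step_simps root_surj_3 V_scalar_3_322[OF t2])
  from g have g: "good (A4 t) (dims 4 [3, 2, 2] [3, 3, 1, 0, 1, 0] [1, 1, 0, 0, 0, 0])"
    by (rule good_step_V[of _ "[]"]) (simp_all add: step_simps root_surj_4 V_scalar_4_322[OF t2])
  from g have g: "good (A4 t) (dims 5 [3, 2, 2] [3, 3, 1, 0, 1, 0] [1, 1, 0, 0, 0, 0])"
    by (rule good_step_V[of _ "[]"]) (simp_all add: step_simps root_surj_5 V_scalar_5_322[OF t2])
  from g have g: "good (A4 t) (dims 5 [3, 3, 2] [3, 3, 1, 0, 1, 0] [1, 1, 0, 0, 0, 0])"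
    by (rule good_step_V[of _ "[1]"]) (simp_all add: step_simps root_surj_5 V_scalar_5_332a[OF t2])
  \<comment> \<open>While the kernel plane of the map to \<open>[1, 0]\<close> is available,
    \<open>[1, 1]\<close> grows to dimension 3 and gets its leaf; the new leaf line then lets
    \<open>[1, 0]\<close> grow.\<close>
  from g have g: "good (A4 t) (dims 5 [3, 3, 2] [3, 3, 1, 1, 1, 0] [1, 1, 0, 0, 0, 0])"
    by (rule good_step_V[of _ "[1, 1]"]) (simp_all add: step_simps root_surj_5 V_scalar_5_332a[OF t2])
  from g have g: "good (A4 t) (dims 5 [3, 3, 2] [3, 3, 1, 2, 1, 0] [1, 1, 0, 0, 0, 0])"
    by (rule good_step_V[of _ "[1, 1]"]) (simp_all add: step_simps root_surj_5 V_scalar_5_332a[OF t2])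
  from g have g: "good (A4 t) (dims 5 [3, 3, 2] [3, 3, 1, 3, 1, 0] [1, 1, 0, 0, 0, 0])"
    by (rule good_step_V[of _ "[1, 1]"]) (simp_all add: step_simps root_surj_5 V_scalar_5_332a[OF t2])
  from g have g: "good (A4 t) (dims 5 [3, 3, 2] [3, 3, 1, 3, 1, 0] [1, 1, 0, 1, 0, 0])"
    by (rule good_step_V[of _ "[1, 1, 0]"]) (simp_all add: step_simps root_surj_5 V_scalar_5_332b[OF t2])
  from g have g: "good (A4 t) (dims 5 [3, 3, 2] [3, 3, 1, 3, 1, 0] [1, 1, 1, 1, 0, 0])"
    by (rule good_step_V[of _ "[1, 0, 0]"]) (simp_all add: step_simps root_surj_5 V_scalar_5_332b[OF t2])
  from g have g: "good (A4 t) (dims 5 [3, 3, 2] [3, 3, 2, 3, 1, 0] [1, 1, 1, 1, 0, 0])"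
    by (rule good_step_V[of _ "[1, 0]"]) (simp_all add: step_simps root_surj_5 V_scalar_5_332b[OF t2])
  from g have g: "good (A4 t) (dims 5 [3, 3, 2] [3, 3, 3, 3, 1, 0] [1, 1, 1, 1, 0, 0])"
    by (rule good_step_V[of _ "[1, 0]"]) (simp_all add: step_simps root_surj_5 V_scalar_5_332b[OF t2])
  from g have g: "good (A4 t) (dims 6 [3, 3, 2] [3, 3, 3, 3, 1, 0] [1, 1, 1, 1, 0, 0])"
    by (rule good_step_V[of _ "[]"]) (simp_all add: step_simps root_surj_6 V_scalar_6_332[OF t2])
  from g have g: "good (A4 t) (dims 6 [3, 3, 3] [3, 3, 3, 3, 1, 0] [1, 1, 1, 1, 0, 0])"
    by (rule good_step_V[of _ "[2]"]) (simp_all add: step_simps root_surj_6 V_scalar_6_333[OF t2])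
  \<comment> \<open>From here on \<open>[0]\<close> and \<open>[1]\<close> carry enough lines, and
    the part behind \<open>[2]\<close> is filled in.\<close>
  from g have g: "good (A4 t) (dims 6 [3, 3, 3] [3, 3, 3, 3, 1, 0] [1, 1, 1, 1, 1, 0])"
    by (rule good_step_V[of _ "[2, 0, 0]"]) (simp_all add: step_simps root_surj_6 V_scalar_6_333[OF t2])
  from g have g: "good (A4 t) (dims 6 [3, 3, 3] [3, 3, 3, 3, 2, 0] [1, 1, 1, 1, 1, 0])"
    by (rule good_step_V[of _ "[2, 0]"]) (simp_all add: step_simps root_surj_6 V_scalar_6_333[OF t2])
  from g have g: "good (A4 t) (dims 6 [3, 3, 3] [3, 3, 3, 3, 3, 0] [1, 1, 1, 1, 1, 0])"
    by (rule good_step_V[of _ "[2, 0]"]) (simp_all add: step_simps root_surj_6 V_scalar_6_333[OF t2])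
  from g have g: "good (A4 t) (dims 6 [3, 3, 3] [3, 3, 3, 3, 3, 1] [1, 1, 1, 1, 1, 0])"
    by (rule good_step_V[of _ "[2, 1]"]) (simp_all add: step_simps root_surj_6 V_scalar_6_333[OF t2])
  from g have g: "good (A4 t) (dims 6 [3, 3, 3] [3, 3, 3, 3, 3, 2] [1, 1, 1, 1, 1, 0])"
    by (rule good_step_V[of _ "[2, 1]"]) (simp_all add: step_simps root_surj_6 V_scalar_6_333[OF t2])
  from g have g: "good (A4 t) (dims 6 [3, 3, 3] [3, 3, 3, 3, 3, 3] [1, 1, 1, 1, 1, 0])"
    by (rule good_step_V[of _ "[2, 1]"]) (simp_all add: step_simps root_surj_6 V_scalar_6_333[OF t2])
  from g have g: "good (A4 t) (dims 6 [3, 3, 3] [3, 3, 3, 3, 3, 3] [1, 1, 1, 1, 1, 1])"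
    by (rule good_step_V[of _ "[2, 1, 0]"]) (simp_all add: step_simps root_surj_6 V_scalar_6_333[OF t2])
  from g have g: "good (A4 t) (dims 7 [3, 3, 3] [3, 3, 3, 3, 3, 3] [1, 1, 1, 1, 1, 1])"
    by (rule good_top_step[of _ "[]"]) (auto simp: step_simps less_2_iff less_3_iff)
  from g show ?thesis .
qed

text \<open>Each of the six pairs contributes 2 to the dimension. The second leaf is added before
  the fourth coordinate, since \<open>shape\<close> demands both leaves in dimension 4.\<close>

lemma good_52:
  assumes "S \<subseteq> {..<3} \<times> {..<2}"
  shows "good (A4 t) (top_dims S {})"
proof -
  have "finite S" using assms finite_subset by blast
  then show ?thesis using assms
  proof (induction S)
    case empty
    have "dims 7 [3, 3, 3] [3, 3, 3, 3, 3, 3] [1, 1, 1, 1, 1, 1] p = top_dims {} {} p" if "p \<in> Adr" for p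
      using that by (cases rule: Adr_cases) (auto simp: less_2_iff less_3_iff shape_dims)
    from good_cong[of "dims 7 [3, 3, 3] [3, 3, 3, 3, 3, 3] [1, 1, 1, 1, 1, 1]" "top_dims {} {}" "A4 t", OF this]
    show ?case using good_40 by simp
  next
    case (insert x S)
    obtain i j where x: "x = (i, j)" "i < 3" "j < 2" using insert.prems by auto
    let ?D = "(top_dims S {})([i, j, 1] := 1)"
    let ?D' = "?D([i, j] := 4)"
    have "good (A4 t) ?D"
      by (rule good_top_step[OF insert.IH, of "[i, j, 1]"])
        (use insert x in \<open>auto simp: shape_def One_nat_def\<close>)
    then have "good (A4 t) ?D'"
      by (rule good_top_step[of _ "[i, j]"])
        (use insert x in \<open>auto simp: shape_def less_2_iff One_nat_def\<close>)
    moreover have "?D' p = top_dims (insert x S) {} p" if "p \<in> Adr" for p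
      using that x by (cases rule: Adr_cases) (auto simp: less_2_iff)
    ultimately show ?case using good_cong[of ?D' "top_dims (insert x S) {}" "A4 t"] by simp
  qed
qed

text \<open>There are 24 outer sinks, and attaching one leaves the conditions at the neighbours of
  the root untouched. \<open>UNIV\<close> agrees with the set of the six pairs on addresses.\<close>

lemma good_76:
  assumes "finite T" "T \<subseteq> {p \<in> Adr. length p = 4}"
  shows "good (A4 t) (top_dims UNIV T)"
  using assms
proof (induction T)
  case empty
  have "top_dims ({..<3} \<times> {..<2}) {} p = top_dims UNIV {} p" if "p \<in> Adr" for p
    using that by (cases rule: Adr_cases) auto
  from good_cong[of "top_dims ({..<3} \<times> {..<2}) {}" "top_dims UNIV {}" "A4 t", OF this]
  show ?case using good_52[of "{..<3} \<times> {..<2}"] by simp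
next
  case (insert p T)
  have p: "p \<in> Adr" "length p = 4" using insert.prems by auto
  have "good (A4 t) ((top_dims UNIV T)(p := 1))"
  proof (rule good_top_step[of _ p])
    show "good (A4 t) (top_dims UNIV T)" using insert by simp
    show "shape ((top_dims UNIV T)(p := 1))"
      using p unfolding shape_def by auto
  qed (use p insert.hyps in \<open>auto simp: top_dims_def split: list.split\<close>)
  moreover have "((top_dims UNIV T)(p := 1)) r = top_dims UNIV (insert p T) r" if "r \<in> Adr" for r
    using that p by (cases rule: Adr_cases) auto
  ultimately show ?case
    using good_cong[of "(top_dims UNIV T)(p := 1)" "top_dims UNIV (insert p T)" "A4 t"] by simp
qed

end

end

section \<open>The reflections of the simple representation\<close>

lemma exact_dimsI:
  fixes A A' :: "nat list \<Rightarrow> (nat \<Rightarrow> 'k::field) \<Rightarrow> nat \<Rightarrow> 'k"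
  assumes star: "star p = {r0, r1, r2}" "r0 \<noteq> r1" "r0 \<noteq> r2" "r1 \<noteq> r2"
    and d: "D (snk b r0) = da" "D (snk b r1) = db" "D (snk b r2) = dc" "D p = d" "D' p = d'"
    and comp: "\<And>x. x \<in> kn d \<Longrightarrow>
      trunc d' (A' r0 (trunc da (A r0 x)) + A' r1 (trunc db (A r1 x)) + A' r2 (trunc dc (A r2 x))) = 0"
    and ker: "\<And>u v w. u \<in> kn da \<Longrightarrow> v \<in> kn db \<Longrightarrow> w \<in> kn dc \<Longrightarrow>
      trunc d' (A' r0 u + A' r1 v + A' r2 w) = 0 \<Longrightarrow>
      \<exists>x\<in>kn d. u = trunc da (A r0 x) \<and> v = trunc db (A r1 x) \<and> w = trunc dc (A r2 x)"
    and surj: "\<And>y. y \<in> kn d' \<Longrightarrow> \<exists>u\<in>kn da. \<exists>v\<in>kn db. \<exists>w\<in>kn dc.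
      trunc d' (A' r0 u + A' r1 v + A' r2 w) = y"
  shows "exact_dims b A D A' D' p"
proof -
  have sum: "(\<Sum>r\<in>star p. F r) = F r0 + F r1 + F r2" for F :: "nat list \<Rightarrow> nat \<Rightarrow> 'k"
    using star by (simp add: add.assoc)
  show ?thesis
    unfolding exact_dims_def sum unfolding star(1)
  proof (intro conjI ballI allI impI)
    fix x :: "nat \<Rightarrow> 'k" assume "x \<in> kn (D p)"
    then show "trunc (D' p) (A' r0 (trunc (D (snk b r0)) (A r0 x))) +
        trunc (D' p) (A' r1 (trunc (D (snk b r1)) (A r1 x))) +
        trunc (D' p) (A' r2 (trunc (D (snk b r2)) (A r2 x))) = 0"
      using comp[of x] d by (simp add: trunc_add)
  next
    fix h assume h: "\<forall>r\<in>{r0, r1, r2}. h r \<in> kn (D (snk b r))"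
      and 0: "trunc (D' p) (A' r0 (h r0)) + trunc (D' p) (A' r1 (h r1)) + trunc (D' p) (A' r2 (h r2)) = 0"
    have "h r0 \<in> kn da" "h r1 \<in> kn db" "h r2 \<in> kn dc" using h d by auto
    moreover have "trunc d' (A' r0 (h r0) + A' r1 (h r1) + A' r2 (h r2)) = 0"
      using 0 d by (simp add: trunc_add)
    ultimately show "\<exists>x\<in>kn (D p). \<forall>r\<in>{r0, r1, r2}. h r = trunc (D (snk b r)) (A r x)"
      using ker[of "h r0" "h r1" "h r2"] d by auto
  next
    fix y :: "nat \<Rightarrow> 'k" assume "y \<in> kn (D' p)"
    then obtain u v w where uvw: "u \<in> kn da" "v \<in> kn db" "w \<in> kn dc"
      "trunc d' (A' r0 u + A' r1 v + A' r2 w) = y"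
      using surj[of y] d by auto
    then show "\<exists>h. (\<forall>r\<in>{r0, r1, r2}. h r \<in> kn (D (snk b r))) \<and>
        trunc (D' p) (A' r0 (h r0)) + trunc (D' p) (A' r1 (h r1)) + trunc (D' p) (A' r2 (h r2)) = y"
      using star d
      by (intro exI[of _ "\<lambda>r. if r = r0 then u else if r = r1 then v else w"]) (auto simp: trunc_add)
  qed
qed

lemma star_simps:
  "star [] = {[0], [1], [2]}"
  "star [i] = {[i], [i, 0], [i, 1]}"
  "star [i, j] = {[i, j], [i, j, 0], [i, j, 1]}"
  "star [i, j, k] = {[i, j, k], [i, j, k, 0], [i, j, k, 1]}"
  "star [i, j, k, h] = {[i, j, k, h], [i, j, k, h, 0], [i, j, k, h, 1]}"
  by (simp_all add: star_def)

lemma all_linear_0: "all_linear A \<Longrightarrow> A p 0 = 0"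
  using linear_on_zero[of kscale kscale UNIV "A p"] by (simp add: all_linear_def)

lemma exact_dims_zero:
  assumes A: "all_linear A" "all_linear A'"
    and d: "D' p = 0" "\<And>r. r \<in> star p \<Longrightarrow> D (snk b r) = 0"
  shows "exact_dims b A D A' D' p"
proof -
  have "(\<forall>r\<in>star p. h r \<in> kn (D (snk b r))) \<Longrightarrow> \<exists>x\<in>kn (D p). \<forall>r\<in>star p. h r = trunc (D (snk b r)) (A r x)" for h
    using d(2) by (intro bexI[of _ 0]) auto
  then show ?thesis unfolding exact_dims_def using d by auto
qed

text \<open>The case of a vertex that becomes nonzero in this reflection: its only nonzero neighbour
  is the parent, of dimension 1, and the cokernel is a copy of it.\<close>

lemma exact_dims_leaf:
  fixes A A' :: "nat list \<Rightarrow> (nat \<Rightarrow> 'k::field) \<Rightarrow> nat \<Rightarrow> 'k"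
  assumes A: "all_linear A" "all_linear A'"
    and p: "p \<noteq> []" and d: "D (snk b p) = 1" "D (snk b (p @ [0])) = 0" "D (snk b (p @ [1])) = 0" "D p = 0" "D' p = 1"
    and c: "c \<noteq> 0" "\<And>a. trunc 1 (A' p (vec [a])) = vec [c * a]"
  shows "exact_dims b A D A' D' p"
proof (rule exact_dimsI[where D = D and D' = D', OF _ _ _ _ d])
  show "star p = {p, p @ [0], p @ [1]}" using p by (simp add: star_def)
next
  note z = all_linear_0[OF A(1)] all_linear_0[OF A(2)]
  {
    fix x :: "nat \<Rightarrow> 'k" assume "x \<in> kn 0"
    then have "x = 0" by simp
    then show "trunc 1 (A' p (trunc 1 (A p x)) + A' (p @ [0]) (trunc 0 (A (p @ [0]) x)) +
        A' (p @ [1]) (trunc 0 (A (p @ [1]) x))) = 0"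
      by (simp only: z trunc_zero trunc_0 add_0)
  next
    fix u v w :: "nat \<Rightarrow> 'k"
    assume u: "u \<in> kn 1" and vw: "v \<in> kn 0" "w \<in> kn 0"
      and 0: "trunc 1 (A' p u + A' (p @ [0]) v + A' (p @ [1]) w) = 0"
    obtain a where a: "u = vec [a]" using u by (auto simp: kn_1_iff)
    have vw0: "v = 0" "w = 0" using vw by simp_all
    have "vec [c * a] = 0" using 0 unfolding vw0 a z add_0_right c(2) .
    then have "u = 0" using a c(1) by simp
    then show "\<exists>x\<in>kn 0. u = trunc 1 (A p x) \<and> v = trunc 0 (A (p @ [0]) x) \<and> w = trunc 0 (A (p @ [1]) x)"
      using vw0 by (intro bexI[of _ 0]) (simp_all only: z trunc_zero trunc_0 zero_kn)
  next
    fix y :: "nat \<Rightarrow> 'k" assume "y \<in> kn 1"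
    then obtain a where "y = vec [a]" by (auto simp: kn_1_iff)
    then have "trunc 1 (A' p (vec [a / c]) + A' (p @ [0]) 0 + A' (p @ [1]) 0) = y"
      unfolding z add_0_right c(2) using c(1) by simp
    then show "\<exists>u\<in>kn 1. \<exists>v\<in>kn 0. \<exists>w\<in>kn 0. trunc 1 (A' p u + A' (p @ [0]) v + A' (p @ [1]) w) = y"
      by (intro bexI[of _ "vec [a / c]"] bexI[of _ 0]) simp_all
  }
qed simp_all

section \<open>Coordinates of the first three reflections\<close>

definition D1 :: "nat list \<Rightarrow> nat" where
  "D1 p = (case p of [] \<Rightarrow> 1 | [i] \<Rightarrow> 1 | _ \<Rightarrow> 0)"

definition D2 :: "nat list \<Rightarrow> nat" where
  "D2 p = (case p of [] \<Rightarrow> 2 | [i] \<Rightarrow> 1 | [i, j] \<Rightarrow> 1 | _ \<Rightarrow> 0)"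

text \<open>At the root, the three vectors with sum zero present the cokernel of the diagonal map
  into the sum of three lines.\<close>

definition A2 :: "nat list \<Rightarrow> (nat \<Rightarrow> 'k) \<Rightarrow> nat \<Rightarrow> 'k::field" where
  "A2 p x = (case p of
       [i] \<Rightarrow> if i = 0 then vec [x 0, 0] else if i = 1 then vec [0, x 0] else vec [- x 0, - x 0]
     | [i, j] \<Rightarrow> if j = 0 then x else - x
     | _ \<Rightarrow> 0)"

definition D3 :: "nat list \<Rightarrow> nat" where
  "D3 p = (case p of [] \<Rightarrow> 2 | [i] \<Rightarrow> 3 | [i, j] \<Rightarrow> 1 | [i, j, k] \<Rightarrow> 1 | _ \<Rightarrow> 0)"

text \<open>The sign at \<open>i = 2\<close> matches the relation
  \<open>vmap t 0 x + vmap t 1 x - vmap t 2 x = 0\<close> on \<open>kn 2\<close>, and the opposite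
  signs at the leaves cancel the extra entries in \<open>A4\<close>.\<close>

definition A3 :: "'k \<Rightarrow> nat list \<Rightarrow> (nat \<Rightarrow> 'k) \<Rightarrow> nat \<Rightarrow> 'k::field" where
  "A3 t p x = (case p of
       [i] \<Rightarrow> if i = 2 then - x else x
     | [i, j] \<Rightarrow> kscale (x 0) (line t i j)
     | [i, j, k] \<Rightarrow> if k = 0 then - x else x
     | _ \<Rightarrow> 0)"

lemma D_long:
  "length p > 1 \<Longrightarrow> D1 p = 0" "length p > 2 \<Longrightarrow> D2 p = 0" "length p > 3 \<Longrightarrow> D3 p = 0"
  by (auto simp: D1_def D2_def D3_def split: list.split)

lemma all_linear_A2: "all_linear A2"
  unfolding all_linear_def linear_on_def A2_def
  by (auto split: list.split) (auto simp: kscale_def fun_eq_iff algebra_simps)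

lemma all_linear_A3: "all_linear (A3 t)"
  unfolding all_linear_def linear_on_def A3_def
  by (auto split: list.split simp: kvec.scale_left_distrib)
     (auto simp: kscale_def fun_eq_iff algebra_simps)

lemma finite_Adr_le: "finite {p \<in> Adr. length p \<le> n}"
proof -
  have "p ! k < 3" if "p \<in> Adr" "k < length p" for p k
    using that unfolding Adr_def by (auto split: if_splits)
  then have "{p \<in> Adr. length p \<le> n} \<subseteq> {p. set p \<subseteq> {..<3} \<and> length p \<le> n}"
    by (auto simp: in_set_conv_nth)
  then show ?thesis using finite_lists_length_le[of "{..<3::nat}" n] finite_subset by blast
qed

lemma finite_dims_4:
  assumes "\<And>p. length p > 4 \<Longrightarrow> D p = 0"
  shows "finite_dims D"
  unfolding finite_dims_def
  by (rule finite_subset[OF _ finite_Adr_le[of 4]]) (use assms in \<open>auto simp: not_less[symmetric]\<close>)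

lemma length_snk_star: "r \<in> star p \<Longrightarrow> p \<noteq> [] \<Longrightarrow> length p \<le> Suc (length (snk b r))"
  by (auto simp: star_def snk_def)

lemma D_simps [simp]:
  "D1 [] = 1" "D1 [i] = 1" "D1 [i, j] = 0" "D1 [i, j, k] = 0" "D1 [i, j, k, h] = 0"
  "D2 [] = 2" "D2 [i] = 1" "D2 [i, j] = 1" "D2 [i, j, k] = 0" "D2 [i, j, k, h] = 0"
  "D3 [] = 2" "D3 [i] = 3" "D3 [i, j] = 1" "D3 [i, j, k] = 1" "D3 [i, j, k, h] = 0"
  by (simp_all add: D1_def D2_def D3_def)

lemma A23_simps:
  "A2 [i] x = (if i = 0 then vec [x 0, 0] else if i = 1 then vec [0, x 0] else vec [- x 0, - x 0])"
  "A2 [i, j] x = (if j = 0 then x else - x)"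
  "A3 t [i] x = (if i = 2 then - x else x)"
  "A3 t [i, j] x = kscale (x 0) (line t i j)"
  "A3 t [i, j, k] x = (if k = 0 then - x else x)"
  by (simp_all add: A2_def A3_def)

lemma exact_01:
  assumes p: "p \<in> Adr" "odd (length p)"
  shows "exact_dims False (\<lambda>_ _. 0) ((\<lambda>_. 0)([] := 1)) (\<lambda>_ x. x) D1 p"
proof -
  have lin: "all_linear (\<lambda>_ _. 0 :: nat \<Rightarrow> 'k::field)" "all_linear (\<lambda>_ x. x :: nat \<Rightarrow> 'k)"
    by (auto simp: all_linear_def linear_on_def)
  from p(1) show ?thesis
  proof (cases rule: Adr_cases)
    case (2 i)
    show ?thesis unfolding 2
      by (rule exact_dims_leaf[OF lin, where c = 1]) (simp_all add: snk_def)
  next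
    case (4 i j k)
    show ?thesis unfolding 4 by (rule exact_dims_zero[OF lin]) (auto simp: star_simps snk_def)
  next
    case 6
    then have "p \<noteq> []" by auto
    then have "snk False r \<noteq> []" if "r \<in> star p" for r
      using length_snk_star[OF that, of False] 6 by fastforce
    then show ?thesis using 6 by (intro exact_dims_zero[OF lin]) (auto simp: D_long)
  qed (use p in auto)
qed

lemma exact_12:
  assumes p: "p \<in> Adr" "even (length p)"
  shows "exact_dims True (\<lambda>_ x. x) D1 (A2 :: nat list \<Rightarrow> (nat \<Rightarrow> 'b::field) \<Rightarrow> nat \<Rightarrow> 'b) D2 p"
proof -
  have lin: "all_linear (\<lambda>_ x. x :: nat \<Rightarrow> 'b)"
    by (auto simp: all_linear_def linear_on_def)
  from p(1) show ?thesis
  proof (cases rule: Adr_cases)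
    case 1
    show ?thesis unfolding 1
    proof (rule exact_dimsI[OF star_simps(1), where da = 1 and db = 1 and dc = 1 and d = 1 and d' = 2])
      fix y :: "nat \<Rightarrow> 'b" assume "y \<in> kn 2"
      then obtain a c where "y = vec [a, c]" by (auto elim!: kn_SucE simp: numeral_2_eq_2)
      then show "\<exists>u\<in>kn 1. \<exists>v\<in>kn 1. \<exists>w\<in>kn 1. trunc 2 (A2 [0] u + A2 [1] v + A2 [2] w) = y"
        by (intro bexI[of _ "vec [a]"] bexI[of _ "vec [c]"] bexI[of _ "vec [0]"]) (simp_all add: A23_simps)
    qed (auto simp: snk_def kn_1_iff A23_simps)
  next
    case (3 i j)
    show ?thesis unfolding 3
      by (rule exact_dims_leaf[OF lin all_linear_A2, where c = "if j = 0 then 1 else - 1"]) (simp_all add: snk_def A23_simps)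
  next
    case (5 i j k h)
    show ?thesis unfolding 5 by (rule exact_dims_zero[OF lin all_linear_A2]) (auto simp: star_simps snk_def D_long)
  next
    case 6
    then have "p \<noteq> []" by auto
    then have "length (snk True r) > 1" if "r \<in> star p" for r
      using length_snk_star[OF that, of True] 6 by linarith
    then show ?thesis using 6 by (intro exact_dims_zero[OF lin all_linear_A2]) (auto simp: D_long)
  qed (use p in auto)
qed

lemma exact_23:
  fixes t :: "'k::field"
  assumes t: "t \<noteq> 0" and p: "p \<in> Adr" "odd (length p)"
  shows "exact_dims False A2 D2 (A3 t) D3 p"
  using p(1)
proof (cases rule: Adr_cases)
  case (2 i)
  show ?thesis unfolding 2
  proof (rule exact_dimsI[OF star_simps(2), where da = 2 and db = 1 and dc = 1 and d = 1 and d' = 3])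
    fix u v w :: "nat \<Rightarrow> 'k"
    assume uvw: "u \<in> kn 2" "v \<in> kn 1" "w \<in> kn 1"
      and 0: "trunc 3 (A3 t [i] u + A3 t [i, 0] v + A3 t [i, 1] w) = 0"
    obtain a b where u: "u = vec [a, b]" using uvw(1) by (auto elim!: kn_SucE simp: numeral_2_eq_2)
    obtain c where v: "v = vec [c]" using uvw(2) by (auto simp: kn_1_iff)
    obtain d where w: "w = vec [d]" using uvw(3) by (auto simp: kn_1_iff)
    show "\<exists>x\<in>kn 1. u = trunc 2 (A2 [i] x) \<and> v = trunc 1 (A2 [i, 0] x) \<and> w = trunc 1 (A2 [i, 1] x)"
    proof -
      \<comment> \<open>The vectors \<open>line t i 0\<close> and \<open>line t i 1\<close> have the
        same third entry, which is 1 or \<open>t\<close>.\<close>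
      have "t * c + t * d = 0 \<Longrightarrow> c + d = 0" using t by (simp flip: distrib_left)
      then have "c + d = 0"
        using 0 2(2) unfolding u v w less_3_iff by (elim disjE) (auto simp: A23_simps line_def mult.commute)
      then have "d = - c" by (simp add: eq_neg_iff_add_eq_0 add.commute)
      then have "u = trunc 2 (A2 [i] (vec [c])) \<and> v = trunc 1 (A2 [i, 0] (vec [c])) \<and>
          w = trunc 1 (A2 [i, 1] (vec [c]))"
        using 0 2(2) unfolding u v w less_3_iff
        by (elim disjE) (auto simp: A23_simps line_def minus_equation_iff[of a] minus_equation_iff[of b])
      then show ?thesis by (intro bexI[of _ "vec [c]"]) simp_all
    qed
  next
    fix y :: "nat \<Rightarrow> 'k" assume "y \<in> kn 3"
    then obtain a b c where y: "y = vec [a, b, c]" by (auto elim!: kn_SucE simp: numeral_3_eq_3)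
    show "\<exists>u\<in>kn 2. \<exists>v\<in>kn 1. \<exists>w\<in>kn 1. trunc 3 (A3 t [i] u + A3 t [i, 0] v + A3 t [i, 1] w) = y"
      using t 2(2) unfolding less_3_iff y
      \<comment> \<open>The arc \<open>[i, 0]\<close> supplies the third coordinate, and the plane
        coming from the root corrects the other two.\<close>
      by (intro bexI[of _ "if i = 0 then vec [a, b - c] else if i = 1 then vec [a - c / t, b] else vec [- a, - b]"]
          bexI[of _ "vec [if i = 1 then c / t else c]"] bexI[of _ "vec [0]"])
        (elim disjE; simp add: A23_simps line_def)+
  qed (use 2(2) in \<open>auto simp: snk_def kn_1_iff A23_simps line_def less_3_iff\<close>)
next
  case (4 i j k)
  show ?thesis unfolding 4
    by (rule exact_dims_leaf[OF all_linear_A2 all_linear_A3, where c = "if k = 0 then - 1 else 1"])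
      (simp_all add: snk_def A23_simps)
next
  case 6
  then have "p \<noteq> []" by auto
  then have "length (snk False r) > 2" if "r \<in> star p" for r
    using length_snk_star[OF that, of False] 6 by linarith
  then show ?thesis
    using 6 by (intro exact_dims_zero[OF all_linear_A2 all_linear_A3]) (auto simp: D_long)
qed (use p in auto)

lemma top_dims_full [simp]: "top_dims UNIV UNIV [i, j] = 4" "top_dims UNIV UNIV [i, j, k] = 1"
  "top_dims UNIV UNIV [i, j, k, h] = 1"
  by simp_all

lemma exact_34:
  fixes t :: "'k::field"
  assumes t2: "t * t = t + 1" and p: "p \<in> Adr" "even (length p)"
  shows "exact_dims True (A3 t) D3 (A4 t) (top_dims UNIV UNIV) p"
  using p(1)
proof (cases rule: Adr_cases)
  case 1
  show ?thesis unfolding 1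
  proof (rule exact_dimsI[OF star_simps(1), where da = 3 and db = 3 and dc = 3 and d = 2 and d' = 7])
    fix x :: "nat \<Rightarrow> 'k" assume "x \<in> kn 2"
    then obtain a b where "x = vec [a, b]" by (auto elim!: kn_SucE simp: numeral_2_eq_2)
    then show "trunc 7 (A4 t [0] (trunc 3 (A3 t [0] x)) + A4 t [1] (trunc 3 (A3 t [1] x)) +
        A4 t [2] (trunc 3 (A3 t [2] x))) = 0"
      by (simp add: A23_simps A4_simps vmap_simps algebra_simps)
  next
    fix u v w :: "nat \<Rightarrow> 'k"
    assume "u \<in> kn 3" "v \<in> kn 3" "w \<in> kn 3"
      and 0: "trunc 7 (A4 t [0] u + A4 t [1] v + A4 t [2] w) = 0"
    then obtain a b c a' b' c' a'' b'' c'' where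
      uvw: "u = vec [a, b, c]" "v = vec [a', b', c']" "w = vec [a'', b'', c'']"
      by (auto elim!: kn_SucE simp: numeral_3_eq_3)
    have "a' = a \<and> b' = b \<and> c = 0 \<and> c' = 0 \<and> a'' = - a \<and> b'' = - b \<and> c'' = 0"
      using 0 unfolding uvw by (simp add: A4_simps vmap_simps) algebra
    then show "\<exists>x\<in>kn 2. u = trunc 3 (A3 t [0] x) \<and> v = trunc 3 (A3 t [1] x) \<and> w = trunc 3 (A3 t [2] x)"
      unfolding uvw by (intro bexI[of _ "vec [a, b]"]) (simp_all add: A23_simps)
  next
    fix y :: "nat \<Rightarrow> 'k" assume y: "y \<in> kn 7"
    have "root_surj t (top_dims UNIV UNIV)" by (rule root_surj_7) simp_all
    then obtain xs ys zs where "length xs \<le> 3" "length ys \<le> 3" "length zs \<le> 3"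
      and "y = trunc 7 (vmap t 0 (vec xs) + vmap t 1 (vec ys) + vmap t 2 (vec zs))"
      using y unfolding root_surj_def top_dims_simps by blast
    then show "\<exists>u\<in>kn 3. \<exists>v\<in>kn 3. \<exists>w\<in>kn 3. trunc 7 (A4 t [0] u + A4 t [1] v + A4 t [2] w) = y"
      by (intro bexI[of _ "vec xs"] bexI[of _ "vec ys"] bexI[of _ "vec zs"])
        (simp_all only: A4_simps vec_in_kn)
  qed (simp_all add: snk_def)
next
  case (3 i j)
  let ?W = "wmap t i j" and ?v = "line t i j" and ?e = "vec [0, 0, 0, 1] :: nat \<Rightarrow> 'k"
  have lin: "linear_on kscale kscale UNIV ?W"
    using all_linear_A4[of t] A4_simps(2)[of t i j] unfolding all_linear_def by (metis ext)
  have W3: "?W x \<in> kn 3" for x using 3(2,3) by (auto simp: less_2_iff less_3_iff wmap_simps)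
  then have W4: "?W x \<in> kn 4" for x using kn_mono[of 3 4] by auto
  have v3: "?v \<in> kn 3" using 3(2,3) by (auto simp: less_2_iff less_3_iff line_def)
  have e4: "?e \<in> kn 4" by simp
  have vec0: "vec [a] 0 = a" for a :: 'k by simp
  \<comment> \<open>The value splits into a vector of \<open>kn 3\<close> and a multiple of the
    fourth unit vector, which can be compared separately.\<close>
  have sum: "?W u + A4 t [i, j, 0] (vec [a]) + A4 t [i, j, 1] (vec [c]) =
      ?W (u + kscale (a * t + c * (t - 1)) ?v) + kscale (a + c) ?e" for u a c
    using linear_on_add[OF lin, of u "kscale (a * t + c * (t - 1)) ?v"]
      linear_on_scale[OF lin, of ?v "a * t + c * (t - 1)"]
    by (simp add: A4_simps vec0 kvec.scale_left_distrib kvec.scale_right_distrib ac_simps del: vec.simps(2))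
  show ?thesis unfolding 3
  proof (rule exact_dimsI[OF star_simps(3), where da = 3 and db = 1 and dc = 1 and d = 1 and d' = 4])
    fix x :: "nat \<Rightarrow> 'k" assume "x \<in> kn 1"
    then obtain a where x: "x = vec [a]" by (auto simp: kn_1_iff)
    have "kscale a ?v + kscale (- a * t + a * (t - 1)) ?v = kscale (a + (- a * t + a * (t - 1))) ?v"
      by (simp only: kvec.scale_left_distrib)
    also have "\<dots> = 0" by (simp add: algebra_simps)
    finally have "?W (kscale a ?v) + A4 t [i, j, 0] (vec [- a]) + A4 t [i, j, 1] (vec [a]) = 0"
      unfolding sum using linear_on_zero[OF lin] by simp
    moreover have "trunc 3 (A3 t [i, j] x) = kscale a ?v" "trunc 1 (A3 t [i, j, 0] x) = vec [- a]"
      "trunc 1 (A3 t [i, j, 1] x) = vec [a]"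
      using v3 by (simp_all add: x A23_simps kvec.subspace_scale)
    ultimately show "trunc 4 (A4 t [i, j] (trunc 3 (A3 t [i, j] x)) + A4 t [i, j, 0] (trunc 1 (A3 t [i, j, 0] x)) +
        A4 t [i, j, 1] (trunc 1 (A3 t [i, j, 1] x))) = 0"
      by (simp only: A4_simps(2) trunc_zero)
  next
    fix u v w :: "nat \<Rightarrow> 'k"
    assume u: "u \<in> kn 3" and vw: "v \<in> kn 1" "w \<in> kn 1"
      and 0: "trunc 4 (A4 t [i, j] u + A4 t [i, j, 0] v + A4 t [i, j, 1] w) = 0"
    obtain a c where vw': "v = vec [a]" "w = vec [c]" using vw by (auto simp: kn_1_iff)
    let ?u = "u + kscale (a * t + c * (t - 1)) ?v"
    have 1: "?W ?u + kscale (a + c) ?e = 0"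
      using 0 trunc_id[OF kvec.subspace_add[OF subspace_kn W4[of ?u] kvec.subspace_scale[OF subspace_kn e4, of "a + c"]]]
      unfolding vw' A4_simps(2) sum by simp
    have "?W ?u 3 = 0" using W3[of ?u] by (simp add: kn_def)
    then have "kscale (a + c) ?e 3 = 0" using fun_cong[OF 1, of 3] by (simp del: vec.simps(2))
    then have "a + c = 0" by (simp add: kscale_def)
    then have ac: "c = - a" by (simp add: eq_neg_iff_add_eq_0 add.commute)
    have "?W ?u = 0" using 1 unfolding \<open>a + c = 0\<close> kvec.scale_zero_left add_0_right .
    then have "?u = 0"
      using wmap_inj[OF t2 3(2,3), of 3 3 ?u] u v3 by (simp add: kvec.subspace_add kvec.subspace_scale)
    \<comment> \<open>Here it matters that the two leaf factors \<open>t\<close> and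
      \<open>t - 1\<close> differ by exactly 1.\<close>
    moreover have "a * t + c * (t - 1) = a" by (simp add: ac algebra_simps)
    ultimately have "u = kscale (- a) ?v" by (simp add: eq_neg_iff_add_eq_0)
    then show "\<exists>x\<in>kn 1. u = trunc 3 (A3 t [i, j] x) \<and> v = trunc 1 (A3 t [i, j, 0] x) \<and> w = trunc 1 (A3 t [i, j, 1] x)"
      using trunc_id[OF kvec.subspace_neg[OF subspace_kn kvec.subspace_scale[OF subspace_kn v3, of a]]]
      by (intro bexI[of _ "vec [- a]"]) (simp_all add: A23_simps vw' ac)
  next
    fix y :: "nat \<Rightarrow> 'k" assume y: "y \<in> kn 4"
    let ?z = "y - kscale (y 3) ?e"
    have "?z n = 0" if "n \<ge> 3" for n
    proof (cases "n = 3")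
      case False
      then have "n \<ge> 4" using that by simp
      then have "y n = 0" "?e n = 0" using y e4 unfolding kn_def by blast+
      then show ?thesis by (simp add: kscale_def del: vec.simps(2))
    qed (simp add: kscale_def)
    then have "?z \<in> kn 3" unfolding kn_def by blast
    then obtain x where x: "x \<in> kn 3" "?z = trunc 3 (?W x)"
      using wmap_surj[OF t2 3(2,3) order_refl order_refl] by blast
    \<comment> \<open>The arc \<open>[i, j, 0]\<close> provides coordinate 3 but also adds
      \<open>y 3 * t\<close> times the line, which is subtracted in advance.\<close>
    let ?u = "x - kscale (y 3 * t) ?v"
    have "?W ?u + A4 t [i, j, 0] (vec [y 3]) + A4 t [i, j, 1] (vec [0]) = ?W x + kscale (y 3) ?e"
      unfolding sum by simp
    also have "\<dots> = y" using x(2) W3[of x] by (simp add: diff_eq_eq del: vec.simps(2))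
    finally have "trunc 4 (A4 t [i, j] ?u + A4 t [i, j, 0] (vec [y 3]) + A4 t [i, j, 1] (vec [0])) = y"
      using y unfolding A4_simps(2) by simp
    moreover have "?u \<in> kn 3"
      by (rule kvec.subspace_diff[OF subspace_kn x(1) kvec.subspace_scale[OF subspace_kn v3]])
    ultimately show "\<exists>u\<in>kn 3. \<exists>v\<in>kn 1. \<exists>w\<in>kn 1. trunc 4 (A4 t [i, j] u + A4 t [i, j, 0] v + A4 t [i, j, 1] w) = y"
      by (intro bexI[of _ ?u] bexI[of _ "vec [y 3]"] bexI[of _ "vec [0]"]) simp_all
  qed (simp_all add: snk_def)
next
  case (5 i j k h)
  show ?thesis unfolding 5
    by (rule exact_dims_leaf[OF all_linear_A3 all_linear_A4, where c = 1]) (simp_all add: snk_def A4_simps D_long)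
next
  case 6
  then have "p \<noteq> []" by auto
  then have "length (snk True r) > 3" if "r \<in> star p" for r
    using length_snk_star[OF that, of True] 6 by linarith
  then show ?thesis
    using 6 by (intro exact_dims_zero[OF all_linear_A3 all_linear_A4]) (auto simp: D_long)
qed (use p in auto)

context coded_quiver
begin

lemma rspace_simple_at:
  assumes "v \<in> verts Q"
  shows "rspace (simple_at (w []) :: ('v, 'e, 'k::field) rep) v =
    rspace (model (\<lambda>_ _. 0) ((\<lambda>_. 0)([] := 1)) :: ('v, 'e, 'k) rep) v"
proof -
  obtain p where "p \<in> Adr" "v = w p" using assms by (auto simp: verts_eq)
  then show ?thesis by (auto simp: simple_at_def kn_def fun_eq_iff)
qed

lemma rmap_simple_at: "rmap (simple_at v) a x = 0"
  by (simp add: simple_at_def zero_fun_def)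

lemma is_rep_simple_at: "is_rep Q (simple_at (w []) :: ('v, 'e, 'k::field) rep)"
proof -
  let ?M = "simple_at (w []) :: ('v, 'e, 'k) rep"
  let ?N = "model (\<lambda>_ _. 0) ((\<lambda>_. 0)([] := 1)) :: ('v, 'e, 'k) rep"
  interpret wf_digraph Q by (rule wf)
  have N: "is_rep Q ?N"
    by (rule is_rep_model) (auto simp: all_linear_def linear_on_def finite_dims_def)
  have "linear_on kscale kscale (rspace ?M (tail Q a)) (rmap ?M a) \<and> rmap ?M a ` rspace ?M (tail Q a) \<subseteq> rspace ?M (head Q a)"
    if "a \<in> arcs Q" for a
    using kvec.subspace_0[OF is_rep_subspace[OF N head_in_verts[OF that]]] rspace_simple_at[OF head_in_verts[OF that], where 'k = 'k]
    by (auto simp: linear_on_def rmap_simple_at)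
  then show ?thesis
    using N rspace_simple_at[where 'k = 'k] unfolding is_rep_def by (simp cong: conj_cong)
qed

lemma rep_iso_simple_at:
  "\<exists>\<phi>. rep_iso Q (simple_at (w [])) (model (\<lambda>_ _. 0) ((\<lambda>_. 0)([] := 1)) :: ('v, 'e, 'k::field) rep) \<phi>"
proof -
  have "rmap (model (\<lambda>_ _. 0) ((\<lambda>_. 0)([] := 1)) :: ('v, 'e, 'k) rep) a x = 0" if "a \<in> arcs Q" for a x
    using that by (auto simp: arcs_eq)
  then have "rep_iso Q (simple_at (w [])) (model (\<lambda>_ _. 0) ((\<lambda>_. 0)([] := 1)) :: ('v, 'e, 'k) rep) (\<lambda>_. id)"
    unfolding rep_iso_def rep_hom_def
    by (simp add: rspace_simple_at rmap_simple_at linear_on_def)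
  then show ?thesis by blast
qed

end

lemma golden_ratio_exists: "\<exists>t::'k::alg_closed_field. t * t = t + 1"
proof -
  obtain t :: 'k where "poly [:-1, -1, 1:] t = 0"
    using alg_closed_imp_poly_has_root[of "[:-1, -1, 1 :: 'k:]"] by auto
  then show ?thesis by (intro exI[of _ t]) (simp add: algebra_simps eq_diff_eq)
qed

context tree_root
begin

lemma P_tilde_4_iso:
  fixes t :: "'k::field"
  assumes t2: "t * t = t + 1"
  shows "is_rep Q (P_tilde Q s 4 :: ('v, 'e, 'k) rep) \<and>
    (\<exists>\<phi>. rep_iso Q (P_tilde Q s 4) (coded_quiver.model Q vert edge False (A4 t) (top_dims UNIV UNIV)) \<phi>)"
proof -
  interpret C: coded_quiver Q vert edge False by (rule coded)
  interpret C': coded_quiver "opposite Q" vert edge True by (rule coded_opposite)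
  have t0: "t \<noteq> 0" using t2 by auto
  let ?P = "P_tilde Q s :: nat \<Rightarrow> ('v, 'e, 'k) rep"
  have lin: "all_linear (\<lambda>_ _. 0 :: nat \<Rightarrow> 'k)" "all_linear (\<lambda>_ x. x :: nat \<Rightarrow> 'k)"
    by (auto simp: all_linear_def linear_on_def)
  have fin: "finite_dims ((\<lambda>_. 0)([] := 1))" "finite_dims D1" "finite_dims D2" "finite_dims D3"
    "finite_dims (top_dims UNIV UNIV)"
    by (auto intro!: finite_dims_4 simp: D_long top_dims_def split: list.split)
  have sinks: "p \<in> Adr \<Longrightarrow> even (length p) \<noteq> False \<Longrightarrow> D1 p = ((\<lambda>_. 0)([] := 1)) p"
    "p \<in> Adr \<Longrightarrow> even (length p) \<noteq> True \<Longrightarrow> D2 p = D1 p"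
    "p \<in> Adr \<Longrightarrow> even (length p) \<noteq> False \<Longrightarrow> D3 p = D2 p"
    "p \<in> Adr \<Longrightarrow> even (length p) \<noteq> True \<Longrightarrow> top_dims UNIV UNIV p = D3 p" for p
    by ((cases rule: Adr_cases[of p]; auto simp: D_long top_dims_def split: list.split)[1])+
  have "vert [] = s" by simp
  then have "is_rep Q (?P 0) \<and> (\<exists>\<phi>. rep_iso Q (?P 0) (C.model (\<lambda>_ _. 0) ((\<lambda>_. 0)([] := 1))) \<phi>)"
    using C.is_rep_simple_at C.rep_iso_simple_at by simp
  from C.reflect_model[OF _ lin fin(1,2) sinks(1) exact_01 this]
  have "is_rep (opposite Q) (?P (Suc 0)) \<and>
      (\<exists>\<phi>. rep_iso (opposite Q) (?P (Suc 0)) (C'.model (\<lambda>_ x. x) D1) \<phi>)"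
    using coded_opposite by simp
  from C'.reflect_model[OF _ lin(2) all_linear_A2 fin(2,3) sinks(2) exact_12 this]
  have "is_rep Q (?P (Suc (Suc 0))) \<and> (\<exists>\<phi>. rep_iso Q (?P (Suc (Suc 0))) (C.model A2 D2) \<phi>)"
    using coded by simp
  from C.reflect_model[OF _ all_linear_A2 all_linear_A3 fin(3,4) sinks(3) exact_23[OF t0] this]
  have "is_rep (opposite Q) (?P (Suc (Suc (Suc 0)))) \<and>
      (\<exists>\<phi>. rep_iso (opposite Q) (?P (Suc (Suc (Suc 0)))) (C'.model (A3 t) D3) \<phi>)"
    using coded_opposite by simp
  from C'.reflect_model[OF _ all_linear_A3 all_linear_A4 fin(4,5) sinks(4) exact_34[OF t2] this]
  have "is_rep Q (?P (Suc (Suc (Suc (Suc 0))))) \<and>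
      (\<exists>\<phi>. rep_iso Q (?P (Suc (Suc (Suc (Suc 0))))) (C.model (A4 t) (top_dims UNIV UNIV)) \<phi>)"
    using coded by simp
  moreover have "4 = Suc (Suc (Suc (Suc 0)))" by simp
  ultimately show ?thesis by (simp only:)
qed

end

theorem proposition5p4p9:
  fixes Q :: "('v, 'e) pre_digraph" and s :: 'v
  assumes "universal_cover_3_Kronecker Q" and "is_sink Q s"
  shows "accessible Q (P_tilde Q s 4 :: ('v, 'e, 'k::alg_closed_field) rep)"
proof -
  interpret tree_root Q s by unfold_locales (fact assms)+
  interpret C: Q3_cover Q vert edge by (rule Q3_cover.intro) (rule coded)
  obtain t :: 'k where t: "t * t = t + 1" using golden_ratio_exists by blast
  obtain \<phi> where rep: "is_rep Q (P_tilde Q s 4 :: ('v, 'e, 'k) rep)"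
    and iso: "rep_iso Q (P_tilde Q s 4) (C.model (A4 t) (top_dims UNIV UNIV)) \<phi>"
    using P_tilde_4_iso[OF t] by blast
  \<comment> \<open>The outer sink that is added last, directly in \<open>P_tilde Q s 4\<close>. Its
    even length makes it a sink of \<open>Q\<close>.\<close>
  define p :: "nat list" where "p = [0, 0, 0, 0]"
  define T where "T = {r \<in> Adr. length r = 4}"
  have p: "p \<in> Adr" "even (length p) \<noteq> False" "p \<in> T" by (auto simp: p_def T_def)
  have T: "finite T" unfolding T_def by (rule finite_subset[OF _ finite_Adr_le[of 4]]) auto
  let ?D = "top_dims UNIV (T - {p})"
  \<comment> \<open>On addresses the dimension vector of \<open>P_tilde Q s 4\<close> is thus one
    step at \<open>p\<close> above the dimension vector \<open>?D\<close> of total dimension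
    75.\<close>
  have D: "top_dims UNIV UNIV r = (?D(p := Suc (?D p))) r" "top_dims UNIV UNIV r = top_dims UNIV T r"
    if "r \<in> Adr" for r
    using that p(1,3) by (cases rule: Adr_cases; auto simp: T_def top_dims_def split: list.split)+
  have "C.good (A4 t) (top_dims UNIV T)" "C.good (A4 t) ?D"
    using T by (auto intro!: C.good_76[OF t] simp: T_def)
  then have br: "brick_dims False (A4 t) (?D(p := Suc (?D p)))" and good: "C.good (A4 t) ?D"
    using brick_dims_cong[of "top_dims UNIV T" "?D(p := Suc (?D p))" False "A4 t"] D
    by (auto simp: C.good_def)
  have "rep_iso Q (P_tilde Q s 4) (C.model (A4 t) (?D(p := Suc (?D p)))) \<phi>"
    using iso C.model_cong[of "top_dims UNIV UNIV" "?D(p := Suc (?D p))" "A4 t", OF D(1)] by (simp only:)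
  from C.accessible_iso_sink[OF all_linear_A4 good p(1,2) br rep this] show ?thesis by simp
qed

end
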